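(* Let $\alpha\in(0,1]$, $s_{\alpha}:=\frac32+\frac14(1-\alpha)$, and let $\delta>0$ be small enough. Then there exist $k_\delta\in(1/2,1)$ and $c_\delta>0$ such that, for every $T>0$ and every smooth solution $w$ on $\mathbb R^2\times[0,T]$ of the linear equation $$w_t+D_x^{\alpha}w_x+\mathcal Hw_{yy}=F,$$ one has $$\|\partial_x w\|_{L^1_T L^\infty_{xy}}\leq c_\delta T^{k_\delta}\left(\|w\|_{L^\infty_T H^{s_{\alpha}+2\delta}_{xy}}+\int_0^T \|F(\cdot,t)\|_{H^{s_{\alpha}-1+2\delta}_{xy}}\, dt \right)$$ and $$\|\partial_y w\|_{L^1_T L^\infty_{xy}}\leq c_\delta T^{k_\delta}\left(\|w\|_{L^\infty_T H^{s_{\alpha}+2\delta}_{xy}}+\int_0^T \|F(\cdot,t)\|_{H^{s_{\alpha}-1+2\delta}_{xy}}\, dt \right).$$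
   Context: $D_x^{\alpha}$ and the Hilbert transform $\mathcal H$ in $x$ are defined through the Fourier transform in $(x,y)$ (dual variables $(\xi,\eta)$) by $\widehat{D_x^{\alpha}f}=|\xi|^{\alpha}\widehat f$ and $\widehat{\mathcal H f}=-i\,\mathrm{sgn}(\xi)\widehat f$. $H^s_{xy}=H^s(\mathbb R^2)$ is the usual $L^2$-based Sobolev space and $H^\infty(\mathbb R^2)=\bigcap_{s\in\mathbb R}H^s(\mathbb R^2)$. "Smooth solution" means that $w$ and $F$ belong to $C([0,T];H^\infty(\mathbb R^2))$ and the equation holds. Notation: $\|f\|_{L^p_TX}=\bigl(\int_0^T\|f(t)\|_X^p\,dt\bigr)^{1/p}$ (essential supremum over $[0,T]$ if $p=\infty$), and $L^\infty_{xy}=L^\infty(\mathbb R^2)$. "$\delta$ small enough" means $0<\delta<\delta_0$ for some $\delta_0=\delta_0(\alpha)>0$. *)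

theory Defs
  imports "HOL-Analysis.Analysis" "HOL-Probability.Essential_Supremum"
begin

(* Functions on the plane are complex valued; real valued functions are a special case.
   All norms take values in ennreal, so that no convention for divergent integrals enters. *)

type_synonym plane = "real \<times> real"

definition esqrt :: "ennreal \<Rightarrow> ennreal" where
  "esqrt x = (if x = \<infinity> then \<infinity> else ennreal (sqrt (enn2real x)))"

definition L2_norm :: "(plane \<Rightarrow> complex) \<Rightarrow> ennreal" where
  "L2_norm f = esqrt (\<integral>\<^sup>+ z. ennreal ((norm (f z))\<^sup>2) \<partial>lborel)"

definition L2 :: "(plane \<Rightarrow> complex) set" where
  "L2 = {f. f \<in> borel_measurable lborel \<and> L2_norm f < \<infinity>}"

definition Linf_norm :: "(plane \<Rightarrow> complex) \<Rightarrow> ennreal" where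
  "Linf_norm f = esssup lborel (\<lambda>z. ennreal (norm (f z)))"

(* The kernel is exp(-i(x xi + y eta)), so that d/dx has symbol i xi. The factor 1/(2 pi) makes
   the transform unitary on L2. *)
definition fourier_integral :: "(plane \<Rightarrow> complex) \<Rightarrow> plane \<Rightarrow> complex" where
  "fourier_integral f \<zeta> =
     complex_of_real (1 / (2 * pi)) * (LINT z|lborel. cis (- (z \<bullet> \<zeta>)) * f z)"

(* Plancherel: the transform of an L2 function is the L2 limit of the Fourier integrals
   of its truncations to balls. *)
definition is_fourier :: "(plane \<Rightarrow> complex) \<Rightarrow> (plane \<Rightarrow> complex) \<Rightarrow> bool" where
  "is_fourier f g \<longleftrightarrow> f \<in> L2 \<and> g \<in> L2 \<and>
     (\<lambda>n::nat. L2_norm (\<lambda>\<zeta>.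
        fourier_integral (\<lambda>z. if norm z \<le> real n then f z else 0) \<zeta> - g \<zeta>)) \<longlonglongrightarrow> 0"

(* Determined up to a null set; everything below depends only on the class modulo null sets. *)
definition fourier :: "(plane \<Rightarrow> complex) \<Rightarrow> plane \<Rightarrow> complex" where
  "fourier f = (SOME g. is_fourier f g)"

definition fourier_multiplier ::
    "(plane \<Rightarrow> complex) \<Rightarrow> (plane \<Rightarrow> complex) \<Rightarrow> plane \<Rightarrow> complex" where
  "fourier_multiplier m f = (SOME g. is_fourier g (\<lambda>\<zeta>. m \<zeta> * fourier f \<zeta>))"

definition frac_deriv_x :: "real \<Rightarrow> (plane \<Rightarrow> complex) \<Rightarrow> plane \<Rightarrow> complex" where
  "frac_deriv_x \<alpha> = fourier_multiplier (\<lambda>(\<xi>, \<eta>). complex_of_real (\<bar>\<xi>\<bar> powr \<alpha>))"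

definition hilbert_x :: "(plane \<Rightarrow> complex) \<Rightarrow> plane \<Rightarrow> complex" where
  "hilbert_x = fourier_multiplier (\<lambda>(\<xi>, \<eta>). - \<i> * complex_of_real (sgn \<xi>))"

(* The usual Sobolev norm for s >= 0; negative s would require tempered distributions
   outside L2 and is not used. *)
definition sobolev_norm :: "real \<Rightarrow> (plane \<Rightarrow> complex) \<Rightarrow> ennreal" where
  "sobolev_norm s f = (if f \<in> L2
     then esqrt (\<integral>\<^sup>+ \<zeta>. ennreal ((1 + (norm \<zeta>)\<^sup>2) powr s * (norm (fourier f \<zeta>))\<^sup>2) \<partial>lborel)
     else \<infinity>)"

definition sobolev :: "real \<Rightarrow> (plane \<Rightarrow> complex) set" where
  "sobolev s = {f \<in> L2. sobolev_norm s f < \<infinity>}"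

(* Every class in the intersection of all Sobolev spaces has exactly one continuous
   representative, and that one is smooth; it stands for the class, so that classical
   partial derivatives make sense. Since the spaces decrease in s, only s >= 0 matters. *)
definition H_infinity :: "(plane \<Rightarrow> complex) set" where
  "H_infinity = {f. continuous_on UNIV f \<and> (\<forall>s\<ge>0. f \<in> sobolev s)}"

definition partial_x :: "(plane \<Rightarrow> complex) \<Rightarrow> plane \<Rightarrow> complex" where
  "partial_x f = (\<lambda>(x, y). vector_derivative (\<lambda>u. f (u, y)) (at x))"

definition partial_y :: "(plane \<Rightarrow> complex) \<Rightarrow> plane \<Rightarrow> complex" where
  "partial_y f = (\<lambda>(x, y). vector_derivative (\<lambda>u. f (x, u)) (at y))"

(* Continuity for the Frechet topology of H_infinity, i.e. in every Sobolev norm. *)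
definition C_H_infinity :: "real \<Rightarrow> (real \<Rightarrow> plane \<Rightarrow> complex) \<Rightarrow> bool" where
  "C_H_infinity T u \<longleftrightarrow> (\<forall>t\<in>{0..T}. u t \<in> H_infinity \<and>
     (\<forall>s\<ge>0. ((\<lambda>\<tau>. sobolev_norm s (\<lambda>z. u \<tau> z - u t z)) \<longlongrightarrow> 0) (at t within {0..T})))"

definition has_L2_time_derivative ::
    "(real \<Rightarrow> plane \<Rightarrow> complex) \<Rightarrow> (plane \<Rightarrow> complex) \<Rightarrow> real \<Rightarrow> real set \<Rightarrow> bool" where
  "has_L2_time_derivative u v t S \<longleftrightarrow> v \<in> L2 \<and>
     ((\<lambda>\<tau>. L2_norm (\<lambda>z. (u \<tau> z - u t z) / complex_of_real (\<tau> - t) - v z)) \<longlongrightarrow> 0) (at t within S)"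

(* w_t + D_x^alpha w_x + H w_yy = F on [0,T]. The time derivative is the L2 limit of difference
   quotients, one-sided at 0 and T. By the equation and the continuity of w and F, the limit
   then exists in every Sobolev norm. *)
definition smooth_solution ::
    "real \<Rightarrow> real \<Rightarrow> (real \<Rightarrow> plane \<Rightarrow> complex) \<Rightarrow> (real \<Rightarrow> plane \<Rightarrow> complex) \<Rightarrow> bool" where
  "smooth_solution \<alpha> T w F \<longleftrightarrow> C_H_infinity T w \<and> C_H_infinity T F \<and>
     (\<exists>w\<^sub>t. \<forall>t\<in>{0..T}. has_L2_time_derivative w (w\<^sub>t t) t {0..T} \<and>
        (AE z in lborel. w\<^sub>t t z + frac_deriv_x \<alpha> (partial_x (w t)) z
           + hilbert_x (partial_y (partial_y (w t))) z = F t z))"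

definition L1_time_norm ::
    "real \<Rightarrow> ((plane \<Rightarrow> complex) \<Rightarrow> ennreal) \<Rightarrow> (real \<Rightarrow> plane \<Rightarrow> complex) \<Rightarrow> ennreal" where
  "L1_time_norm T N u = (\<integral>\<^sup>+ t\<in>{0..T}. N (u t) \<partial>lborel)"

definition Linf_time_norm ::
    "real \<Rightarrow> ((plane \<Rightarrow> complex) \<Rightarrow> ennreal) \<Rightarrow> (real \<Rightarrow> plane \<Rightarrow> complex) \<Rightarrow> ennreal" where
  "Linf_time_norm T N u = esssup (restrict_space lborel {0..T}) (\<lambda>t. N (u t))"

definition s_crit :: "real \<Rightarrow> real" where
  "s_crit \<alpha> = 3 / 2 + 1 / 4 * (1 - \<alpha>)"

end

theory Submission
  imports Defs "HOL-Probability.Probability"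
begin

text \<open>
  On the Fourier side conjugation with the free group turns the equation into \<open>v' = exp (i t \<omega>) F\<close>, where
  \<open>\<omega> (\<xi>, \<eta>) = \<xi> |\<xi>|^\<alpha> + sgn \<xi> * \<eta>^2\<close>. Cut the frequencies sharply into dyadic square shells of size \<open>2^j\<close>. By
  van der Corput's second derivative test, in \<open>\<xi>\<close> and in \<open>\<eta>\<close> separately, the kernel of the group on a shell is
  bounded by a multiple of \<open>2^(j (1 - \<alpha>) / 2) / |t|\<close>, and trivially by a multiple of \<open>4^j\<close>; interpolating the two
  bounds gives the locally integrable power \<open>|t|^(2 \<delta> - 1)\<close>. The \<open>T T\<^sup>*\<close> argument then needs only Schur's test and
  bounds the \<open>L\<^sup>1\<close> norm in time of the supremum in space, on an interval of length \<open>L\<close>, with the factor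
  \<open>L^(1/2 + \<delta>)\<close>. On the \<open>j\<close>-th shell it is applied with Duhamel's formula on \<open>2^j\<close> intervals of length \<open>T / 2^j\<close>;
  this balances the data against the force and produces the regularity \<open>s_crit \<alpha> + 2 \<delta>\<close>, with \<open>2^(- \<delta> j)\<close> to
  spare for the sum over the shells.
\<close>

section \<open>Square-integrable functions on the plane\<close>

text \<open>Duality for the L1 norm in time of a supremum in space would call for measurable
  selections and for a separate device for the retarded force term. Sampling avoids both: the time
  integral is bounded by a finite sum over cells, each supremum is replaced by the value at a nearly
  optimal point, and the dual objects become finite sums of plane waves with coefficients of modulus
  at most 1. The restriction s \<le> \<tau> in Duhamel's formula only sets some coefficients to 0,
  so data and force obey the same bound, and the cell size tends to 0 at the end. Squares serve for
  the frequency cut because on each half of a square the phase is a function of \<xi> plus a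
  function of \<eta>, so that the kernel is a sum of products of one-dimensional oscillatory
  integrals. Van der Corput's bound needs no amplitude that vanishes at the ends of the interval, so
  a sharp cut costs nothing. The bound 1/|t| alone fails logarithmically to be integrable at 0;
  hence the interpolation, the loss of 2 * \<delta> derivatives and constants that blow up as
  \<delta> tends to 0.\<close>

definition l2 :: "(plane \<Rightarrow> complex) \<Rightarrow> real" where
  "l2 f = sqrt (LINT z|lborel. (norm (f z))\<^sup>2)"

lemma l2_nonneg [simp]: "0 \<le> l2 f"
  by (simp add: l2_def)

lemma l2_square: "(l2 f)\<^sup>2 = (LINT z|lborel. (norm (f z))\<^sup>2)"
  by (simp add: l2_def)

lemma esqrt_less_infty [simp]: "esqrt x < \<infinity> \<longleftrightarrow> x < \<infinity>"
  by (auto simp: esqrt_def less_top)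

lemma L2_iff: "f \<in> L2 \<longleftrightarrow> f \<in> borel_measurable lborel \<and> integrable lborel (\<lambda>z. (norm (f z))\<^sup>2)"
  unfolding L2_def L2_norm_def esqrt_less_infty
  by (auto simp: integrable_iff_bounded)

lemma L2_measurable: "f \<in> L2 \<Longrightarrow> f \<in> borel_measurable borel"
  by (simp add: L2_iff)

lemma L2_square_integrable: "f \<in> L2 \<Longrightarrow> integrable lborel (\<lambda>z. (norm (f z))\<^sup>2)"
  by (simp add: L2_iff)

text \<open>From here on the norms are real: \<open>l2\<close> is built on a Bochner integral and
  falls back to 0 when the square is not integrable, so it stands for the norm only together with
  membership in \<open>L2\<close>. This is why membership accompanies most estimates.\<close>

lemma L2_norm_eq: "f \<in> L2 \<Longrightarrow> L2_norm f = ennreal (l2 f)"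
  unfolding L2_norm_def l2_def
  by (subst nn_integral_eq_integral) (auto simp: esqrt_def L2_iff)

lemma L2_I:
  assumes "f \<in> borel_measurable borel" "(\<integral>\<^sup>+ z. ennreal ((norm (f z))\<^sup>2) \<partial>lborel) \<le> ennreal B"
  shows "f \<in> L2"
  using assms le_less_trans[OF assms(2) ennreal_less_top]
  by (simp add: L2_def L2_norm_def esqrt_less_infty[unfolded infinity_ennreal_def])

lemma nn_integral_L2: "f \<in> L2 \<Longrightarrow> (\<integral>\<^sup>+ z. ennreal ((norm (f z))\<^sup>2) \<partial>lborel) = ennreal ((l2 f)\<^sup>2)"
  unfolding l2_square by (subst nn_integral_eq_integral) (auto simp: L2_iff)

lemma l2_le:
  assumes "f \<in> borel_measurable borel" "(\<integral>\<^sup>+ z. ennreal ((norm (f z))\<^sup>2) \<partial>lborel) \<le> ennreal (B\<^sup>2)" "0 \<le> B"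
  shows "l2 f \<le> B"
proof -
  have "f \<in> L2" using L2_I assms by blast
  then have "ennreal ((l2 f)\<^sup>2) \<le> ennreal (B\<^sup>2)" using nn_integral_L2 assms by simp
  then have "(l2 f)\<^sup>2 \<le> B\<^sup>2" by simp
  then show ?thesis using assms(3) by (rule power2_le_imp_le)
qed

lemma L2_dominated:
  assumes "f \<in> L2" "g \<in> borel_measurable borel" "\<And>z. norm (g z) \<le> C * norm (f z)"
  shows "g \<in> L2" "0 \<le> C \<Longrightarrow> l2 g \<le> C * l2 f"
proof -
  have le: "(norm (g z))\<^sup>2 \<le> C\<^sup>2 * (norm (f z))\<^sup>2" for z
    using power_mono[OF assms(3)[of z], of 2] by (simp add: power_mult_distrib)
  have i: "integrable lborel (\<lambda>z. C\<^sup>2 * (norm (f z))\<^sup>2)"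
    using L2_square_integrable[OF assms(1)] by simp
  have i2: "integrable lborel (\<lambda>z. (norm (g z))\<^sup>2)"
    by (rule Bochner_Integration.integrable_bound[OF i]) (use le assms(2) in auto)
  then show "g \<in> L2" using assms(2) by (simp add: L2_iff)
  assume "0 \<le> C"
  have "(l2 g)\<^sup>2 \<le> (LINT z|lborel. C\<^sup>2 * (norm (f z))\<^sup>2)"
    unfolding l2_square by (rule integral_mono[OF i2 i]) (use le in auto)
  then have "(l2 g)\<^sup>2 \<le> (C * l2 f)\<^sup>2" by (simp add: l2_square power_mult_distrib)
  then show "l2 g \<le> C * l2 f" using \<open>0 \<le> C\<close> by (meson l2_nonneg mult_nonneg_nonneg power2_le_imp_le)
qed

lemma L2_mono:
  assumes "f \<in> L2" "g \<in> borel_measurable borel" "\<And>z. norm (g z) \<le> norm (f z)"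
  shows "g \<in> L2" "l2 g \<le> l2 f"
  using L2_dominated[of f g 1] assms by auto

lemma L2_cmult: "f \<in> L2 \<Longrightarrow> (\<lambda>z. c * f z) \<in> L2"
  by (rule L2_dominated(1)[of f _ "norm c"]) (auto simp: norm_mult L2_iff)

lemma l2_cmult: "l2 (\<lambda>z. c * f z) = norm c * l2 f"
  by (simp add: l2_def norm_mult power_mult_distrib real_sqrt_mult)

lemma l2_minus_commute: "l2 (\<lambda>z. f z - g z) = l2 (\<lambda>z. g z - f z)"
  by (simp add: l2_def norm_minus_commute)

lemma L2_add: 
  assumes "f \<in> L2" "g \<in> L2" shows "(\<lambda>z. f z + g z) \<in> L2"
proof -
  have m: "f \<in> borel_measurable borel" "g \<in> borel_measurable borel" using assms by (auto simp: L2_iff)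
  have le: "(norm (f z + g z))\<^sup>2 \<le> 2 * (norm (f z))\<^sup>2 + 2 * (norm (g z))\<^sup>2" for z
  proof -
    have "(norm (f z + g z))\<^sup>2 \<le> (norm (f z) + norm (g z))\<^sup>2"
      by (intro power_mono norm_triangle_ineq) auto
    also have "\<dots> \<le> 2 * (norm (f z))\<^sup>2 + 2 * (norm (g z))\<^sup>2"
      using sum_squares_bound[of "norm (f z)" "norm (g z)"] by (simp add: power2_sum)
    finally show ?thesis .
  qed
  have i: "integrable lborel (\<lambda>z. 2 * (norm (f z))\<^sup>2 + 2 * (norm (g z))\<^sup>2)"
    using assms by (auto simp: L2_iff)
  have "integrable lborel (\<lambda>z. (norm (f z + g z))\<^sup>2)"
    by (rule Bochner_Integration.integrable_bound[OF i]) (use le m in auto)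
  then show ?thesis using m by (simp add: L2_iff)
qed

lemma L2_uminus: "f \<in> L2 \<Longrightarrow> (\<lambda>z. - f z) \<in> L2"
  using L2_cmult[of f "-1"] by simp

lemma L2_diff: "f \<in> L2 \<Longrightarrow> g \<in> L2 \<Longrightarrow> (\<lambda>z. f z - g z) \<in> L2"
  using L2_add[OF _ L2_uminus, of f g] by simp

lemma L2_zero [simp]: "(\<lambda>z. 0) \<in> L2"
  by (simp add: L2_iff)

lemma L2_AE_cong:
  assumes "f \<in> L2" "g \<in> borel_measurable borel" "AE z in lborel. f z = g z"
  shows "g \<in> L2"
proof -
  have "AE z in lborel. (norm (f z))\<^sup>2 = (norm (g z))\<^sup>2" using assms(3) by eventually_elim auto
  then show ?thesis
    using assms by (auto simp: L2_iff intro: integrable_cong_AE_imp)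
qed

lemma l2_AE_cong:
  assumes "f \<in> borel_measurable borel" "g \<in> borel_measurable borel" "AE z in lborel. f z = g z"
  shows "l2 f = l2 g"
proof -
  have "AE z in lborel. (norm (f z))\<^sup>2 = (norm (g z))\<^sup>2" using assms(3) by eventually_elim auto
  then have "(LINT z|lborel. (norm (f z))\<^sup>2) = (LINT z|lborel. (norm (g z))\<^sup>2)"
    using assms by (intro integral_cong_AE) auto
  then show ?thesis by (simp add: l2_def)
qed

lemma L2_norm_mult_integrable:
  assumes "f \<in> L2" "g \<in> L2"
  shows "integrable lborel (\<lambda>z. norm (f z) * norm (g z))"
proof -
  have m: "f \<in> borel_measurable borel" "g \<in> borel_measurable borel" using assms by (auto simp: L2_iff)
  have i: "integrable lborel (\<lambda>z. (norm (f z))\<^sup>2 + (norm (g z))\<^sup>2)"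
    using assms by (auto simp: L2_iff)
  have "norm (f z) * norm (g z) \<le> (norm (f z))\<^sup>2 + (norm (g z))\<^sup>2" for z
    using sum_squares_bound[of "norm (f z)" "norm (g z)"] mult_nonneg_nonneg[OF norm_ge_zero[of "f z"] norm_ge_zero[of "g z"]]
    by linarith
  then show ?thesis
    by (intro Bochner_Integration.integrable_bound[OF i]) (use m in auto)
qed

lemma L2_mult_integrable:
  assumes "f \<in> L2" "g \<in> L2"
  shows "integrable lborel (\<lambda>z. f z * g z)"
  using L2_norm_mult_integrable[OF assms] assms
  by (subst integrable_norm_iff[symmetric]) (auto simp: norm_mult L2_iff)

lemma Cauchy_Schwarz_l2:
  assumes "f \<in> L2" "g \<in> L2"
  shows "(LINT z|lborel. norm (f z) * norm (g z)) \<le> l2 f * l2 g"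
proof -
  have m: "f \<in> borel_measurable borel" "g \<in> borel_measurable borel" using assms by (auto simp: L2_iff)
  have "(\<integral>\<^sup>+ z. ennreal (norm (f z)) * ennreal (norm (g z)) \<partial>lborel)\<^sup>2
     \<le> (\<integral>\<^sup>+ z. (ennreal (norm (f z)))\<^sup>2 \<partial>lborel) * (\<integral>\<^sup>+ z. (ennreal (norm (g z)))\<^sup>2 \<partial>lborel)"
    by (rule Cauchy_Schwarz_nn_integral) (use m in auto)
  also have "\<dots> = ennreal ((l2 f)\<^sup>2) * ennreal ((l2 g)\<^sup>2)"
    using nn_integral_L2[OF assms(1)] nn_integral_L2[OF assms(2)] by (simp add: ennreal_power)
  also have "(\<integral>\<^sup>+ z. ennreal (norm (f z)) * ennreal (norm (g z)) \<partial>lborel)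
      = ennreal (LINT z|lborel. norm (f z) * norm (g z))"
    by (simp add: ennreal_mult[symmetric] nn_integral_eq_integral L2_norm_mult_integrable[OF assms])
  finally have "(LINT z|lborel. norm (f z) * norm (g z))\<^sup>2 \<le> (l2 f * l2 g)\<^sup>2"
    by (simp add: ennreal_power ennreal_mult[symmetric] power_mult_distrib)
  then show ?thesis by (rule power2_le_imp_le) simp
qed

lemma Cauchy_Schwarz_l2_integral:
  assumes "f \<in> L2" "g \<in> L2"
  shows "norm (LINT z|lborel. f z * g z) \<le> l2 f * l2 g"
  using integral_norm_bound[of lborel "\<lambda>z. f z * g z"] Cauchy_Schwarz_l2[OF assms]
  by (simp add: norm_mult)

lemma l2_triangle:
  assumes "f \<in> L2" "g \<in> L2"
  shows "l2 (\<lambda>z. f z + g z) \<le> l2 f + l2 g"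
proof -
  have i: "integrable lborel (\<lambda>z. (norm (f z))\<^sup>2 + 2 * (norm (f z) * norm (g z)) + (norm (g z))\<^sup>2)"
    using assms L2_norm_mult_integrable[OF assms] by (auto simp: L2_iff)
  have le: "(norm (f z + g z))\<^sup>2 \<le> (norm (f z))\<^sup>2 + 2 * (norm (f z) * norm (g z)) + (norm (g z))\<^sup>2" for z
    using power_mono[OF norm_triangle_ineq[of "f z" "g z"], of 2] by (simp add: power2_sum algebra_simps)
  have "(l2 (\<lambda>z. f z + g z))\<^sup>2 
      \<le> (LINT z|lborel. (norm (f z))\<^sup>2 + 2 * (norm (f z) * norm (g z)) + (norm (g z))\<^sup>2)"
    unfolding l2_square
    by (rule integral_mono[OF _ i]) (use le L2_add[OF assms] in \<open>auto simp: L2_iff\<close>)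
  also have "\<dots> = (l2 f)\<^sup>2 + 2 * (LINT z|lborel. norm (f z) * norm (g z)) + (l2 g)\<^sup>2"
    using assms L2_norm_mult_integrable[OF assms] by (simp add: l2_square L2_iff)
  also have "\<dots> \<le> (l2 f + l2 g)\<^sup>2"
    using Cauchy_Schwarz_l2[OF assms] by (simp add: power2_sum)
  finally show ?thesis by (rule power2_le_imp_le) simp
qed

lemma l2_triangle_diff:
  assumes "f \<in> L2" "g \<in> L2" "h \<in> L2"
  shows "l2 (\<lambda>z. f z - h z) \<le> l2 (\<lambda>z. f z - g z) + l2 (\<lambda>z. g z - h z)"
  using l2_triangle[OF L2_diff[OF assms(1,2)] L2_diff[OF assms(2,3)]] by simp

lemma l2_le_diff:
  assumes "f \<in> L2" "g \<in> L2"
  shows "l2 f \<le> l2 g + l2 (\<lambda>z. f z - g z)"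
  using l2_triangle_diff[of f g "\<lambda>z. 0"] assms by simp

lemma l2_abs_diff_le:
  assumes "f \<in> L2" "g \<in> L2"
  shows "\<bar>l2 f - l2 g\<bar> \<le> l2 (\<lambda>z. f z - g z)"
  using l2_le_diff[OF assms] l2_le_diff[OF assms(2,1)] l2_minus_commute[of f g] by linarith

lemma l2_eq_0_imp_AE:
  assumes "f \<in> L2" "l2 f = 0"
  shows "AE z in lborel. f z = 0"
proof -
  have "(LINT z|lborel. (norm (f z))\<^sup>2) = 0" using assms(2) by (simp add: l2_def)
  then have "AE z in lborel. (norm (f z))\<^sup>2 = 0"
    using assms by (subst (asm) integral_nonneg_eq_0_iff_AE) (auto simp: L2_iff)
  then show ?thesis by auto
qed

lemma tendsto_L2_norm_iff:
  assumes "eventually (\<lambda>n. f n \<in> L2) G"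
  shows "((\<lambda>n. L2_norm (f n)) \<longlongrightarrow> 0) G \<longleftrightarrow> ((\<lambda>n. l2 (f n)) \<longlongrightarrow> 0) G"
proof -
  have "((\<lambda>n. L2_norm (f n)) \<longlongrightarrow> 0) G \<longleftrightarrow> ((\<lambda>n. ennreal (l2 (f n))) \<longlongrightarrow> ennreal 0) G"
    unfolding ennreal_0
    by (rule tendsto_cong) (use assms L2_norm_eq in \<open>auto elim: eventually_mono\<close>)
  also have "\<dots> \<longleftrightarrow> ((\<lambda>n. l2 (f n)) \<longlongrightarrow> 0) G"
    by (subst tendsto_ennreal_iff) auto
  finally show ?thesis .
qed

text \<open>Along a subsequence with \<open>l2\<close>-increments below \<open>4\<^sup>-\<^sup>k\<close> the weighted sum of the squared
  increments has finite integral, so the increments are almost everywhere geometrically small.\<close>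

lemma L2_complete:
  assumes L2: "\<And>n::nat. f n \<in> L2"
    and Cauchy: "\<And>e. 0 < e \<Longrightarrow> \<exists>N. \<forall>m\<ge>N. \<forall>n\<ge>N. l2 (\<lambda>z. f m z - f n z) < e"
  obtains g where "g \<in> L2" "(\<lambda>n. l2 (\<lambda>z. f n z - g z)) \<longlonglongrightarrow> 0"
proof -
  have m [measurable]: "f n \<in> borel_measurable borel" for n using L2 L2_measurable by blast
  have "\<exists>N. \<forall>k. (\<forall>m\<ge>N k. \<forall>n\<ge>N k. l2 (\<lambda>z. f m z - f n z) < (1/4)^k)"
    using Cauchy by (intro choice allI) simp
  then obtain N where N: "\<And>k m n. N k \<le> m \<Longrightarrow> N k \<le> n \<Longrightarrow> l2 (\<lambda>z. f m z - f n z) < (1/4)^k" by blast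
  define r where "r k = (\<Sum>i\<le>k. N i) + k" for k
  have r_mono: "r k \<le> r (Suc k)" for k by (simp add: r_def)
  then have r_mono': "i \<le> j \<Longrightarrow> r i \<le> r j" for i j by (rule lift_Suc_mono_le)
  have r_ge: "N k \<le> r k" for k by (auto simp: r_def intro!: trans_le_add1 member_le_sum)
  have r_k: "k \<le> r k" for k by (simp add: r_def)
  define d where "d k z = f (r (Suc k)) z - f (r k) z" for k z
  have dm [measurable]: "d k \<in> borel_measurable borel" for k unfolding d_def by measurable
  have dL: "d k \<in> L2" for k unfolding d_def[abs_def] by (intro L2_diff L2)
  have dsmall: "l2 (d k) \<le> (1/4)^k" for k
    unfolding d_def[abs_def] by (rule less_imp_le, rule N) (use r_ge r_mono in \<open>auto intro: order_trans\<close>)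
  have "(\<integral>\<^sup>+ z. (\<Sum>k. ennreal (4^k * (norm (d k z))\<^sup>2)) \<partial>lborel)
      = (\<Sum>k. \<integral>\<^sup>+ z. ennreal (4^k * (norm (d k z))\<^sup>2) \<partial>lborel)"
    by (rule nn_integral_suminf) measurable
  also have "\<dots> = (\<Sum>k. ennreal (4^k * (l2 (d k))\<^sup>2))"
    by (simp add: ennreal_mult nn_integral_cmult nn_integral_L2[OF dL])
  also have "\<dots> \<le> (\<Sum>k. ennreal ((1/4)^k))"
  proof (rule suminf_le)
    fix k
    have "4^k * (l2 (d k))\<^sup>2 \<le> 4^k * ((1/4)^k)\<^sup>2"
      by (intro mult_left_mono power_mono dsmall) auto
    also have "\<dots> = (1/4::real)^k" by (simp add: power2_eq_square power_one_over)
    finally show "ennreal (4^k * (l2 (d k))\<^sup>2) \<le> ennreal ((1/4)^k)" by (rule ennreal_leI)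
  qed auto
  also have "\<dots> = ennreal (\<Sum>k. (1/4)^k)" by (rule suminf_ennreal2) auto
  finally have fin: "(\<integral>\<^sup>+ z. (\<Sum>k. ennreal (4^k * (norm (d k z))\<^sup>2)) \<partial>lborel) \<noteq> \<infinity>"
    by (auto simp: top_unique)
  have fin_AE: "AE z in lborel. (\<Sum>k. ennreal (4^k * (norm (d k z))\<^sup>2)) \<noteq> \<infinity>"
    by (rule nn_integral_noteq_infinite[OF _ fin]) measurable
  have cv: "convergent (\<lambda>k. f (r k) z)" if "(\<Sum>k. ennreal (4^k * (norm (d k z))\<^sup>2)) \<noteq> \<infinity>" for z
  proof -
    have s: "summable (\<lambda>k. 4^k * (norm (d k z))\<^sup>2)"
      by (rule summable_suminf_not_top) (use that in auto)
    then obtain B where B: "\<And>k. 4^k * (norm (d k z))\<^sup>2 \<le> B"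
      using summable_imp_Bseq by (fastforce simp: Bseq_def)
    have "B \<ge> 0" using order_trans[OF _ B[of 0]] by simp
    have "norm (d k z) \<le> sqrt B * (1/2)^k" for k
    proof -
      have "(2^k * norm (d k z))\<^sup>2 \<le> B" using B[of k] by (simp add: power_mult_distrib power_mult[symmetric] mult.commute[of k 2] power_mult)
      then have "2^k * norm (d k z) \<le> sqrt B" by (rule real_le_rsqrt)
      then show ?thesis by (simp add: field_simps power_one_over)
    qed
    moreover have "summable (\<lambda>k. sqrt B * (1/2::real)^k)" by (intro summable_mult summable_geometric) simp
    ultimately have "summable (\<lambda>k. d k z)" by (rule summable_comparison_test'[rotated])
    then have "convergent (\<lambda>n. \<Sum>k<n. d k z)" by (simp add: summable_iff_convergent)
    moreover have "(\<Sum>k<n. d k z) = f (r n) z - f (r 0) z" for n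
      unfolding d_def by (rule sum_lessThan_telescope)
    ultimately have "convergent (\<lambda>n. f (r n) z - f (r 0) z)" by simp
    then show ?thesis by (simp add: convergent_diff_const_right_iff)
  qed
  have conv: "AE z in lborel. convergent (\<lambda>k. f (r k) z)" using fin_AE by (rule eventually_mono) (rule cv)
  \<comment> \<open>Where the subsequence diverges, the value of \<open>lim\<close> is irrelevant:
    this happens on a null set only.\<close>
  define g where "g z = lim (\<lambda>k. f (r k) z)" for z
  have gm [measurable]: "g \<in> borel_measurable borel" unfolding g_def[abs_def] by (rule borel_measurable_lim_metric) measurable
  have lim: "AE z in lborel. (\<lambda>k. f (r k) z) \<longlonglongrightarrow> g z"
    using conv by eventually_elim (simp add: g_def convergent_LIMSEQ_iff)
  \<comment> \<open>Fatou along the subsequence passes the Cauchy bound to the limit function. It is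
    used with e = 1 for the membership of \<open>g\<close>, and with arbitrarily small e for the
    convergence.\<close>
  have fatou: "(\<integral>\<^sup>+ z. ennreal ((norm (f n z - g z))\<^sup>2) \<partial>lborel) \<le> ennreal (e\<^sup>2)"
    if "0 < e" "\<And>m. m \<ge> M \<Longrightarrow> l2 (\<lambda>z. f n z - f m z) < e" for n e M
  proof -
    have "(\<integral>\<^sup>+ z. ennreal ((norm (f n z - g z))\<^sup>2) \<partial>lborel)
       = (\<integral>\<^sup>+ z. liminf (\<lambda>k. ennreal ((norm (f n z - f (r k) z))\<^sup>2)) \<partial>lborel)"
    proof (rule nn_integral_cong_AE)
      show "AE z in lborel. ennreal ((norm (f n z - g z))\<^sup>2) = liminf (\<lambda>k. ennreal ((norm (f n z - f (r k) z))\<^sup>2))"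
        using lim
      proof eventually_elim
        case (elim z)
        then have "(\<lambda>k. ennreal ((norm (f n z - f (r k) z))\<^sup>2)) \<longlonglongrightarrow> ennreal ((norm (f n z - g z))\<^sup>2)"
          by (intro tendsto_intros)
        then show ?case by (intro lim_imp_Liminf[symmetric]) auto
      qed
    qed
    also have "\<dots> \<le> liminf (\<lambda>k. \<integral>\<^sup>+ z. ennreal ((norm (f n z - f (r k) z))\<^sup>2) \<partial>lborel)"
      by (rule nn_integral_liminf) measurable
    also have "\<dots> \<le> liminf (\<lambda>k. ennreal (e\<^sup>2))"
    proof (rule Liminf_mono)
      show "\<forall>\<^sub>F k in sequentially. (\<integral>\<^sup>+ z. ennreal ((norm (f n z - f (r k) z))\<^sup>2) \<partial>lborel) \<le> ennreal (e\<^sup>2)"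
        using eventually_ge_at_top[of M]
      proof eventually_elim
        case (elim k)
        then have "r k \<ge> M" using r_k[of k] by linarith
        then have "l2 (\<lambda>z. f n z - f (r k) z) \<le> e" using that(2) less_imp_le by blast
        then have "(l2 (\<lambda>z. f n z - f (r k) z))\<^sup>2 \<le> e\<^sup>2" by (intro power_mono) auto
        then show ?case using nn_integral_L2[OF L2_diff[OF L2 L2]] by (auto intro: ennreal_leI)
      qed
    qed
    also have "\<dots> = ennreal (e\<^sup>2)" by (simp add: Liminf_const)
    finally show ?thesis .
  qed
  obtain N1 where N1: "\<And>m n. N1 \<le> m \<Longrightarrow> N1 \<le> n \<Longrightarrow> l2 (\<lambda>z. f m z - f n z) < 1"
    using Cauchy[of 1] by auto
  have "(\<lambda>z. f N1 z - g z) \<in> L2" by (rule L2_I[OF _ fatou[of 1 N1]]) (use N1 in auto)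
  from L2_diff[OF L2[of N1] this] have gL: "g \<in> L2" by simp
  have "(\<lambda>n. l2 (\<lambda>z. f n z - g z)) \<longlonglongrightarrow> 0"
  proof (rule LIMSEQ_I)
    fix e :: real assume "0 < e"
    then obtain M where M: "\<And>m n. M \<le> m \<Longrightarrow> M \<le> n \<Longrightarrow> l2 (\<lambda>z. f m z - f n z) < e/2"
      using Cauchy[of "e/2"] by auto
    have le: "l2 (\<lambda>z. f n z - g z) \<le> e/2" if "n \<ge> M" for n
      by (rule l2_le[OF _ fatou[of "e/2" M]]) (use M that \<open>0 < e\<close> in auto)
    have "l2 (\<lambda>z. f n z - g z) < e" if "n \<ge> M" for n
      using le[OF that] \<open>0 < e\<close> by linarith
    then show "\<exists>no. \<forall>n\<ge>no. norm (l2 (\<lambda>z. f n z - g z) - 0) < e"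
      by (intro exI[of _ M]) simp
  qed
  with gL show ?thesis using that by blast
qed

text \<open>Common form of the continuity statements in time below: each functional is a norm or a
  supremum of the function at time t, so it varies by no more than a norm of the difference.\<close>

lemma continuous_on_by_modulus:
  fixes f :: "'a::topological_space \<Rightarrow> real"
  assumes lim: "\<And>t. t \<in> S \<Longrightarrow> ((\<lambda>\<tau>. d \<tau> t) \<longlongrightarrow> 0) (at t within S)"
    and le: "\<And>t \<tau>. t \<in> S \<Longrightarrow> \<tau> \<in> S \<Longrightarrow> \<bar>f \<tau> - f t\<bar> \<le> d \<tau> t"
  shows "continuous_on S f"
  unfolding continuous_on_def
proof
  fix t assume t: "t \<in> S"
  have "((\<lambda>\<tau>. f \<tau> - f t) \<longlongrightarrow> 0) (at t within S)"
    by (rule Lim_null_comparison[OF _ lim[OF t]]) (use le[OF t] in \<open>auto simp: eventually_at_filter\<close>)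
  then show "(f \<longlongrightarrow> f t) (at t within S)" by (rule LIM_zero_cancel)
qed

section \<open>Truncation to balls\<close>

definition trunc :: "nat \<Rightarrow> (plane \<Rightarrow> complex) \<Rightarrow> plane \<Rightarrow> complex" where
  "trunc n f = (\<lambda>z. if norm z \<le> real n then f z else 0)"

lemma trunc_measurable [measurable (raw)]:
  assumes [measurable]: "f \<in> borel_measurable borel"
  shows "trunc n f \<in> borel_measurable borel"
  unfolding trunc_def by measurable

lemma norm_trunc_le: "norm (trunc n f z) \<le> norm (f z)"
  by (simp add: trunc_def)

lemma L2_trunc: "f \<in> L2 \<Longrightarrow> trunc n f \<in> L2"
  by (rule L2_mono(1)) (auto intro: L2_measurable trunc_measurable norm_trunc_le)

lemma l2_trunc_le: "f \<in> L2 \<Longrightarrow> l2 (trunc n f) \<le> l2 f"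
  by (rule L2_mono(2)) (auto intro: L2_measurable trunc_measurable norm_trunc_le)

lemma l2_dominated_convergence:
  fixes f :: "nat \<Rightarrow> plane \<Rightarrow> complex"
  assumes "h \<in> L2" "\<And>n. f n \<in> borel_measurable borel" "\<And>n z. norm (f n z) \<le> norm (h z)"
    "\<And>z. (\<lambda>n. f n z) \<longlonglongrightarrow> 0"
  shows "(\<lambda>n. l2 (f n)) \<longlonglongrightarrow> 0"
proof -
  have "(\<lambda>n. LINT z|lborel. (norm (f n z))\<^sup>2) \<longlonglongrightarrow> (LINT z|(lborel::plane measure). 0)"
  proof (rule integral_dominated_convergence[where w = "\<lambda>z. (norm (h z))\<^sup>2"])
    show "AE z in lborel. (\<lambda>n. (norm (f n z))\<^sup>2) \<longlonglongrightarrow> 0"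
      using tendsto_power[OF tendsto_norm_zero[OF assms(4)], where n=2] by simp
    show "AE z in lborel. norm ((norm (f n z))\<^sup>2) \<le> (norm (h z))\<^sup>2" for n
      using assms(3) by (auto intro: power_mono)
  qed (use assms in \<open>auto simp: L2_iff\<close>)
  then show ?thesis unfolding l2_def using tendsto_real_sqrt by fastforce
qed

lemma l2_trunc_tendsto:
  assumes "f \<in> L2" shows "(\<lambda>n. l2 (\<lambda>z. f z - trunc n f z)) \<longlonglongrightarrow> 0"
proof (rule l2_dominated_convergence[OF assms])
  have [measurable]: "f \<in> borel_measurable borel" using assms L2_measurable by blast
  show "(\<lambda>z. f z - trunc n f z) \<in> borel_measurable borel" for n by measurable
  show "norm (f z - trunc n f z) \<le> norm (f z)" for n z by (simp add: trunc_def)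
  show "(\<lambda>n. f z - trunc n f z) \<longlonglongrightarrow> 0" for z
  proof (rule tendsto_eventually)
    show "\<forall>\<^sub>F n in sequentially. f z - trunc n f z = 0"
      using eventually_ge_at_top[of "nat \<lceil>norm z\<rceil>"]
      by eventually_elim (auto simp: trunc_def; linarith)
  qed
qed

text \<open>A ball has finite measure, so its indicator is in \<open>L2\<close>, and the truncation
  is a product of two elements of \<open>L2\<close>. To the truncations the Fourier integral thus
  applies absolutely.\<close>

lemma trunc_integrable:
  assumes "f \<in> L2" shows "integrable lborel (trunc n f)"
proof -
  have [measurable]: "f \<in> borel_measurable borel" using assms L2_measurable by blast
  have i: "integrable lborel (\<lambda>z::plane. indicator (cball 0 (real n)) z :: real)"
    by (intro integrable_real_indicator emeasure_bounded_finite) auto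
  have "(\<lambda>z. of_real (indicator (cball 0 (real n)) z)) \<in> L2"
    unfolding L2_iff by (intro conjI Bochner_Integration.integrable_cong[THEN iffD1, OF refl _ i])
      (auto simp: indicator_def)
  from L2_mult_integrable[OF this assms]
  show ?thesis by (rule Bochner_Integration.integrable_cong[THEN iffD1, rotated 2]) (auto simp: trunc_def indicator_def)
qed

section \<open>Fourier integrals of integrable functions\<close>

lemma norm_cis_mult [simp]: "norm (cis a * z) = norm z" "norm (z * cis a) = norm z"
  by (simp_all add: norm_mult)

lemma borel_measurable_cis [measurable (raw)]:
  "f \<in> borel_measurable M \<Longrightarrow> (\<lambda>x. cis (f x)) \<in> borel_measurable M"
  unfolding cis_conv_exp by (intro borel_measurable_continuous_on[of exp] continuous_intros) auto

lemma integrable_cis_mult: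
  assumes "integrable M (f :: 'a \<Rightarrow> complex)" "g \<in> borel_measurable M"
  shows "integrable M (\<lambda>x. cis (g x) * f x)"
  by (rule Bochner_Integration.integrable_bound[OF assms(1)]) (use assms in auto)

lemma integrable_bounded_mult:
  assumes "integrable M (f :: 'a \<Rightarrow> complex)" "g \<in> borel_measurable M" "\<And>x. norm (g x) \<le> C"
  shows "integrable M (\<lambda>x. g x * f x)"
proof (rule Bochner_Integration.integrable_bound)
  show "integrable M (\<lambda>x. of_real C * f x)" using assms by simp
  have "norm (g x * f x) \<le> norm (of_real C * f x)" for x
    using assms(3)[of x] by (simp add: norm_mult mult_mono)
  then show "AE x in M. norm (g x * f x) \<le> norm (of_real C * f x)" by simp
qed (use assms in auto)

lemma integral_translate_plane:
  fixes f :: "plane \<Rightarrow> complex"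
  assumes "f \<in> borel_measurable borel"
  shows "(LINT z|lborel. f (a + z)) = (LINT z|lborel. f z)"
  by (subst (2) lborel_distr_plus[of a, symmetric], subst integral_distr) (use assms in auto)

lemma lborel_distr_uminus_plane: "distr lborel borel uminus = (lborel :: plane measure)"
  by (subst lborel_affine[of "-1" 0]) (auto simp: density_1)

lemma integral_reflect_plane:
  fixes f :: "plane \<Rightarrow> 'a :: {banach, second_countable_topology}"
  assumes "f \<in> borel_measurable borel"
  shows "(LINT z|lborel. f (- z)) = (LINT z|lborel. f z)"
  by (subst (2) lborel_distr_uminus_plane[symmetric], subst integral_distr) (use assms in auto)

lemma integrable_reflect_plane:
  fixes f :: "plane \<Rightarrow> 'a :: {banach, second_countable_topology}"
  assumes "integrable lborel f"
  shows "integrable lborel (\<lambda>z. f (- z))"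
proof -
  have "integrable (distr lborel borel uminus) f" using assms by (simp add: lborel_distr_uminus_plane)
  then show ?thesis by (subst (asm) integrable_distr_eq) (use assms in auto)
qed

lemma nn_integral_translate_plane:
  fixes f :: "plane \<Rightarrow> ennreal"
  assumes "f \<in> borel_measurable borel"
  shows "(\<integral>\<^sup>+z. f (a + z) \<partial>lborel) = (\<integral>\<^sup>+z. f z \<partial>lborel)"
  by (subst (2) lborel_distr_plus[of a, symmetric], subst nn_integral_distr) (use assms in auto)

lemma AE_reflect_plane:
  fixes P :: "plane \<Rightarrow> bool"
  assumes "AE z in lborel. P z"
  shows "AE z in lborel. P (- z)"
proof -
  have "AE z in distr lborel borel uminus. P z" using assms by (subst lborel_distr_uminus_plane)
  then show ?thesis by (rule AE_distrD[rotated]) simp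
qed

lemma integrable_tensor:
  fixes f :: "'a::euclidean_space \<Rightarrow> complex" and g :: "'b::euclidean_space \<Rightarrow> complex"
  assumes "integrable lborel f" "integrable lborel g"
  shows "integrable (lborel \<Otimes>\<^sub>M lborel) (\<lambda>z. f (fst z) * g (snd z))"
proof (rule lborel_pair.Fubini_integrable)
  have [measurable]: "f \<in> borel_measurable borel" "g \<in> borel_measurable borel" using assms by auto
  show "(\<lambda>z. f (fst z) * g (snd z)) \<in> borel_measurable (lborel \<Otimes>\<^sub>M lborel)" by measurable
  show "integrable lborel (\<lambda>x. LINT y|lborel. norm (f (fst (x, y)) * g (snd (x, y))))"
    using assms by (simp add: norm_mult)
  show "AE x in lborel. integrable lborel (\<lambda>y. f (fst (x, y)) * g (snd (x, y)))"
    using assms by simp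
qed

lemma integral_tensor:
  fixes f :: "'a::euclidean_space \<Rightarrow> complex" and g :: "'b::euclidean_space \<Rightarrow> complex"
  assumes "integrable lborel f" "integrable lborel g"
  shows "(LINT z|lborel. f (fst z) * g (snd z)) = (LINT x|lborel. f x) * (LINT y|lborel. g y)"
  using lborel_pair.integral_fst'[OF integrable_tensor[OF assms]] by (simp add: lborel_prod)

lemma fourier_integral_measurable [measurable]:
  assumes [measurable]: "f \<in> borel_measurable borel"
  shows "fourier_integral f \<in> borel_measurable borel"
proof -
  have "(\<lambda>\<zeta>. LINT z|lborel. cis (- (z \<bullet> \<zeta>)) * f z) \<in> borel_measurable borel"
    by (rule lborel.borel_measurable_lebesgue_integral) measurable
  then show ?thesis unfolding fourier_integral_def[abs_def] by measurable
qed

lemma norm_fourier_integral_le: 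
  "norm (fourier_integral f \<zeta>) \<le> 1 / (2 * pi) * (LINT z|lborel. norm (f z))"
  unfolding fourier_integral_def norm_mult norm_of_real
  using integral_norm_bound[of lborel "\<lambda>z. cis (- (z \<bullet> \<zeta>)) * f z"] by (simp add: divide_right_mono)

lemma fourier_integral_add:
  assumes "integrable lborel f" "integrable lborel g"
  shows "fourier_integral (\<lambda>z. f z + g z) \<zeta> = fourier_integral f \<zeta> + fourier_integral g \<zeta>"
  unfolding fourier_integral_def 
  by (simp add: distrib_left integrable_cis_mult assms)

lemma fourier_integral_cmult: "fourier_integral (\<lambda>z. c * f z) \<zeta> = c * fourier_integral f \<zeta>"
  unfolding fourier_integral_def by (simp add: mult.left_commute)

lemma fourier_integral_diff:
  assumes "integrable lborel f" "integrable lborel g"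
  shows "fourier_integral (\<lambda>z. f z - g z) \<zeta> = fourier_integral f \<zeta> - fourier_integral g \<zeta>"
  unfolding fourier_integral_def 
  by (simp add: right_diff_distrib integrable_cis_mult assms)

lemma fourier_integral_AE_cong:
  assumes "f \<in> borel_measurable borel" "g \<in> borel_measurable borel" "AE z in lborel. f z = g z"
  shows "fourier_integral f = fourier_integral g"
  unfolding fourier_integral_def
proof (intro ext arg_cong[where f="\<lambda>x. _ * x"] integral_cong_AE)
  show "AE z in lborel. cis (- (z \<bullet> \<zeta>)) * f z = cis (- (z \<bullet> \<zeta>)) * g z" for \<zeta>
    using assms(3) by eventually_elim simp
qed (use assms in measurable)

lemma fourier_integral_reflect:
  assumes [measurable]: "f \<in> borel_measurable borel"
  shows "fourier_integral (\<lambda>z. f (- z)) \<zeta> = fourier_integral f (- \<zeta>)"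
  unfolding fourier_integral_def
  using integral_reflect_plane[of "\<lambda>z. cis (z \<bullet> \<zeta>) * f z"] by simp

lemma fourier_integral_cnj: "fourier_integral (\<lambda>z. cnj (f z)) \<zeta> = cnj (fourier_integral f (- \<zeta>))"
  unfolding fourier_integral_def
  using Bochner_Integration.integral_cnj[of lborel "\<lambda>z. cis (z \<bullet> \<zeta>) * f z"] by (simp add: cis_cnj del: integral_cnj)

lemma fourier_integral_modulate:
  "fourier_integral (\<lambda>\<zeta>. cis (w \<bullet> \<zeta>) * f \<zeta>) z = fourier_integral f (z - w)"
  unfolding fourier_integral_def
  by (simp add: mult.assoc[symmetric] cis_mult inner_diff_right inner_commute)

text \<open>The multiplication formula: Fubini for a kernel of modulus 1 against a tensor product.
  With a modulated Gaussian for \<open>g\<close> it produces heat means; with the damped conjugate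
  of the transform it produces the \<open>L2\<close> bound.\<close>

lemma integral_fourier_integral_mult:
  assumes "integrable lborel f" "integrable lborel g"
  shows "(LINT \<zeta>|lborel. fourier_integral f \<zeta> * g \<zeta>) = (LINT z|lborel. f z * fourier_integral g z)"
proof -
  let ?c = "complex_of_real (1 / (2 * pi))"
  let ?h = "\<lambda>z \<zeta>. cis (- (z \<bullet> \<zeta>)) * (f z * g \<zeta>)"
  have [measurable]: "f \<in> borel_measurable borel" "g \<in> borel_measurable borel" using assms by auto
  have "integrable (lborel \<Otimes>\<^sub>M lborel) (\<lambda>p. cis (- (fst p \<bullet> snd p)) * (f (fst p) * g (snd p)))"
    by (intro integrable_cis_mult integrable_tensor assms) measurable
  then have i: "integrable (lborel \<Otimes>\<^sub>M lborel) (case_prod ?h)" by (simp add: case_prod_unfold)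
  have "(LINT \<zeta>|lborel. fourier_integral f \<zeta> * g \<zeta>) = ?c * (LINT \<zeta>|lborel. LINT z|lborel. ?h z \<zeta>)"
    unfolding fourier_integral_def by (simp add: mult_ac flip: integral_mult_left_zero integral_mult_right_zero)
  also have "\<dots> = ?c * (LINT z|lborel. LINT \<zeta>|lborel. ?h z \<zeta>)"
    by (subst lborel_pair.Fubini_integral[OF i]) simp
  also have "\<dots> = (LINT z|lborel. f z * fourier_integral g z)"
    unfolding fourier_integral_def by (simp add: mult_ac inner_commute flip: integral_mult_left_zero integral_mult_right_zero)
  finally show ?thesis .
qed

section \<open>Gaussians, their transforms and heat means\<close>

definition gauss :: "real \<Rightarrow> plane \<Rightarrow> real" where
  "gauss \<epsilon> \<zeta> = exp (- (\<epsilon>\<^sup>2 * (norm \<zeta>)\<^sup>2) / 2)"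

text \<open>Times 2 pi this is the transform of \<open>gauss \<epsilon>\<close>. The parameter is a
  standard deviation, so the total mass and the one-dimensional transform come from the normal
  distribution.\<close>

definition heat_kernel :: "real \<Rightarrow> plane \<Rightarrow> real" where
  "heat_kernel \<epsilon> z = normal_density 0 \<epsilon> (fst z) * normal_density 0 \<epsilon> (snd z)"

definition heat :: "real \<Rightarrow> (plane \<Rightarrow> complex) \<Rightarrow> plane \<Rightarrow> complex" where
  "heat \<epsilon> f z = (LINT w|lborel. complex_of_real (heat_kernel \<epsilon> (w - z)) * f w)"

lemma gauss_nonneg [simp]: "0 \<le> gauss \<epsilon> z" and gauss_le_1 [simp]: "gauss \<epsilon> z \<le> 1"
  by (simp_all add: gauss_def)

lemma gauss_measurable [measurable]: "gauss \<epsilon> \<in> borel_measurable borel"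
  unfolding gauss_def by measurable

lemma heat_kernel_measurable [measurable]: "heat_kernel \<epsilon> \<in> borel_measurable borel"
  unfolding heat_kernel_def[abs_def] borel_prod[symmetric] by measurable

lemma heat_kernel_nonneg [simp]: "0 \<le> heat_kernel \<epsilon> z"
  by (simp add: heat_kernel_def)

lemma heat_kernel_uminus [simp]: "heat_kernel \<epsilon> (- z) = heat_kernel \<epsilon> z"
  by (simp add: heat_kernel_def normal_density_def)

lemma heat_kernel_minus_commute: "heat_kernel \<epsilon> (z - w) = heat_kernel \<epsilon> (w - z)"
  using heat_kernel_uminus[of \<epsilon> "w - z"] by simp

lemma integrable_gauss_1d:
  assumes "0 < \<epsilon>" shows "integrable lborel (\<lambda>\<xi>::real. complex_of_real (exp (- (\<epsilon>\<^sup>2 * \<xi>\<^sup>2) / 2)))"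
proof -
  have "integrable lborel (\<lambda>\<xi>. sqrt (2*pi) / \<epsilon> * normal_density 0 (1/\<epsilon>) \<xi>)"
    using assms by simp
  also have "(\<lambda>\<xi>. sqrt (2*pi) / \<epsilon> * normal_density 0 (1/\<epsilon>) \<xi>) = (\<lambda>\<xi>. exp (- (\<epsilon>\<^sup>2 * \<xi>\<^sup>2) / 2))"
    using assms by (auto simp: normal_density_def fun_eq_iff field_simps real_sqrt_divide real_sqrt_mult)
  finally show ?thesis by simp
qed

lemma fourier_gauss_1d:
  assumes "0 < \<epsilon>"
  shows "(LINT \<xi>|lborel. cis (- (x * \<xi>)) * complex_of_real (exp (- (\<epsilon>\<^sup>2 * \<xi>\<^sup>2) / 2)))
     = of_real (2 * pi * normal_density 0 \<epsilon> x)"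
proof -
  \<comment> \<open>At this frequency, substituting \<epsilon> * \<xi> in the characteristic
    function of the standard normal law turns the phase into - x * \<xi>.\<close>
  define t where "t = - x / \<epsilon>"
  have "complex_of_real (exp (- (t^2) / 2)) = (CLINT x|std_normal_distribution. iexp (t * x))"
    using char_std_normal_distribution unfolding char_def by (metis (no_types))
  also have "\<dots> = (LINT x|lborel. std_normal_density x *\<^sub>R iexp (t * x))"
    by (subst integral_density) auto
  also have "\<dots> = (LINT x|lborel. of_real (1 / sqrt (2*pi)) * (cis (t * x) * of_real (exp (- x\<^sup>2 / 2))))"
    by (intro Bochner_Integration.integral_cong) (auto simp: std_normal_density_def cis_conv_exp scaleR_conv_of_real)
  also have "\<dots> = of_real (1 / sqrt (2*pi)) * (LINT x|lborel. cis (t * x) * of_real (exp (- x\<^sup>2 / 2)))"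
    by simp
  also have "(LINT x|lborel. cis (t * x) * complex_of_real (exp (- x\<^sup>2 / 2)))
       = \<epsilon> *\<^sub>R (LINT \<xi>|lborel. cis (- (x * \<xi>)) * complex_of_real (exp (- (\<epsilon>\<^sup>2 * \<xi>\<^sup>2) / 2)))"
    using assms by (subst lborel_integral_real_affine[where c=\<epsilon> and t=0]) (auto simp: t_def power_mult_distrib)
  finally have "complex_of_real (exp (- (t^2) / 2)) = of_real (\<epsilon> / sqrt (2*pi)) *
      (LINT \<xi>|lborel. cis (- (x * \<xi>)) * complex_of_real (exp (- (\<epsilon>\<^sup>2 * \<xi>\<^sup>2) / 2)))"
    by (simp add: scaleR_conv_of_real)
  then have "(LINT \<xi>|lborel. cis (- (x * \<xi>)) * complex_of_real (exp (- (\<epsilon>\<^sup>2 * \<xi>\<^sup>2) / 2)))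
     = of_real (sqrt (2*pi) / \<epsilon> * exp (- (t^2) / 2))"
    using assms by (simp add: field_simps)
  also have "sqrt (2*pi) / \<epsilon> * exp (- (t^2) / 2) = 2 * pi * normal_density 0 \<epsilon> x"
  proof -
    have "2 * pi = sqrt (2*pi) * sqrt (2*pi)" by simp
    then show ?thesis using assms by (simp add: normal_density_def t_def power_divide real_sqrt_mult)
  qed
  finally show ?thesis .
qed

lemma gauss_tensor: "gauss \<epsilon> \<zeta> = exp (- (\<epsilon>\<^sup>2 * (fst \<zeta>)\<^sup>2) / 2) * exp (- (\<epsilon>\<^sup>2 * (snd \<zeta>)\<^sup>2) / 2)"
  by (cases \<zeta>) (simp add: gauss_def norm_Pair exp_add[symmetric] algebra_simps add_divide_distrib diff_divide_distrib)

lemma integrable_gauss: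
  assumes "0 < \<epsilon>" shows "integrable lborel (\<lambda>\<zeta>. complex_of_real (gauss \<epsilon> \<zeta>))"
  using integrable_tensor[OF integrable_gauss_1d[OF assms] integrable_gauss_1d[OF assms]]
  unfolding lborel_prod by (simp add: gauss_tensor)

lemma fourier_integral_gauss:
  assumes "0 < \<epsilon>"
  shows "fourier_integral (\<lambda>\<zeta>. of_real (gauss \<epsilon> \<zeta>)) z = of_real (2 * pi * heat_kernel \<epsilon> z)"
proof -
  let ?g = "\<lambda>x \<xi>::real. cis (- (x * \<xi>)) * complex_of_real (exp (- (\<epsilon>\<^sup>2 * \<xi>\<^sup>2) / 2))"
  have i: "integrable lborel (?g x)" for x
    by (intro integrable_cis_mult integrable_gauss_1d assms) measurable
  have "cis (- (\<zeta> \<bullet> z)) * of_real (gauss \<epsilon> \<zeta>) = ?g (fst z) (fst \<zeta>) * ?g (snd z) (snd \<zeta>)" for \<zeta> :: plane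
    unfolding gauss_tensor of_real_mult 
    by (cases \<zeta>; cases z) (simp add: cis_mult[symmetric] mult_ac, simp add: cis_mult algebra_simps)
  then have "fourier_integral (\<lambda>\<zeta>. of_real (gauss \<epsilon> \<zeta>)) z = of_real (1 / (2*pi)) *
     (LINT \<zeta>|lborel. ?g (fst z) (fst \<zeta>) * ?g (snd z) (snd \<zeta>))"
    unfolding fourier_integral_def by simp
  also have "\<dots> = of_real (2 * pi * heat_kernel \<epsilon> z)"
    unfolding integral_tensor[OF i i] fourier_gauss_1d[OF assms] by (simp add: heat_kernel_def)
  finally show ?thesis .
qed

lemma nn_integral_heat_kernel:
  assumes "0 < \<epsilon>" shows "(\<integral>\<^sup>+ z. ennreal (heat_kernel \<epsilon> z) \<partial>lborel) = 1"
proof -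
  have hm: "(\<lambda>z. ennreal (heat_kernel \<epsilon> z)) \<in> borel_measurable (lborel \<Otimes>\<^sub>M lborel)"
    unfolding lborel_prod by simp
  have 1: "(\<integral>\<^sup>+ x. ennreal (normal_density 0 \<epsilon> x) \<partial>lborel) = 1"
    using assms by (subst nn_integral_eq_integral) auto
  have "(\<integral>\<^sup>+ z. ennreal (heat_kernel \<epsilon> z) \<partial>lborel) = (\<integral>\<^sup>+ x. \<integral>\<^sup>+ y. ennreal (heat_kernel \<epsilon> (x, y)) \<partial>lborel \<partial>lborel)"
    unfolding lborel_prod[symmetric] by (subst lborel.nn_integral_fst[OF hm]) simp
  also have "\<dots> = 1"
    by (simp add: heat_kernel_def ennreal_mult nn_integral_cmult 1)
  finally show ?thesis .
qed

lemma integrable_heat_kernel: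
  assumes "0 < \<epsilon>" shows "integrable lborel (heat_kernel \<epsilon>)"
  using nn_integral_heat_kernel[OF assms] by (intro integrableI_nonneg) auto

lemma heat_kernel_bounded: obtains B where "\<And>z. heat_kernel \<epsilon> z \<le> B" "0 \<le> B"
proof
  let ?c = "1 / sqrt (2 * pi * \<epsilon>\<^sup>2)"
  have "normal_density 0 \<epsilon> x \<le> ?c" for x
    unfolding normal_density_def by (simp add: divide_right_mono)
  then show "heat_kernel \<epsilon> z \<le> ?c * ?c" for z unfolding heat_kernel_def by (intro mult_mono) auto
qed simp

text \<open>Gaussian-damped Fourier inversion is smoothing by the heat kernel: the multiplication
  formula moves the transform from \<open>f\<close> to the modulated Gaussian, whose transform is a
  translated heat kernel.\<close>

lemma fourier_integral_gauss_mult: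
  assumes "0 < \<epsilon>" "integrable lborel f"
  shows "fourier_integral (\<lambda>\<zeta>. of_real (gauss \<epsilon> \<zeta>) * fourier_integral f \<zeta>) (- z) = heat \<epsilon> f z"
proof -
  let ?g = "\<lambda>\<zeta>. cis (z \<bullet> \<zeta>) * complex_of_real (gauss \<epsilon> \<zeta>)"
  have ig: "integrable lborel ?g"
    by (intro integrable_cis_mult integrable_gauss assms) measurable
  have "fourier_integral (\<lambda>\<zeta>. of_real (gauss \<epsilon> \<zeta>) * fourier_integral f \<zeta>) (- z)
      = of_real (1 / (2*pi)) * (LINT \<zeta>|lborel. fourier_integral f \<zeta> * ?g \<zeta>)"
    unfolding fourier_integral_def[of "\<lambda>\<zeta>. of_real (gauss \<epsilon> \<zeta>) * fourier_integral f \<zeta>"]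
    by (simp add: mult_ac inner_commute)
  also have "\<dots> = of_real (1 / (2*pi)) * (LINT w|lborel. f w * fourier_integral ?g w)"
    by (simp add: integral_fourier_integral_mult[OF assms(2) ig])
  also have "\<dots> = heat \<epsilon> f z"
    unfolding fourier_integral_modulate fourier_integral_gauss[OF assms(1)] heat_def
    by (simp add: mult_ac flip: integral_mult_right_zero)
  finally show ?thesis .
qed

section \<open>The Plancherel transform\<close>

lemma fourier_integral_diff_fun:
  assumes "integrable lborel f" "integrable lborel g"
  shows "fourier_integral (\<lambda>z. f z - g z) = (\<lambda>\<zeta>. fourier_integral f \<zeta> - fourier_integral g \<zeta>)"
  by (rule ext) (rule fourier_integral_diff[OF assms])

lemma nn_integral_pair_heat:
  fixes a b :: "plane \<Rightarrow> ennreal"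
  assumes "0 < \<epsilon>" and [measurable]: "a \<in> borel_measurable borel"
  shows "(\<integral>\<^sup>+z. \<integral>\<^sup>+w. ennreal (heat_kernel \<epsilon> (w - z)) * a z \<partial>lborel \<partial>lborel) = (\<integral>\<^sup>+z. a z \<partial>lborel)"
    and "(\<integral>\<^sup>+z. \<integral>\<^sup>+w. ennreal (heat_kernel \<epsilon> (w - z)) * a w \<partial>lborel \<partial>lborel) = (\<integral>\<^sup>+z. a z \<partial>lborel)"
proof -
  have 1: "(\<integral>\<^sup>+w. ennreal (heat_kernel \<epsilon> (w - z)) \<partial>lborel) = 1" for z
    using nn_integral_translate_plane[of "\<lambda>w. ennreal (heat_kernel \<epsilon> w)" "-z"] nn_integral_heat_kernel[OF assms(1)]
    by simp
  then have 2: "(\<integral>\<^sup>+w. ennreal (heat_kernel \<epsilon> (z - w)) \<partial>lborel) = 1" for z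
    by (subst heat_kernel_minus_commute)
  show "(\<integral>\<^sup>+z. \<integral>\<^sup>+w. ennreal (heat_kernel \<epsilon> (w - z)) * a z \<partial>lborel \<partial>lborel) = (\<integral>\<^sup>+z. a z \<partial>lborel)"
    by (simp add: nn_integral_multc 1)
  have "(\<integral>\<^sup>+z. \<integral>\<^sup>+w. ennreal (heat_kernel \<epsilon> (w - z)) * a w \<partial>lborel \<partial>lborel)
      = (\<integral>\<^sup>+w. \<integral>\<^sup>+z. ennreal (heat_kernel \<epsilon> (w - z)) * a w \<partial>lborel \<partial>lborel)"
    by (rule lborel_pair.Fubini'[symmetric]) measurable
  also have "\<dots> = (\<integral>\<^sup>+z. a z \<partial>lborel)"
    by (simp add: nn_integral_multc 2)
  finally show "(\<integral>\<^sup>+z. \<integral>\<^sup>+w. ennreal (heat_kernel \<epsilon> (w - z)) * a w \<partial>lborel \<partial>lborel) = (\<integral>\<^sup>+z. a z \<partial>lborel)" .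
qed

lemma integrable_heat_kernel_mult:
  assumes "integrable lborel f"
  shows "integrable lborel (\<lambda>w. complex_of_real (heat_kernel \<epsilon> (w - z)) * f w)"
proof -
  obtain B where "\<And>z. heat_kernel \<epsilon> z \<le> B" "0 \<le> B" using heat_kernel_bounded[of \<epsilon>] by blast
  then show ?thesis by (intro integrable_bounded_mult[OF assms, where C=B]) auto
qed

lemma heat_measurable [measurable]:
  assumes [measurable]: "f \<in> borel_measurable borel"
  shows "heat \<epsilon> f \<in> borel_measurable borel"
  unfolding heat_def[abs_def] by (rule lborel.borel_measurable_lebesgue_integral) measurable

text \<open>Schur's test for a symmetric kernel: the product of two values is at most half the sum
  of their squares, and the kernel has mass 1 in either variable.\<close>

lemma norm_integral_heat_le:
  assumes "0 < \<epsilon>" "f \<in> L2" "integrable lborel f"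
  shows "norm (LINT z|lborel. f z * cnj (heat \<epsilon> f z)) \<le> (l2 f)\<^sup>2"
proof -
  have [measurable]: "f \<in> borel_measurable borel" using assms by auto
  let ?k = "\<lambda>w z. ennreal (heat_kernel \<epsilon> (w - z))"
  let ?a = "\<lambda>z. ennreal ((norm (f z))\<^sup>2 / 2)"
  have a: "(\<integral>\<^sup>+z. ?a z \<partial>lborel) = ennreal ((l2 f)\<^sup>2 / 2)"
    using nn_integral_L2[OF assms(2)]
    by (subst nn_integral_eq_integral) (use assms in \<open>auto simp: l2_square L2_iff\<close>)
  have pt: "ennreal (norm (f z * cnj (heat \<epsilon> f z))) \<le> (\<integral>\<^sup>+w. ?k w z * ?a z + ?k w z * ?a w \<partial>lborel)" for z
  proof -
    have "ennreal (norm (f z * cnj (heat \<epsilon> f z))) = ennreal (norm (f z)) * ennreal (norm (heat \<epsilon> f z))"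
      by (simp add: norm_mult ennreal_mult)
    also have "\<dots> \<le> ennreal (norm (f z)) * (\<integral>\<^sup>+w. norm (complex_of_real (heat_kernel \<epsilon> (w - z)) * f w) \<partial>lborel)"
      unfolding heat_def by (intro mult_left_mono integral_norm_bound_ennreal integrable_heat_kernel_mult assms) auto
    also have "\<dots> = (\<integral>\<^sup>+w. ennreal (norm (f z)) * ennreal (heat_kernel \<epsilon> (w - z) * norm (f w)) \<partial>lborel)"
      by (subst nn_integral_cmult[symmetric]) (auto simp: norm_mult)
    also have "\<dots> \<le> (\<integral>\<^sup>+w. ?k w z * ?a z + ?k w z * ?a w \<partial>lborel)"
    proof (rule nn_integral_mono)
      fix w
      have "norm (f z) * (heat_kernel \<epsilon> (w - z) * norm (f w)) = heat_kernel \<epsilon> (w - z) * (norm (f z) * norm (f w))"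
        by simp
      also have "\<dots> \<le> heat_kernel \<epsilon> (w - z) * ((norm (f z))\<^sup>2 / 2 + (norm (f w))\<^sup>2 / 2)"
        using sum_squares_bound[of "norm (f z)" "norm (f w)"] by (intro mult_left_mono) auto
      finally show "ennreal (norm (f z)) * ennreal (heat_kernel \<epsilon> (w - z) * norm (f w)) \<le> ?k w z * ?a z + ?k w z * ?a w"
        by (simp add: ennreal_mult[symmetric] ennreal_plus[symmetric] distrib_left del: ennreal_plus)
    qed
    finally show ?thesis .
  qed
  have "ennreal (norm (LINT z|lborel. f z * cnj (heat \<epsilon> f z))) \<le> (\<integral>\<^sup>+z. norm (f z * cnj (heat \<epsilon> f z)) \<partial>lborel)"
  \<comment> \<open>Integrability of the product has not been established; if it fails, the Bochner
    integral is 0 and the bound is trivial.\<close>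
  proof (cases "integrable lborel (\<lambda>z. f z * cnj (heat \<epsilon> f z))")
    case True then show ?thesis by (rule integral_norm_bound_ennreal)
  qed (simp add: not_integrable_integral_eq)
  also have "\<dots> \<le> (\<integral>\<^sup>+z. \<integral>\<^sup>+w. ?k w z * ?a z + ?k w z * ?a w \<partial>lborel \<partial>lborel)"
    by (rule nn_integral_mono) (rule pt)
  also have "\<dots> = (\<integral>\<^sup>+z. (\<integral>\<^sup>+w. ?k w z * ?a z \<partial>lborel) + (\<integral>\<^sup>+w. ?k w z * ?a w \<partial>lborel) \<partial>lborel)"
    by (intro nn_integral_cong nn_integral_add) measurable
  also have "\<dots> = (\<integral>\<^sup>+z. \<integral>\<^sup>+w. ?k w z * ?a z \<partial>lborel \<partial>lborel) + (\<integral>\<^sup>+z. \<integral>\<^sup>+w. ?k w z * ?a w \<partial>lborel \<partial>lborel)"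
    by (rule nn_integral_add) measurable
  also have "\<dots> = ennreal ((l2 f)\<^sup>2 / 2) + ennreal ((l2 f)\<^sup>2 / 2)"
    using nn_integral_pair_heat[OF assms(1), of ?a] a by simp
  also have "\<dots> = ennreal ((l2 f)\<^sup>2)" by (simp add: ennreal_plus[symmetric] del: ennreal_plus)
  finally show ?thesis by simp
qed

lemma integrable_gauss_mult_fourier:
  assumes "0 < \<epsilon>" "integrable lborel f"
  shows "integrable lborel (\<lambda>\<zeta>. of_real (gauss \<epsilon> \<zeta>) * fourier_integral f \<zeta>)"
proof -
  have [measurable]: "f \<in> borel_measurable borel" using assms by auto
  have "integrable lborel (\<lambda>\<zeta>. fourier_integral f \<zeta> * of_real (gauss \<epsilon> \<zeta>))"
    by (rule integrable_bounded_mult[OF integrable_gauss[OF assms(1)] _ norm_fourier_integral_le]) measurable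
  then show ?thesis by (simp add: mult.commute)
qed

lemma gauss_tendsto_1: "(\<lambda>n. gauss (1 / real (Suc n)) \<zeta>) \<longlonglongrightarrow> 1"
proof -
  have "(\<lambda>n. exp (- ((1 / real (Suc n))\<^sup>2 * (norm \<zeta>)\<^sup>2) / 2)) \<longlonglongrightarrow> exp (- (0\<^sup>2 * (norm \<zeta>)\<^sup>2) / 2)"
    by (intro tendsto_intros LIMSEQ_Suc[OF lim_1_over_n])  simp
  then show ?thesis by (simp add: gauss_def)
qed

text \<open>Only the upper bound is needed at this point; it holds without any density argument, because
  the heat kernel has mass 1.\<close>

lemma fourier_integral_contraction:
  assumes "f \<in> L2" "integrable lborel f"
  shows "fourier_integral f \<in> L2" "l2 (fourier_integral f) \<le> l2 f"
proof -
  have [measurable]: "f \<in> borel_measurable borel" using assms by auto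
  let ?F = "fourier_integral f"
  have gauss_le: "(\<integral>\<^sup>+ \<zeta>. ennreal (gauss \<epsilon> \<zeta> * (norm (?F \<zeta>))\<^sup>2) \<partial>lborel) \<le> ennreal ((l2 f)\<^sup>2)" if e: "0 < \<epsilon>" for \<epsilon>
  proof -
    \<comment> \<open>The damped conjugate of the transform. Pairing it with \<open>?F\<close> gives
      the weighted square integral, and the multiplication formula turns this into the pairing of
      \<open>f\<close> with its conjugated heat mean.\<close>
    define h where "h \<zeta> = cnj (of_real (gauss \<epsilon> \<zeta>) * ?F \<zeta>)" for \<zeta>
    have ih: "integrable lborel h"
      unfolding h_def[abs_def] using integrable_gauss_mult_fourier[OF e assms(2)] by (rule integrable_cnj)
    have Fh: "?F \<zeta> * h \<zeta> = of_real (gauss \<epsilon> \<zeta> * (norm (?F \<zeta>))\<^sup>2)" for \<zeta>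
      by (simp add: h_def complex_norm_square[symmetric] mult.left_commute power2_eq_square)
    have hint: "integrable lborel (\<lambda>\<zeta>. ?F \<zeta> * h \<zeta>)"
      by (rule integrable_bounded_mult[OF ih _ norm_fourier_integral_le]) measurable
    have "integrable lborel (\<lambda>\<zeta>. complex_of_real (gauss \<epsilon> \<zeta> * (norm (?F \<zeta>))\<^sup>2))"
      using hint unfolding Fh .
    then have i: "integrable lborel (\<lambda>\<zeta>. gauss \<epsilon> \<zeta> * (norm (?F \<zeta>))\<^sup>2)"
      by (simp only: complex_of_real_integrable_eq)
    have "(LINT \<zeta>|lborel. ?F \<zeta> * h \<zeta>) = (LINT z|lborel. f z * fourier_integral h z)"
      by (rule integral_fourier_integral_mult[OF assms(2) ih])
    also have "fourier_integral h = (\<lambda>z. cnj (heat \<epsilon> f z))"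
      unfolding h_def[abs_def] fourier_integral_cnj fun_eq_iff using fourier_integral_gauss_mult[OF e assms(2)] by simp
    finally have "complex_of_real (LINT \<zeta>|lborel. gauss \<epsilon> \<zeta> * (norm (?F \<zeta>))\<^sup>2) = (LINT z|lborel. f z * cnj (heat \<epsilon> f z))"
      unfolding Fh by (simp only: integral_complex_of_real)
    then have "\<bar>LINT \<zeta>|lborel. gauss \<epsilon> \<zeta> * (norm (?F \<zeta>))\<^sup>2\<bar> \<le> (l2 f)\<^sup>2"
      using norm_integral_heat_le[OF e assms] by (metis norm_of_real)
    then show ?thesis
      by (subst nn_integral_eq_integral[OF i]) (auto intro: ennreal_leI)
  qed
  have "(\<integral>\<^sup>+ \<zeta>. ennreal ((norm (?F \<zeta>))\<^sup>2) \<partial>lborel)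
      = (\<integral>\<^sup>+ \<zeta>. liminf (\<lambda>n. ennreal (gauss (1 / real (Suc n)) \<zeta> * (norm (?F \<zeta>))\<^sup>2)) \<partial>lborel)"
  proof (rule nn_integral_cong)
    fix \<zeta>
    have "(\<lambda>n. ennreal (gauss (1 / real (Suc n)) \<zeta> * (norm (?F \<zeta>))\<^sup>2)) \<longlonglongrightarrow> ennreal (1 * (norm (?F \<zeta>))\<^sup>2)"
      by (intro tendsto_intros gauss_tendsto_1)
    then show "ennreal ((norm (?F \<zeta>))\<^sup>2) = liminf (\<lambda>n. ennreal (gauss (1 / real (Suc n)) \<zeta> * (norm (?F \<zeta>))\<^sup>2))"
      by (intro lim_imp_Liminf[symmetric]) auto
  qed
  also have "\<dots> \<le> liminf (\<lambda>n. \<integral>\<^sup>+ \<zeta>. ennreal (gauss (1 / real (Suc n)) \<zeta> * (norm (?F \<zeta>))\<^sup>2) \<partial>lborel)"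
    by (rule nn_integral_liminf) measurable
  also have "\<dots> \<le> liminf (\<lambda>n::nat. ennreal ((l2 f)\<^sup>2))"
    by (intro Liminf_mono always_eventually allI gauss_le) simp
  also have "\<dots> = ennreal ((l2 f)\<^sup>2)" by (simp add: Liminf_const)
  finally have le: "(\<integral>\<^sup>+ \<zeta>. ennreal ((norm (?F \<zeta>))\<^sup>2) \<partial>lborel) \<le> ennreal ((l2 f)\<^sup>2)" .
  show "?F \<in> L2" by (rule L2_I[OF _ le]) measurable
  show "l2 ?F \<le> l2 f" by (rule l2_le[OF _ le]) auto
qed

section \<open>The transform as an L2 limit: existence, linearity, uniqueness\<close>

lemma is_fourier_iff:
  "is_fourier f g \<longleftrightarrow> f \<in> L2 \<and> g \<in> L2 \<and>
     (\<lambda>n. l2 (\<lambda>\<zeta>. fourier_integral (trunc n f) \<zeta> - g \<zeta>)) \<longlonglongrightarrow> 0"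
proof -
  have "((\<lambda>n. L2_norm (\<lambda>\<zeta>. fourier_integral (trunc n f) \<zeta> - g \<zeta>)) \<longlonglongrightarrow> 0) \<longleftrightarrow>
     (\<lambda>n. l2 (\<lambda>\<zeta>. fourier_integral (trunc n f) \<zeta> - g \<zeta>)) \<longlonglongrightarrow> 0" if "f \<in> L2" "g \<in> L2"
    by (intro tendsto_L2_norm_iff always_eventually allI L2_diff fourier_integral_contraction L2_trunc trunc_integrable that)
  then show ?thesis unfolding is_fourier_def trunc_def by blast
qed

lemma is_fourier_L2: "is_fourier f g \<Longrightarrow> f \<in> L2" "is_fourier f g \<Longrightarrow> g \<in> L2"
  by (simp_all add: is_fourier_iff)

text \<open>The transforms of the truncations form a Cauchy sequence because the contraction applies
  to differences of truncations; completeness supplies the limit.\<close>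

lemma is_fourier_exists:
  assumes "f \<in> L2" obtains g where "is_fourier f g"
proof -
  let ?F = "\<lambda>n. fourier_integral (trunc n f)"
  have FL: "?F n \<in> L2" for n
    by (intro fourier_integral_contraction L2_trunc trunc_integrable assms)
  have le: "l2 (\<lambda>\<zeta>. ?F m \<zeta> - ?F n \<zeta>) \<le> l2 (\<lambda>z. f z - trunc m f z) + l2 (\<lambda>z. f z - trunc n f z)" for m n
  proof -
    have "l2 (\<lambda>\<zeta>. ?F m \<zeta> - ?F n \<zeta>) = l2 (fourier_integral (\<lambda>z. trunc m f z - trunc n f z))"
      by (subst fourier_integral_diff_fun) (simp_all add: trunc_integrable assms)
    also have "\<dots> \<le> l2 (\<lambda>z. trunc m f z - trunc n f z)"
      by (intro fourier_integral_contraction L2_diff L2_trunc assms Bochner_Integration.integrable_diff trunc_integrable)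
    also have "\<dots> \<le> l2 (\<lambda>z. trunc m f z - f z) + l2 (\<lambda>z. f z - trunc n f z)"
      by (intro l2_triangle_diff L2_trunc assms)
    finally show ?thesis by (simp add: l2_minus_commute)
  qed
  have *: "\<exists>N. \<forall>m\<ge>N. \<forall>n\<ge>N. l2 (\<lambda>z. ?F m z - ?F n z) < e" if "0 < e" for e
  proof -
    obtain N where N: "\<And>n. n \<ge> N \<Longrightarrow> l2 (\<lambda>z. f z - trunc n f z) < e / 2"
      using LIMSEQ_D[OF l2_trunc_tendsto[OF assms], of "e/2"] \<open>0 < e\<close> by auto
    have "l2 (\<lambda>z. ?F m z - ?F n z) < e" if "m \<ge> N" "n \<ge> N" for m n
      using le[of m n] N[OF that(1)] N[OF that(2)] by simp
    then show "\<exists>N. \<forall>m\<ge>N. \<forall>n\<ge>N. l2 (\<lambda>z. ?F m z - ?F n z) < e" by blast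
  qed
  obtain g where "g \<in> L2" "(\<lambda>n. l2 (\<lambda>z. ?F n z - g z)) \<longlonglongrightarrow> 0"
    by (rule L2_complete[of ?F, OF FL *])
  then show ?thesis using assms that by (simp add: is_fourier_iff)
qed

lemma l2_limit_le:
  assumes "\<And>n. f n \<in> L2" "g \<in> L2" "(\<lambda>n::nat. l2 (\<lambda>z. f n z - g z)) \<longlonglongrightarrow> 0" "\<And>n. l2 (f n) \<le> B"
  shows "l2 g \<le> B"
proof (rule LIMSEQ_le_const)
  show "(\<lambda>n. B + l2 (\<lambda>z. f n z - g z)) \<longlonglongrightarrow> B"
    using tendsto_add[OF tendsto_const assms(3), of B] by simp
  have "l2 g \<le> B + l2 (\<lambda>z. f n z - g z)" for n
    using l2_le_diff[OF assms(2) assms(1)[of n]] assms(4)[of n] l2_minus_commute[of g "f n"] by simp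
  then show "\<exists>N. \<forall>n\<ge>N. l2 g \<le> B + l2 (\<lambda>z. f n z - g z)" by blast
qed

lemma is_fourier_contraction: "is_fourier f g \<Longrightarrow> l2 g \<le> l2 f"
  unfolding is_fourier_iff
  by (elim conjE, rule l2_limit_le[of "\<lambda>n. fourier_integral (trunc n f)"])
     (auto intro!: fourier_integral_contraction L2_trunc trunc_integrable 
       order_trans[OF fourier_integral_contraction(2) l2_trunc_le])

lemma trunc_add: "trunc n (\<lambda>z. f z + g z) = (\<lambda>z. trunc n f z + trunc n g z)"
  by (auto simp: trunc_def)

lemma trunc_cmult: "trunc n (\<lambda>z. c * f z) = (\<lambda>z. c * trunc n f z)"
  by (auto simp: trunc_def)

lemma is_fourier_add:
  assumes "is_fourier f g" "is_fourier f' g'"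
  shows "is_fourier (\<lambda>z. f z + f' z) (\<lambda>\<zeta>. g \<zeta> + g' \<zeta>)"
proof -
  have L: "f \<in> L2" "g \<in> L2" "f' \<in> L2" "g' \<in> L2" using assms by (auto simp: is_fourier_iff)
  let ?F = "\<lambda>n f \<zeta>. fourier_integral (trunc n f) \<zeta>"
  have FL: "?F n f \<in> L2" if "f \<in> L2" for f n
    by (intro fourier_integral_contraction L2_trunc trunc_integrable that)
  have "(\<lambda>n. l2 (\<lambda>\<zeta>. ?F n (\<lambda>z. f z + f' z) \<zeta> - (g \<zeta> + g' \<zeta>))) \<longlonglongrightarrow> 0"
  proof (rule tendsto_sandwich[OF _ _ tendsto_const])
    show "(\<lambda>n. l2 (\<lambda>\<zeta>. ?F n f \<zeta> - g \<zeta>) + l2 (\<lambda>\<zeta>. ?F n f' \<zeta> - g' \<zeta>)) \<longlonglongrightarrow> 0"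
      using tendsto_add[of "\<lambda>n. l2 (\<lambda>\<zeta>. ?F n f \<zeta> - g \<zeta>)" 0 _ "\<lambda>n. l2 (\<lambda>\<zeta>. ?F n f' \<zeta> - g' \<zeta>)" 0] assms
      by (simp add: is_fourier_iff)
    have "l2 (\<lambda>\<zeta>. ?F n (\<lambda>z. f z + f' z) \<zeta> - (g \<zeta> + g' \<zeta>)) 
       \<le> l2 (\<lambda>\<zeta>. ?F n f \<zeta> - g \<zeta>) + l2 (\<lambda>\<zeta>. ?F n f' \<zeta> - g' \<zeta>)" for n
      using l2_triangle[OF L2_diff[OF FL[OF L(1)] L(2)] L2_diff[OF FL[OF L(3)] L(4)]]
      by (simp add: trunc_add fourier_integral_add trunc_integrable L add_diff_add)
    then show "\<forall>\<^sub>F n in sequentially. l2 (\<lambda>\<zeta>. ?F n (\<lambda>z. f z + f' z) \<zeta> - (g \<zeta> + g' \<zeta>))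
       \<le> l2 (\<lambda>\<zeta>. ?F n f \<zeta> - g \<zeta>) + l2 (\<lambda>\<zeta>. ?F n f' \<zeta> - g' \<zeta>)" by simp
  qed simp
  then show ?thesis using L by (simp add: is_fourier_iff L2_add)
qed

lemma is_fourier_cmult:
  assumes "is_fourier f g" shows "is_fourier (\<lambda>z. c * f z) (\<lambda>\<zeta>. c * g \<zeta>)"
proof -
  have "(\<lambda>n. norm c * l2 (\<lambda>\<zeta>. fourier_integral (trunc n f) \<zeta> - g \<zeta>)) \<longlonglongrightarrow> norm c * 0"
    using assms by (intro tendsto_intros) (simp add: is_fourier_iff)
  then show ?thesis using assms
    by (simp add: is_fourier_iff trunc_cmult fourier_integral_cmult[abs_def] L2_cmult
       right_diff_distrib[symmetric] l2_cmult)
qed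

lemma is_fourier_diff:
  assumes "is_fourier f g" "is_fourier f' g'"
  shows "is_fourier (\<lambda>z. f z - f' z) (\<lambda>\<zeta>. g \<zeta> - g' \<zeta>)"
  using is_fourier_add[OF assms(1) is_fourier_cmult[OF assms(2), of "-1"]] by simp

lemma is_fourier_AE_cong:
  assumes "is_fourier f g" "f' \<in> borel_measurable borel" "g' \<in> borel_measurable borel"
    "AE z in lborel. f z = f' z" "AE z in lborel. g z = g' z"
  shows "is_fourier f' g'"
proof -
  have L: "f \<in> L2" "g \<in> L2" "f' \<in> L2" "g' \<in> L2"
    using assms L2_AE_cong by (auto simp: is_fourier_iff)
  then have m [measurable]: "f \<in> borel_measurable borel" "g \<in> borel_measurable borel"
    "f' \<in> borel_measurable borel" "g' \<in> borel_measurable borel" using L2_measurable by blast+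
  have 1: "fourier_integral (trunc n f) = fourier_integral (trunc n f')" for n
    by (rule fourier_integral_AE_cong) (use assms(4) in \<open>auto simp: trunc_def\<close>)
  have 2: "l2 (\<lambda>\<zeta>. fourier_integral (trunc n f) \<zeta> - g \<zeta>) = l2 (\<lambda>\<zeta>. fourier_integral (trunc n f) \<zeta> - g' \<zeta>)" for n
    by (rule l2_AE_cong) (use assms(5) in auto)
  show ?thesis using assms(1) L unfolding is_fourier_iff 2 unfolding 1 by simp
qed

text \<open>The contraction applied to the difference. Since the transform is unique up to a null
  set, the choice made in \<open>fourier\<close> is harmless.\<close>

lemma is_fourier_AE_unique:
  assumes "is_fourier f g" "is_fourier f' g'" "AE z in lborel. f z = f' z"
  shows "AE \<zeta> in lborel. g \<zeta> = g' \<zeta>"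
proof -
  have L: "f \<in> L2" "g \<in> L2" "f' \<in> L2" "g' \<in> L2" using assms by (auto simp: is_fourier_iff)
  then have m: "f \<in> borel_measurable borel" "f' \<in> borel_measurable borel" using L2_measurable by blast+
  have "l2 (\<lambda>\<zeta>. g \<zeta> - g' \<zeta>) \<le> l2 (\<lambda>z. f z - f' z)"
    by (rule is_fourier_contraction[OF is_fourier_diff[OF assms(1,2)]])
  also have "\<dots> = l2 (\<lambda>z. 0)" by (rule l2_AE_cong) (use assms(3) m in auto)
  also have "\<dots> = 0" by (simp add: l2_def)
  finally have "l2 (\<lambda>\<zeta>. g \<zeta> - g' \<zeta>) = 0" using l2_nonneg[of "\<lambda>\<zeta>. g \<zeta> - g' \<zeta>"] by linarith
  from l2_eq_0_imp_AE[OF L2_diff[OF L(2,4)] this] show ?thesis by simp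
qed

lemma is_fourier_fourier_integral:
  assumes "f \<in> L2" "integrable lborel f"
  shows "is_fourier f (fourier_integral f)"
proof -
  have le: "l2 (\<lambda>\<zeta>. fourier_integral (trunc n f) \<zeta> - fourier_integral f \<zeta>) \<le> l2 (\<lambda>z. f z - trunc n f z)" for n
    using fourier_integral_contraction(2)[of "\<lambda>z. f z - trunc n f z"] assms
    by (subst l2_minus_commute) (simp add: fourier_integral_diff_fun trunc_integrable L2_diff L2_trunc)
  have "(\<lambda>n. l2 (\<lambda>\<zeta>. fourier_integral (trunc n f) \<zeta> - fourier_integral f \<zeta>)) \<longlonglongrightarrow> 0"
    by (rule tendsto_sandwich[OF _ _ tendsto_const l2_trunc_tendsto[OF assms(1)]]) (auto simp: le)
  then show ?thesis using assms fourier_integral_contraction by (simp add: is_fourier_iff)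
qed

section \<open>Fourier inversion and isometry\<close>

lemma L2_reflect: "f \<in> L2 \<Longrightarrow> (\<lambda>z. f (- z)) \<in> L2"
  using integrable_reflect_plane[of "\<lambda>z. (norm (f z))\<^sup>2"] by (auto simp: L2_iff)

lemma l2_reflect: "f \<in> borel_measurable borel \<Longrightarrow> l2 (\<lambda>z. f (- z)) = l2 f"
  using integral_reflect_plane[of "\<lambda>z. (norm (f z))\<^sup>2"] by (simp add: l2_def)

lemma is_fourier_reflect:
  assumes "is_fourier f g" shows "is_fourier (\<lambda>z. f (- z)) (\<lambda>\<zeta>. g (- \<zeta>))"
proof -
  have L: "f \<in> L2" "g \<in> L2" using assms by (auto simp: is_fourier_iff)
  then have [measurable]: "f \<in> borel_measurable borel" "g \<in> borel_measurable borel" using L2_measurable by blast+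
  have "trunc n (\<lambda>z. f (- z)) = (\<lambda>z. trunc n f (- z))" for n by (auto simp: trunc_def)
  then have "l2 (\<lambda>\<zeta>. fourier_integral (trunc n (\<lambda>z. f (- z))) \<zeta> - g (- \<zeta>))
     = l2 (\<lambda>\<zeta>. fourier_integral (trunc n f) (- \<zeta>) - g (- \<zeta>))" for n
    by (simp add: fourier_integral_reflect)
  also have "\<dots>n = l2 (\<lambda>\<zeta>. fourier_integral (trunc n f) \<zeta> - g \<zeta>)" for n
    by (rule l2_reflect[of "\<lambda>\<zeta>. fourier_integral (trunc n f) \<zeta> - g \<zeta>"]) measurable
  finally show ?thesis using assms by (simp add: is_fourier_iff L2_reflect)
qed

text \<open>The positive and negative parts of \<open>u\<close> are densities of two measures that
  agree on boxes. Boxes are stable under intersection, generate the Borel sets and exhaust the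
  plane, so the measures coincide and with them the densities.\<close>

lemma AE_eq_0_if_box_integrals_eq_0_real:
  fixes u :: "plane \<Rightarrow> real"
  assumes [measurable]: "u \<in> borel_measurable borel"
    and int: "\<And>a b. integrable lborel (\<lambda>z. indicator (box a b) z * u z)"
    and zero: "\<And>a b. (LINT z|lborel. indicator (box a b) z * u z) = 0"
  shows "AE z in lborel. u z = 0"
proof -
  \<comment> \<open>\<open>ennreal\<close> cuts negative values off at 0, so \<open>?M u\<close> has
    the positive part of \<open>u\<close> as its density, and the measure formed with - u has the
    negative part.\<close>
  let ?M = "\<lambda>v. density lborel (\<lambda>z. ennreal (v z))"
  have em: "emeasure (?M v) (box a b) = (\<integral>\<^sup>+z. ennreal (indicator (box a b) z * v z) \<partial>lborel)"
    if "v \<in> borel_measurable borel" for v :: "plane \<Rightarrow> real" and a b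
    using that by (subst emeasure_density) (auto intro!: nn_integral_cong simp: indicator_def)
  have fin: "(\<integral>\<^sup>+z. ennreal (indicator (box a b) z * u z) \<partial>lborel) \<noteq> \<infinity>"
     "(\<integral>\<^sup>+z. ennreal (indicator (box a b) z * - u z) \<partial>lborel) \<noteq> \<infinity>" for a b
    using int[of a b] by (auto simp: real_integrable_def)
  have eq: "emeasure (?M u) (box a b) = emeasure (?M (\<lambda>z. - u z)) (box a b)" for a b
  proof -
    have "enn2real (\<integral>\<^sup>+z. ennreal (indicator (box a b) z * u z) \<partial>lborel)
        = enn2real (\<integral>\<^sup>+z. ennreal (indicator (box a b) z * - u z) \<partial>lborel)"
      using zero[of a b] real_lebesgue_integral_def[OF int[of a b]] by simp
    then have "ennreal (enn2real (\<integral>\<^sup>+z. ennreal (indicator (box a b) z * u z) \<partial>lborel))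
        = ennreal (enn2real (\<integral>\<^sup>+z. ennreal (indicator (box a b) z * - u z) \<partial>lborel))"
      by (rule arg_cong)
    then have "(\<integral>\<^sup>+z. ennreal (indicator (box a b) z * u z) \<partial>lborel)
        = (\<integral>\<^sup>+z. ennreal (indicator (box a b) z * - u z) \<partial>lborel)"
      using fin[of a b] by (simp only: ennreal_enn2real top.not_eq_extremum infinity_ennreal_def)
    then show ?thesis using em[of u a b] em[of "\<lambda>z. - u z" a b] by simp
  qed
  have "?M u = ?M (\<lambda>z. - u z)"
  proof (rule measure_eqI_generator_eq)
    let ?E = "range (\<lambda>(a, b). box a b :: plane set)"
    show "Int_stable ?E" by (auto simp: Int_stable_def box_Int_box)
    show "?E \<subseteq> Pow UNIV" "sets (?M u) = sigma_sets UNIV ?E" "sets (?M (\<lambda>z. - u z)) = sigma_sets UNIV ?E"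
      by (simp_all add: borel_eq_box)
    let ?A = "\<lambda>n::nat. box (- (real n *\<^sub>R One)) (real n *\<^sub>R One) :: plane set"
    show "range ?A \<subseteq> ?E" "(\<Union>i. ?A i) = UNIV" unfolding UN_box_eq_UNIV by auto
    show "emeasure (?M u) (?A i) \<noteq> \<infinity>" for i using fin(1) by (simp add: em)
    show "emeasure (?M u) X = emeasure (?M (\<lambda>z. - u z)) X" if "X \<in> ?E" for X
      using that eq by auto
  qed
  then have "AE z in lborel. ennreal (u z) = ennreal (- u z)"
    by (intro sigma_finite_measure.density_unique[OF sigma_finite_lborel]) measurable
  then show ?thesis
  proof eventually_elim
    case (elim z)
    then show ?case by (cases "0 \<le> u z") (auto simp: ennreal_neg ennreal_eq_0_iff)
  qed
qed

lemma L2_indicator_box: "(\<lambda>z. complex_of_real (indicator (box a b) z)) \<in> L2"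
  "integrable lborel (\<lambda>z::plane. complex_of_real (indicator (box a b) z))"
proof -
  have i: "integrable lborel (\<lambda>z::plane. indicator (box a b) z :: real)"
    by (intro integrable_real_indicator emeasure_bounded_finite bounded_box) auto
  then show "integrable lborel (\<lambda>z::plane. complex_of_real (indicator (box a b) z))"
    by (rule integrable_of_real)
  show "(\<lambda>z. complex_of_real (indicator (box a b) z)) \<in> L2"
    unfolding L2_iff by (intro conjI Bochner_Integration.integrable_cong[THEN iffD1, OF refl _ i])
      (auto simp: indicator_def)
qed

lemma AE_eq_0_if_box_integrals_eq_0:
  assumes "h \<in> L2" and zero: "\<And>a b. (LINT z|lborel. of_real (indicator (box a b) z) * h z) = 0"
  shows "AE z in lborel. h z = 0"
proof -
  have [measurable]: "h \<in> borel_measurable borel" using assms L2_measurable by blast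
  have i: "integrable lborel (\<lambda>z. of_real (indicator (box a b) z) * h z)" for a b
    by (rule L2_mult_integrable[OF L2_indicator_box(1) assms(1)])
  have iR: "integrable lborel (\<lambda>z. indicator (box a b) z * Re (h z))" for a b
    using integrable_Re[OF i[of a b]] by simp
  have iI: "integrable lborel (\<lambda>z. indicator (box a b) z * Im (h z))" for a b
    using integrable_Im[OF i[of a b]] by simp
  have R: "AE z in lborel. Re (h z) = 0"
    using integral_Re[OF i] zero by (intro AE_eq_0_if_box_integrals_eq_0_real iR) auto
  have I: "AE z in lborel. Im (h z) = 0"
    using integral_Im[OF i] zero by (intro AE_eq_0_if_box_integrals_eq_0_real iI) auto
  show ?thesis using R I by eventually_elim (simp add: complex_eq_iff)
qed

lemma integral_scale_plane:
  fixes f :: "plane \<Rightarrow> complex"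
  assumes "0 < c" and [measurable]: "f \<in> borel_measurable borel"
  shows "(LINT z|lborel. f z) = of_real (c\<^sup>2) * (LINT z|lborel. f (c *\<^sub>R z))"
proof -
  have "(LINT z|lborel. f z) = (LINT z|density (distr lborel borel (\<lambda>x. 0 + c *\<^sub>R x)) (\<lambda>_. \<bar>c\<bar>^DIM(plane)). f z)"
    using assms by (subst lborel_affine[of c 0]) auto
  also have "\<dots> = (LINT z|lborel. (c\<^sup>2) *\<^sub>R f (c *\<^sub>R z))"
    by (subst integral_density) (auto simp: integral_distr power2_eq_square)
  finally show ?thesis by (simp add: scaleR_conv_of_real)
qed

lemma heat_kernel_scale:
  assumes "0 < \<epsilon>" shows "\<epsilon>\<^sup>2 * heat_kernel \<epsilon> (\<epsilon> *\<^sub>R z) = heat_kernel 1 z"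
proof -
  have "\<epsilon> * normal_density 0 \<epsilon> (\<epsilon> * x) = std_normal_density x" for x
    using assms by (simp add: normal_density_def real_sqrt_mult power_mult_distrib)
  then show ?thesis
    by (simp add: heat_kernel_def power2_eq_square) (metis (no_types, opaque_lifting) mult.assoc mult.left_commute)
qed

text \<open>Rescaling freezes the kernel at \<epsilon> = 1 and leaves \<epsilon> only in the
  argument of \<open>f\<close>, the form in which dominated convergence applies.\<close>

lemma heat_eq_scaled:
  assumes "0 < \<epsilon>" and [measurable]: "f \<in> borel_measurable borel"
  shows "heat \<epsilon> f z = (LINT u|lborel. of_real (heat_kernel 1 u) * f (z + \<epsilon> *\<^sub>R u))"
proof -
  have "heat \<epsilon> f z = (LINT w|lborel. of_real (heat_kernel \<epsilon> w) * f (z + w))"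
    unfolding heat_def
    using integral_translate_plane[of "\<lambda>w. of_real (heat_kernel \<epsilon> (w - z)) * f w" z] by simp
  also have "\<dots> = of_real (\<epsilon>\<^sup>2) * (LINT u|lborel. of_real (heat_kernel \<epsilon> (\<epsilon> *\<^sub>R u)) * f (z + \<epsilon> *\<^sub>R u))"
    by (rule integral_scale_plane[OF assms(1)]) measurable
  also have "\<dots> = (LINT u|lborel. of_real (\<epsilon>\<^sup>2 * heat_kernel \<epsilon> (\<epsilon> *\<^sub>R u)) * f (z + \<epsilon> *\<^sub>R u))"
    by (simp add: mult.assoc flip: integral_mult_right_zero)
  finally show ?thesis by (simp only: heat_kernel_scale[OF assms(1)])
qed

lemma integral_heat_kernel: "0 < \<epsilon> \<Longrightarrow> (LINT z|lborel. heat_kernel \<epsilon> z) = 1"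
  by (subst integral_eq_nn_integral) (auto simp: nn_integral_heat_kernel)

lemma heat_tendsto:
  assumes [measurable]: "f \<in> borel_measurable borel" and "isCont f z" and B: "\<And>z. norm (f z) \<le> B"
  shows "(\<lambda>n. heat (1 / real (Suc n)) f z) \<longlonglongrightarrow> f z"
proof -
  have "(\<lambda>n. LINT u|lborel. of_real (heat_kernel 1 u) * f (z + (1 / real (Suc n)) *\<^sub>R u))
      \<longlonglongrightarrow> (LINT u|lborel. of_real (heat_kernel 1 u) * f z)"
  proof (rule integral_dominated_convergence[where w = "\<lambda>u. heat_kernel 1 u * B"])
    show "integrable lborel (\<lambda>u. heat_kernel 1 u * B)" using integrable_heat_kernel[of 1] by simp
    show "AE u in lborel. (\<lambda>n. of_real (heat_kernel 1 u) * f (z + (1 / real (Suc n)) *\<^sub>R u))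
       \<longlonglongrightarrow> of_real (heat_kernel 1 u) * f z"
    proof (rule AE_I2)
      fix u
      have "(\<lambda>n. z + (1 / real (Suc n)) *\<^sub>R u) \<longlonglongrightarrow> z + 0 *\<^sub>R u"
        by (intro tendsto_intros LIMSEQ_Suc[OF lim_1_over_n])
      then have "(\<lambda>n. f (z + (1 / real (Suc n)) *\<^sub>R u)) \<longlonglongrightarrow> f z"
        using isCont_tendsto_compose[OF assms(2)] by simp
      then show "(\<lambda>n. of_real (heat_kernel 1 u) * f (z + (1 / real (Suc n)) *\<^sub>R u))
       \<longlonglongrightarrow> of_real (heat_kernel 1 u) * f z" by (intro tendsto_intros)
    qed
    show "AE u in lborel. norm (of_real (heat_kernel 1 u) * f (z + (1 / real (Suc n)) *\<^sub>R u)) \<le> heat_kernel 1 u * B" for n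
      by (intro AE_I2) (simp add: norm_mult mult_left_mono[OF B])
  qed measurable
  also have "(LINT u|lborel. of_real (heat_kernel 1 u) * f z) = f z"
    by (simp add: integral_heat_kernel)
  finally show ?thesis by (simp add: heat_eq_scaled)
qed

lemma norm_heat_le:
  assumes [measurable]: "f \<in> borel_measurable borel" and "0 < \<epsilon>" and B: "\<And>z. norm (f z) \<le> B"
  shows "norm (heat \<epsilon> f z) \<le> B"
proof -
  have "norm (heat \<epsilon> f z) \<le> (LINT u|lborel. heat_kernel 1 u * B)"
    unfolding heat_eq_scaled[OF assms(2,1)]
  proof (rule Bochner_Integration.integral_norm_bound_integral)
    show "integrable lborel (\<lambda>u. of_real (heat_kernel 1 u) * f (z + \<epsilon> *\<^sub>R u))"
      using integrable_bounded_mult[of lborel "\<lambda>u. of_real (heat_kernel 1 u)" "\<lambda>u. f (z + \<epsilon> *\<^sub>R u)" B] B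
        integrable_of_real[OF integrable_heat_kernel[of 1]] by (simp add: mult.commute)
    show "integrable lborel (\<lambda>u. heat_kernel 1 u * B)" using integrable_heat_kernel[of 1] by simp
    show "norm (of_real (heat_kernel 1 u) * f (z + \<epsilon> *\<^sub>R u)) \<le> heat_kernel 1 u * B" for u
      by (simp add: norm_mult mult_left_mono[OF B])
  qed
  then show ?thesis by (simp add: integral_heat_kernel)
qed

text \<open>The kernel is even, so heat means are symmetric. In the inversion proof this moves the
  mean from \<open>f\<close>, which need not be continuous anywhere, to the indicator of a
  box.\<close>

lemma integral_heat_symmetric:
  assumes "integrable lborel f" "integrable lborel g"
  shows "(LINT z|lborel. f z * heat \<epsilon> g z) = (LINT z|lborel. heat \<epsilon> f z * g z)"
proof -
  let ?h = "\<lambda>z w. of_real (heat_kernel \<epsilon> (w - z)) * (f z * g w)"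
  have [measurable]: "f \<in> borel_measurable borel" "g \<in> borel_measurable borel" using assms by auto
  obtain B where B: "\<And>z. heat_kernel \<epsilon> z \<le> B" "0 \<le> B" using heat_kernel_bounded[of \<epsilon>] by blast
  have "integrable (lborel \<Otimes>\<^sub>M lborel) (\<lambda>p. complex_of_real (heat_kernel \<epsilon> (snd p - fst p)) * (f (fst p) * g (snd p)))"
    by (rule integrable_bounded_mult[OF integrable_tensor[OF assms], where C=B]) (use B in \<open>measurable, auto\<close>)
  then have i: "integrable (lborel \<Otimes>\<^sub>M lborel) (case_prod ?h)" by (simp add: case_prod_unfold)
  have "(LINT z|lborel. f z * heat \<epsilon> g z) = (LINT z|lborel. LINT w|lborel. ?h z w)"
    unfolding heat_def by (simp add: mult_ac flip: integral_mult_right_zero)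
  also have "\<dots> = (LINT w|lborel. LINT z|lborel. ?h z w)"
    by (rule lborel_pair.Fubini_integral[OF i, symmetric])
  also have "\<dots> = (LINT z|lborel. heat \<epsilon> f z * g z)"
  proof (rule Bochner_Integration.integral_cong[OF refl])
    fix w
    show "(LINT z|lborel. ?h z w) = heat \<epsilon> f w * g w"
      unfolding heat_def heat_kernel_minus_commute[of \<epsilon> _ w]
      by (subst integral_mult_left_zero[symmetric]) (simp add: mult_ac)
  qed
  finally show ?thesis .
qed

text \<open>The frontier of a convex set is a null set, and off the frontier the indicator is
  locally constant.\<close>

lemma AE_isCont_indicator_box:
  "AE z::plane in lborel. isCont (\<lambda>z. complex_of_real (indicator (box a b) z)) z"
proof -
  have "negligible (frontier (box a b :: plane set))"
    by (intro negligible_convex_frontier convex_box)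
  then have "frontier (box a b :: plane set) \<in> null_sets lebesgue" by (simp add: negligible_iff_null_sets)
  then have "AE z::plane in lborel. z \<notin> frontier (box a b)"
    by (intro AE_not_in) (simp add: null_sets_completion_iff frontier_closed borel_closed)
  then show ?thesis
  proof eventually_elim
    case (elim z)
    then have "z \<in> interior (box a b) \<or> z \<in> interior (- box a b)"
      by (auto simp: frontier_def interior_open[OF open_box] interior_complement)
    then show ?case
    proof
      assume *: "z \<in> interior (box a b)"
      have "\<forall>\<^sub>F w in nhds z. complex_of_real (indicator (box a b) w) = 1"
        using eventually_nhds_in_open[OF open_interior *] by eventually_elim (use interior_subset[of "box a b"] in \<open>auto simp: indicator_def\<close>)
      moreover have "isCont (\<lambda>z. 1::complex) z" by simp
      ultimately show ?thesis by (subst isCont_cong)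
    next
      assume *: "z \<in> interior (- box a b)"
      have "\<forall>\<^sub>F w in nhds z. complex_of_real (indicator (box a b) w) = 0"
        using eventually_nhds_in_open[OF open_interior *] 
        by eventually_elim (use interior_subset[of "- box a b"] in \<open>auto simp: indicator_def\<close>)
      moreover have "isCont (\<lambda>z. 0::complex) z" by simp
      ultimately show ?thesis by (subst isCont_cong)
    qed
  qed
qed

text \<open>Gaussian means of the inversion integral converge to \<open>f\<close> weakly, tested against boxes, and
  to the \<open>L\<^sup>2\<close> inverse transform strongly.\<close>

lemma is_fourier_inversion_integrable:
  assumes "f \<in> L2" "integrable lborel f"
  shows "is_fourier (fourier_integral f) (\<lambda>z. f (- z))"
proof -
  let ?F = "fourier_integral f" 
  define e where "e n = 1 / real (Suc n)" for n
  have e [simp]: "0 < e n" for n by (simp add: e_def)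
  have [measurable]: "f \<in> borel_measurable borel" using assms by auto
  have FL: "?F \<in> L2" by (rule fourier_integral_contraction[OF assms])
  obtain q where q: "is_fourier ?F q" using is_fourier_exists[OF FL] .
  have qL: "q \<in> L2" using q is_fourier_L2 by blast
  then have [measurable]: "q \<in> borel_measurable borel" using L2_measurable by blast
  \<comment> \<open>Damping makes the transform integrable, so that its own transform is a genuine
    integral, namely a reflected heat mean of \<open>f\<close>.\<close>
  define G where "G n \<zeta> = of_real (gauss (e n) \<zeta>) * ?F \<zeta>" for n \<zeta>
  have GL: "G n \<in> L2" for n
    unfolding G_def[abs_def] by (rule L2_mono(1)[OF FL]) (auto simp: norm_mult mult_left_le_one_le)
  have Gi: "integrable lborel (G n)" for n
    unfolding G_def[abs_def] by (rule integrable_gauss_mult_fourier[OF e assms(2)])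
  have FG: "fourier_integral (G n) (- z) = heat (e n) f z" for n z
    unfolding G_def[abs_def] by (rule fourier_integral_gauss_mult[OF e assms(2)])
  have isG: "is_fourier (G n) (fourier_integral (G n))" for n
    by (rule is_fourier_fourier_integral[OF GL Gi])
  have FGL: "fourier_integral (G n) \<in> L2" for n using isG is_fourier_L2 by blast
  have "(\<lambda>n. l2 (\<lambda>\<zeta>. ?F \<zeta> - G n \<zeta>)) \<longlonglongrightarrow> 0"
  proof (rule l2_dominated_convergence[OF FL])
    fix n \<zeta>
    have "norm (?F \<zeta> - G n \<zeta>) = norm (of_real (1 - gauss (e n) \<zeta>) * ?F \<zeta>)"
      by (simp add: G_def algebra_simps)
    also have "\<dots> = (1 - gauss (e n) \<zeta>) * norm (?F \<zeta>)"
      unfolding norm_mult norm_of_real by (simp add: abs_of_nonneg)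
    also have "\<dots> \<le> 1 * norm (?F \<zeta>)" by (intro mult_right_mono) auto
    finally show "norm (?F \<zeta> - G n \<zeta>) \<le> norm (?F \<zeta>)" by simp
  next
    fix \<zeta>
    have "(\<lambda>n. ?F \<zeta> - of_real (gauss (e n) \<zeta>) * ?F \<zeta>) \<longlonglongrightarrow> ?F \<zeta> - of_real 1 * ?F \<zeta>"
      by (intro tendsto_intros gauss_tendsto_1[folded e_def])
    then show "(\<lambda>n. ?F \<zeta> - G n \<zeta>) \<longlonglongrightarrow> 0" by (simp add: G_def)
  qed (unfold G_def, measurable)
  note A = this
  have B: "l2 (\<lambda>z. heat (e n) f z - q (- z)) \<le> l2 (\<lambda>\<zeta>. ?F \<zeta> - G n \<zeta>)" for n
  proof -
    have "l2 (\<lambda>z. heat (e n) f z - q (- z)) = l2 (\<lambda>z. fourier_integral (G n) z - q z)"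
      unfolding FG[symmetric] 
      using l2_reflect[OF L2_measurable[OF L2_diff[OF FGL qL]]] by simp
    also have "\<dots> \<le> l2 (\<lambda>\<zeta>. G n \<zeta> - ?F \<zeta>)"
      by (rule is_fourier_contraction[OF is_fourier_diff[OF isG q]])
    also have "\<dots> = l2 (\<lambda>\<zeta>. ?F \<zeta> - G n \<zeta>)" by (rule l2_minus_commute)
    finally show ?thesis .
  qed
  have lim: "(\<lambda>n. l2 (\<lambda>z. heat (e n) f z - q (- z))) \<longlonglongrightarrow> 0"
    by (rule Lim_null_comparison[OF always_eventually A]) (simp add: B)
  have hL: "heat (e n) f \<in> L2" for n
    using L2_reflect[OF FGL[of n]] by (simp add: FG)
  have q'L: "(\<lambda>z. q (- z)) \<in> L2" by (rule L2_reflect[OF qL])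
  \<comment> \<open>The pairings of the heat means with a box have two limits: by \<open>lim\<close>
    they tend to the pairing with the reflected \<open>q\<close>, and after moving the mean to the
    box they tend to the pairing with \<open>f\<close>.\<close>
  have "AE z in lborel. q (- z) - f z = 0"
  proof (rule AE_eq_0_if_box_integrals_eq_0)
    show "(\<lambda>z. q (- z) - f z) \<in> L2" by (intro L2_diff q'L assms)
    fix a b :: plane
    let ?b = "\<lambda>z. complex_of_real (indicator (box a b) z)"
    have bL: "?b \<in> L2" and bi: "integrable lborel ?b" by (rule L2_indicator_box)+
    have "(\<lambda>n. (LINT z|lborel. ?b z * heat (e n) f z) - (LINT z|lborel. ?b z * q (- z))) \<longlonglongrightarrow> 0"
    proof (rule Lim_null_comparison)
      show "(\<lambda>n. l2 ?b * l2 (\<lambda>z. heat (e n) f z - q (- z))) \<longlonglongrightarrow> 0"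
        using tendsto_mult[OF tendsto_const lim] by simp
      show "\<forall>\<^sub>F n in sequentially. norm ((LINT z|lborel. ?b z * heat (e n) f z) - (LINT z|lborel. ?b z * q (- z)))
         \<le> l2 ?b * l2 (\<lambda>z. heat (e n) f z - q (- z))"
        using Cauchy_Schwarz_l2_integral[OF bL L2_diff[OF hL q'L]]
        by (simp add: right_diff_distrib L2_mult_integrable bL hL q'L)
    qed
    then have 1: "(\<lambda>n. LINT z|lborel. ?b z * heat (e n) f z) \<longlonglongrightarrow> (LINT z|lborel. ?b z * q (- z))"
      by (rule LIM_zero_cancel)
    have "(\<lambda>n. LINT z|lborel. heat (e n) ?b z * f z) \<longlonglongrightarrow> (LINT z|lborel. ?b z * f z)"
    proof (rule integral_dominated_convergence[where w = "\<lambda>z. norm (f z)"])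
      show "AE z in lborel. (\<lambda>n. heat (e n) ?b z * f z) \<longlonglongrightarrow> ?b z * f z"
        using AE_isCont_indicator_box[of a b]
      proof eventually_elim
        case (elim z)
        have "(\<lambda>n. heat (e n) ?b z) \<longlonglongrightarrow> ?b z"
          by (rule heat_tendsto[OF _ elim, of 1, folded e_def]) (auto simp: indicator_def)
        then show ?case by (intro tendsto_intros)
      qed
      show "AE z in lborel. norm (heat (e n) ?b z * f z) \<le> norm (f z)" for n
      proof (rule AE_I2)
        fix z
        have "norm (heat (e n) ?b z) \<le> 1" by (rule norm_heat_le) (auto simp: indicator_def)
        then show "norm (heat (e n) ?b z * f z) \<le> norm (f z)" by (simp add: norm_mult mult_left_le_one_le)
      qed
    qed (use assms in auto)
    then have 2: "(\<lambda>n. LINT z|lborel. ?b z * heat (e n) f z) \<longlonglongrightarrow> (LINT z|lborel. ?b z * f z)"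
      by (simp only: integral_heat_symmetric[OF bi assms(2)])
    show "(LINT z|lborel. ?b z * (q (- z) - f z)) = 0"
      using LIMSEQ_unique[OF 1 2] by (simp add: right_diff_distrib L2_mult_integrable bL q'L assms)
  qed
  from AE_reflect_plane[OF this] have "AE z in lborel. q z = f (- z)" by simp
  with is_fourier_AE_cong[OF q, of ?F "\<lambda>z. f (- z)"] show ?thesis by auto
qed

text \<open>Density of the integrable functions: inversion is known for the truncations, and the
  contraction controls the error on both sides of the transform.\<close>

theorem is_fourier_inversion:
  assumes "is_fourier f g" shows "is_fourier g (\<lambda>z. f (- z))"
proof -
  have fL: "f \<in> L2" and gL: "g \<in> L2" using assms is_fourier_L2 by blast+
  let ?F = "\<lambda>n. fourier_integral (trunc n f)"
  have isF: "is_fourier (?F n) (\<lambda>z. trunc n f (- z))" for n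
    by (intro is_fourier_inversion_integrable L2_trunc trunc_integrable fL)
  obtain q where q: "is_fourier g q" using is_fourier_exists[OF gL] .
  have qL: "q \<in> L2" using q is_fourier_L2 by blast
  have "l2 (\<lambda>z. q z - f (- z)) = 0"
  proof (rule antisym[OF LIMSEQ_le_const l2_nonneg])
    show "(\<lambda>n. l2 (\<lambda>\<zeta>. ?F n \<zeta> - g \<zeta>) + l2 (\<lambda>z. f z - trunc n f z)) \<longlonglongrightarrow> 0"
      using tendsto_add[of "\<lambda>n. l2 (\<lambda>\<zeta>. ?F n \<zeta> - g \<zeta>)" 0, OF _ l2_trunc_tendsto[OF fL]] assms
      by (simp add: is_fourier_iff)
    have "l2 (\<lambda>z. q z - f (- z)) \<le> l2 (\<lambda>\<zeta>. ?F n \<zeta> - g \<zeta>) + l2 (\<lambda>z. f z - trunc n f z)" for n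
    proof -
      have "l2 (\<lambda>z. q z - f (- z)) \<le> l2 (\<lambda>z. q z - trunc n f (- z)) + l2 (\<lambda>z. trunc n f (- z) - f (- z))"
        by (intro l2_triangle_diff qL L2_reflect L2_trunc fL)
      also have "l2 (\<lambda>z. q z - trunc n f (- z)) \<le> l2 (\<lambda>\<zeta>. g \<zeta> - ?F n \<zeta>)"
        by (rule is_fourier_contraction[OF is_fourier_diff[OF q isF]])
      also have "l2 (\<lambda>z. trunc n f (- z) - f (- z)) = l2 (\<lambda>z. trunc n f z - f z)"
        by (rule l2_reflect[OF L2_measurable[OF L2_diff[OF L2_trunc[OF fL] fL]]])
      finally show ?thesis using l2_minus_commute[of g "?F n"] l2_minus_commute[of f "trunc n f"] by simp
    qed
    then show "\<exists>N. \<forall>n\<ge>N. l2 (\<lambda>z. q z - f (- z)) \<le> l2 (\<lambda>\<zeta>. ?F n \<zeta> - g \<zeta>) + l2 (\<lambda>z. f z - trunc n f z)" by blast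
  qed
  from l2_eq_0_imp_AE[OF L2_diff[OF qL L2_reflect[OF fL]] this]
  have "AE z in lborel. q z = f (- z)" by simp
  with is_fourier_AE_cong[OF q, of g "\<lambda>z. f (- z)"] L2_measurable[OF gL] L2_measurable[OF L2_reflect[OF fL]]
  show ?thesis by auto
qed

text \<open>A contraction whose inverse, up to reflection, is again a contraction preserves the
  norm.\<close>

theorem is_fourier_isometry:
  assumes "is_fourier f g" shows "l2 g = l2 f"
proof (rule antisym)
  show "l2 g \<le> l2 f" by (rule is_fourier_contraction[OF assms])
  have "l2 (\<lambda>z. f (- z)) \<le> l2 g" by (rule is_fourier_contraction[OF is_fourier_inversion[OF assms]])
  then show "l2 f \<le> l2 g" using assms by (simp add: l2_reflect L2_measurable is_fourier_L2)
qed

lemma is_fourier_surj: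
  assumes "g \<in> L2" obtains f where "is_fourier f g"
proof -
  obtain h where "is_fourier g h" using is_fourier_exists[OF assms] .
  from is_fourier_reflect[OF is_fourier_inversion[OF this]] show ?thesis using that by simp
qed

lemma is_fourier_inverse_integral:
  assumes "g \<in> L2" "integrable lborel g"
  shows "is_fourier (\<lambda>z. fourier_integral g (- z)) g"
  using is_fourier_reflect[OF is_fourier_inversion_integrable[OF assms]] by simp

lemma is_fourier_AE_inj:
  assumes "is_fourier f g" "is_fourier f' g'" "AE z in lborel. g z = g' z"
  shows "AE z in lborel. f z = f' z"
  using AE_reflect_plane[OF is_fourier_AE_unique[OF is_fourier_inversion[OF assms(1)] is_fourier_inversion[OF assms(2)] assms(3)]]
  by simp

lemma is_fourier_fourier: "f \<in> L2 \<Longrightarrow> is_fourier f (fourier f)"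
  unfolding fourier_def by (metis is_fourier_exists someI_ex)

lemma fourier_AE_eq: "is_fourier f g \<Longrightarrow> AE \<zeta> in lborel. fourier f \<zeta> = g \<zeta>"
  using is_fourier_AE_unique is_fourier_fourier is_fourier_L2(1) by blast

lemma fourier_L2: "f \<in> L2 \<Longrightarrow> fourier f \<in> L2"
  using is_fourier_fourier is_fourier_L2 by blast

text \<open>Surjectivity of the transform makes the choice in \<open>fourier_multiplier\<close>
  meaningful as soon as the product is in \<open>L2\<close>.\<close>

lemma is_fourier_multiplier:
  assumes "(\<lambda>\<zeta>. m \<zeta> * fourier f \<zeta>) \<in> L2"
  shows "is_fourier (fourier_multiplier m f) (\<lambda>\<zeta>. m \<zeta> * fourier f \<zeta>)"
  unfolding fourier_multiplier_def by (metis is_fourier_surj[OF assms] someI_ex)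

section \<open>Rapidly decreasing transforms and partial derivatives\<close>

text \<open>The Bessel potential on the Fourier side. The exponent is halved because
  \<open>sobolev_norm\<close> applies the power s to the square of the transform.\<close>

definition bessel :: "real \<Rightarrow> (plane \<Rightarrow> complex) \<Rightarrow> plane \<Rightarrow> complex" where
  "bessel s g \<zeta> = complex_of_real ((1 + (norm \<zeta>)\<^sup>2) powr (s / 2)) * g \<zeta>"

text \<open>Transforms of functions in all Sobolev spaces. The class is stable under symbols of
  polynomial growth, hence under the symbols of the spatial operators in the equation.\<close>

definition rapid :: "(plane \<Rightarrow> complex) set" where
  "rapid = {g. \<forall>s\<ge>0. bessel s g \<in> L2}"

lemma weight_pos [simp]: "0 < 1 + (norm (\<zeta> :: plane))\<^sup>2"
  by (simp add: add_pos_nonneg)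

lemma weight_ne_0 [simp]: "1 + (norm (\<zeta> :: plane))\<^sup>2 \<noteq> 0"
  using weight_pos[of \<zeta>] by linarith

lemma bessel_0 [simp]: "bessel 0 g = g"
  by (auto simp: bessel_def)

lemma bessel_measurable [measurable]:
  assumes [measurable]: "g \<in> borel_measurable borel" shows "bessel s g \<in> borel_measurable borel"
  unfolding bessel_def[abs_def] by measurable

lemma bessel_diff: "bessel s (\<lambda>\<zeta>. f \<zeta> - g \<zeta>) = (\<lambda>\<zeta>. bessel s f \<zeta> - bessel s g \<zeta>)"
  by (auto simp: bessel_def algebra_simps)

lemma norm_bessel: "norm (bessel s g \<zeta>) = (1 + (norm \<zeta>)\<^sup>2) powr (s / 2) * norm (g \<zeta>)"
  by (simp add: bessel_def norm_mult)

lemma sobolev_norm_eq: "f \<in> L2 \<Longrightarrow> sobolev_norm s f = L2_norm (bessel s (fourier f))"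
  by (simp add: sobolev_norm_def L2_norm_def norm_bessel power_mult_distrib powr_power)

lemma L2_norm_less_infty_imp: "g \<in> borel_measurable borel \<Longrightarrow> L2_norm g < \<infinity> \<Longrightarrow> g \<in> L2"
  by (simp add: L2_def)

lemma sobolev_imp_bessel_L2:
  assumes "f \<in> sobolev s" shows "bessel s (fourier f) \<in> L2"
proof -
  have "f \<in> L2" and *: "sobolev_norm s f < \<infinity>" using assms by (auto simp: sobolev_def)
  then have "fourier f \<in> borel_measurable borel" by (intro L2_measurable fourier_L2)
  then have "bessel s (fourier f) \<in> borel_measurable borel" by measurable
  then show ?thesis using * sobolev_norm_eq[OF \<open>f \<in> L2\<close>] by (intro L2_norm_less_infty_imp) auto
qed

lemma H_infinity_L2: "f \<in> H_infinity \<Longrightarrow> f \<in> L2"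
  unfolding H_infinity_def sobolev_def by (auto dest: spec[of _ 0])

lemma H_infinity_rapid: "f \<in> H_infinity \<Longrightarrow> fourier f \<in> rapid"
  by (auto simp: H_infinity_def rapid_def sobolev_imp_bessel_L2)

lemma rapid_L2: "g \<in> rapid \<Longrightarrow> g \<in> L2"
  by (auto simp: rapid_def dest: spec[of _ 0])

lemma rapid_bessel_L2: "g \<in> rapid \<Longrightarrow> 0 \<le> s \<Longrightarrow> bessel s g \<in> L2"
  by (auto simp: rapid_def)

lemma rapid_mult:
  assumes "g \<in> rapid" and [measurable]: "m \<in> borel_measurable borel"
    and m: "\<And>\<zeta>. norm (m \<zeta>) \<le> (1 + (norm \<zeta>)\<^sup>2) powr (r / 2)" and "0 \<le> r"
  shows "(\<lambda>\<zeta>. m \<zeta> * g \<zeta>) \<in> rapid"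
  unfolding rapid_def
proof (safe)
  fix s :: real assume "0 \<le> s"
  have [measurable]: "g \<in> borel_measurable borel" using assms(1) rapid_L2 L2_measurable by blast
  show "bessel s (\<lambda>\<zeta>. m \<zeta> * g \<zeta>) \<in> L2"
  proof (rule L2_mono(1))
    show "bessel (r + s) g \<in> L2" using assms(1,4) \<open>0 \<le> s\<close> by (simp add: rapid_bessel_L2)
    show "norm (bessel s (\<lambda>\<zeta>. m \<zeta> * g \<zeta>) \<zeta>) \<le> norm (bessel (r + s) g \<zeta>)" for \<zeta>
      using mult_right_mono[OF m[of \<zeta>], of "(1 + (norm \<zeta>)\<^sup>2) powr (s / 2) * norm (g \<zeta>)"]
      by (simp add: norm_bessel norm_mult add_divide_distrib powr_add mult_ac)
  qed measurable
qed

lemma abs_fst_le_norm: "\<bar>fst (\<zeta>::plane)\<bar> \<le> norm \<zeta>" and abs_snd_le_norm: "\<bar>snd (\<zeta>::plane)\<bar> \<le> norm \<zeta>"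
  using norm_fst_le[of "fst \<zeta>" "snd \<zeta>"] norm_snd_le[of "snd \<zeta>" "fst \<zeta>"] by (auto simp: norm_Pair)

lemma norm_le_weight: "norm (\<zeta>::plane) \<le> (1 + (norm \<zeta>)\<^sup>2) powr (1 / 2)"
  by (simp add: powr_half_sqrt real_le_rsqrt)

lemma integrable_inverse_weight_1d: "integrable lborel (\<lambda>x::real. inverse (1 + x\<^sup>2))"
  using integrable_inverse_1_plus_square
  by (simp add: set_integrable_def)

text \<open>The square of 1 + |\<zeta>|^2 dominates the product of 1 + \<xi>^2 and 1 + \<eta>^2,
  which reduces integrability over the plane to the arctangent integral in each variable.\<close>

lemma inverse_weight_L2: "(\<lambda>\<zeta>::plane. complex_of_real (inverse (1 + (norm \<zeta>)\<^sup>2))) \<in> L2"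
proof -
  have "integrable lborel (\<lambda>x::real. complex_of_real (inverse (1 + x\<^sup>2)))"
    using integrable_of_real[OF integrable_inverse_weight_1d] .
  from integrable_tensor[OF this this]
  have i: "integrable lborel (\<lambda>\<zeta>::plane. complex_of_real (inverse (1 + (fst \<zeta>)\<^sup>2)) * complex_of_real (inverse (1 + (snd \<zeta>)\<^sup>2)))"
    by (simp only: lborel_prod)
  have le: "(inverse (1 + (norm \<zeta>)\<^sup>2))\<^sup>2 \<le> inverse (1 + (fst \<zeta>)\<^sup>2) * inverse (1 + (snd \<zeta>)\<^sup>2)" for \<zeta> :: plane
  proof -
    have f: "(fst \<zeta>)\<^sup>2 \<le> (norm \<zeta>)\<^sup>2" "(snd \<zeta>)\<^sup>2 \<le> (norm \<zeta>)\<^sup>2"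
      using power_mono[OF abs_fst_le_norm, where n=2] power_mono[OF abs_snd_le_norm, where n=2] by auto
    have "(inverse (1 + (norm \<zeta>)\<^sup>2)) * inverse (1 + (norm \<zeta>)\<^sup>2) \<le> inverse (1 + (fst \<zeta>)\<^sup>2) * inverse (1 + (snd \<zeta>)\<^sup>2)"
      using f by (intro mult_mono le_imp_inverse_le) (auto simp: add_pos_nonneg)
    then show ?thesis by (simp add: power2_eq_square)
  qed
  have "integrable lborel (\<lambda>\<zeta>::plane. (norm (complex_of_real (inverse (1 + (norm \<zeta>)\<^sup>2))))\<^sup>2)"
  proof (rule Bochner_Integration.integrable_bound[OF i])
    have "norm ((norm (complex_of_real (inverse (1 + (norm \<zeta>)\<^sup>2))))\<^sup>2) \<le>
        norm (complex_of_real (inverse (1 + (fst \<zeta>)\<^sup>2)) * complex_of_real (inverse (1 + (snd \<zeta>)\<^sup>2)))" for \<zeta> :: plane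
      using order_trans[OF le[of \<zeta>] abs_ge_self] unfolding norm_of_real norm_mult real_norm_def power2_abs abs_power2 abs_mult .
    then show "AE \<zeta> in lborel. norm ((norm (complex_of_real (inverse (1 + (norm (\<zeta>::plane))\<^sup>2))))\<^sup>2) \<le>
        norm (complex_of_real (inverse (1 + (fst \<zeta>)\<^sup>2)) * complex_of_real (inverse (1 + (snd \<zeta>)\<^sup>2)))" by simp
  qed measurable
  moreover have "(\<lambda>\<zeta>::plane. complex_of_real (inverse (1 + (norm \<zeta>)\<^sup>2))) \<in> borel_measurable lborel" by measurable
  ultimately show ?thesis unfolding L2_iff by simp
qed

text \<open>Sobolev embedding in its simplest form: two derivatives suffice in dimension two, since
  the inverse weight is then in \<open>L2\<close>.\<close>

lemma rapid_integrable:
  assumes "g \<in> rapid" shows "integrable lborel g"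
proof -
  have "integrable lborel (\<lambda>\<zeta>. complex_of_real (inverse (1 + (norm \<zeta>)\<^sup>2)) * bessel 2 g \<zeta>)"
    by (rule L2_mult_integrable[OF inverse_weight_L2 rapid_bessel_L2[OF assms]]) simp
  also have "(\<lambda>\<zeta>. complex_of_real (inverse (1 + (norm \<zeta>)\<^sup>2)) * bessel 2 g \<zeta>) = g"
  proof
    fix \<zeta> 
    have "complex_of_real (inverse (1 + (norm \<zeta>)\<^sup>2)) * bessel 2 g \<zeta> = complex_of_real (inverse (1 + (norm \<zeta>)\<^sup>2) * (1 + (norm \<zeta>)\<^sup>2)) * g \<zeta>"
      unfolding of_real_mult by (simp add: bessel_def mult.assoc)
    then show "complex_of_real (inverse (1 + (norm \<zeta>)\<^sup>2)) * bessel 2 g \<zeta> = g \<zeta>"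
      by (subst (asm) left_inverse) auto
  qed
  finally show ?thesis .
qed

lemma rapid_inner_mult: "g \<in> rapid \<Longrightarrow> norm e \<le> 1 \<Longrightarrow> (\<lambda>\<zeta>. \<i> * of_real (e \<bullet> \<zeta>) * g \<zeta>) \<in> rapid"
proof (rule rapid_mult[where r=1])
  assume "norm e \<le> 1"
  then have "\<bar>e \<bullet> \<zeta>\<bar> \<le> 1 * norm \<zeta>" for \<zeta>
    using Cauchy_Schwarz_ineq2[of e \<zeta>] by (meson mult_right_mono norm_ge_zero order_trans)
  then show "norm (\<i> * complex_of_real (e \<bullet> \<zeta>)) \<le> (1 + (norm \<zeta>)\<^sup>2) powr (1 / 2)" for \<zeta>
    using norm_le_weight[of \<zeta>] by (simp add: norm_mult) (meson order_trans)
qed auto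

section \<open>Differentiation of inverse transforms\<close>

lemma cis_approx1: "norm (cis x - 1) \<le> \<bar>x\<bar>"
  using iexp_approx1[of x 0] by (simp add: cis_conv_exp)

lemma cis_approx2: "norm (cis x - 1 - \<i> * of_real x) \<le> x\<^sup>2"
proof -
  have "norm (cis x - 1 - \<i> * of_real x) \<le> x\<^sup>2 / 2"
    using iexp_approx1[of x 1] by (simp add: cis_conv_exp numeral_2_eq_2 algebra_simps)
  then show ?thesis using zero_le_power2[of x] by linarith
qed

text \<open>Second-order Taylor expansion of the exponential under the integral, uniformly in the
  point and the direction. The constant is the second absolute moment of \<open>g\<close>, finite
  because |\<zeta>|^2 * g is again in \<open>rapid\<close>.\<close>

lemma inverse_fourier_difference_le:
  assumes "g \<in> rapid"
  obtains C where "\<And>z e h. norm e \<le> 1 \<Longrightarrow> norm (fourier_integral g (- (z + h *\<^sub>R e)) - fourier_integral g (- z)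
       - of_real h * fourier_integral (\<lambda>\<zeta>. \<i> * of_real (e \<bullet> \<zeta>) * g \<zeta>) (- z)) \<le> C * h\<^sup>2"
proof
  have [measurable]: "g \<in> borel_measurable borel" using assms(1) rapid_L2 L2_measurable by blast
  define C where "C = (LINT \<zeta>|lborel. (norm \<zeta>)\<^sup>2 * norm (g \<zeta>))"
  have gi: "integrable lborel g" by (rule rapid_integrable[OF assms])
  have "(\<lambda>\<zeta>. complex_of_real ((norm \<zeta>)\<^sup>2) * g \<zeta>) \<in> rapid"
    by (rule rapid_mult[OF assms, where r=2]) (auto simp: norm_power)
  from rapid_integrable[OF this] have i: "integrable lborel (\<lambda>\<zeta>. (norm \<zeta>)\<^sup>2 * norm (g \<zeta>))"
    by (drule_tac integrable_norm) (simp add: norm_mult norm_power)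
  fix z e :: plane and h :: real assume e: "norm e \<le> 1"
  have egi: "integrable lborel (\<lambda>\<zeta>. \<i> * of_real (e \<bullet> \<zeta>) * g \<zeta>)"
    by (intro rapid_integrable rapid_inner_mult assms e)
  let ?D = "fourier_integral g (- (z + h *\<^sub>R e)) - fourier_integral g (- z)
       - of_real h * fourier_integral (\<lambda>\<zeta>. \<i> * of_real (e \<bullet> \<zeta>) * g \<zeta>) (- z)"
  let ?k = "\<lambda>\<zeta>. cis (\<zeta> \<bullet> z) * (cis (h * (e \<bullet> \<zeta>)) - 1 - \<i> * of_real (h * (e \<bullet> \<zeta>))) * g \<zeta>"
  have keq: "?k \<zeta> = cis (\<zeta> \<bullet> (z + h *\<^sub>R e)) * g \<zeta> - cis (\<zeta> \<bullet> z) * g \<zeta> - of_real h * (cis (\<zeta> \<bullet> z) * (\<i> * of_real (e \<bullet> \<zeta>) * g \<zeta>))" for \<zeta>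
    by (simp add: cis_mult[symmetric] inner_add_right algebra_simps inner_commute)
  have "?D = of_real (1 / (2*pi)) * (LINT \<zeta>|lborel. ?k \<zeta>)"
    unfolding keq fourier_integral_def
    by (subst Bochner_Integration.integral_diff, (intro Bochner_Integration.integrable_diff integrable_mult_right integrable_cis_mult gi egi; measurable)+, subst Bochner_Integration.integral_diff,
        (intro Bochner_Integration.integrable_diff integrable_mult_right integrable_cis_mult gi egi; measurable)+)
       (simp add: algebra_simps)
  also have "norm \<dots> \<le> 1 * norm (LINT \<zeta>|lborel. ?k \<zeta>)"
    unfolding norm_mult norm_of_real using pi_ge_two by (intro mult_right_mono) auto
  also have "\<dots> \<le> 1 * (LINT \<zeta>|lborel. h\<^sup>2 * ((norm \<zeta>)\<^sup>2 * norm (g \<zeta>)))"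
  proof (intro mult_left_mono Bochner_Integration.integral_norm_bound_integral)
    show "integrable lborel ?k" unfolding keq
      by (intro Bochner_Integration.integrable_diff integrable_mult_right integrable_cis_mult gi egi; measurable)
    show "integrable lborel (\<lambda>\<zeta>. h\<^sup>2 * ((norm \<zeta>)\<^sup>2 * norm (g \<zeta>)))" using i by simp
    fix \<zeta> :: plane
    have "\<bar>e \<bullet> \<zeta>\<bar> \<le> 1 * norm \<zeta>" 
      using Cauchy_Schwarz_ineq2[of e \<zeta>] e by (meson mult_right_mono norm_ge_zero order_trans)
    then have "(e \<bullet> \<zeta>)\<^sup>2 \<le> (norm \<zeta>)\<^sup>2" using power_mono[of "\<bar>e \<bullet> \<zeta>\<bar>" "norm \<zeta>" 2] by simp
    then have "(h * (e \<bullet> \<zeta>))\<^sup>2 \<le> h\<^sup>2 * (norm \<zeta>)\<^sup>2" by (simp add: power_mult_distrib mult_left_mono)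
    then have "norm (cis (h * (e \<bullet> \<zeta>)) - 1 - \<i> * of_real (h * (e \<bullet> \<zeta>))) \<le> h\<^sup>2 * (norm \<zeta>)\<^sup>2"
      using cis_approx2[of "h * (e \<bullet> \<zeta>)"] by linarith
    from mult_right_mono[OF this, of "norm (g \<zeta>)"]
    show "norm (?k \<zeta>) \<le> h\<^sup>2 * ((norm \<zeta>)\<^sup>2 * norm (g \<zeta>))" by (simp add: norm_mult mult.assoc)
  qed simp
  finally show "norm ?D \<le> C * h\<^sup>2" by (simp add: C_def mult.commute)
qed

lemma inverse_fourier_has_vector_derivative:
  assumes "g \<in> rapid" "norm e \<le> 1"
  shows "((\<lambda>h. fourier_integral g (- (z + h *\<^sub>R e))) has_vector_derivative
     fourier_integral (\<lambda>\<zeta>. \<i> * of_real (e \<bullet> \<zeta>) * g \<zeta>) (- z)) (at 0)"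
proof -
  obtain C where C: "\<And>z e h. norm e \<le> 1 \<Longrightarrow> norm (fourier_integral g (- (z + h *\<^sub>R e)) - fourier_integral g (- z)
       - of_real h * fourier_integral (\<lambda>\<zeta>. \<i> * of_real (e \<bullet> \<zeta>) * g \<zeta>) (- z)) \<le> C * h\<^sup>2"
    by (rule inverse_fourier_difference_le[OF assms(1)]) blast
  show ?thesis
    unfolding has_vector_derivative_def has_derivative_at
  proof (safe)
    show "bounded_linear (\<lambda>h. h *\<^sub>R fourier_integral (\<lambda>\<zeta>. \<i> * of_real (e \<bullet> \<zeta>) * g \<zeta>) (- z))"
      by (rule bounded_linear_scaleR_left)
    have lim: "((\<lambda>h. C * norm h) \<longlongrightarrow> 0) (at (0::real))"
      by (intro tendsto_eq_intros) auto
    show "(\<lambda>h. norm (fourier_integral g (- (z + (0 + h) *\<^sub>R e)) - fourier_integral g (- (z + 0 *\<^sub>R e))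
       - h *\<^sub>R fourier_integral (\<lambda>\<zeta>. \<i> * of_real (e \<bullet> \<zeta>) * g \<zeta>) (- z)) / norm h) \<midarrow>0\<rightarrow> 0"
    proof (rule Lim_null_comparison[OF _ lim])
      show "\<forall>\<^sub>F h in at 0. norm (norm (fourier_integral g (- (z + (0 + h) *\<^sub>R e)) - fourier_integral g (- (z + 0 *\<^sub>R e))
       - h *\<^sub>R fourier_integral (\<lambda>\<zeta>. \<i> * of_real (e \<bullet> \<zeta>) * g \<zeta>) (- z)) / norm h) \<le> C * norm h"
        using C[OF assms(2), of z] 
        by (auto simp: eventually_at_filter divide_simps scaleR_conv_of_real power2_eq_square mult.assoc abs_mult_self_eq)
    qed
  qed
qed

lemma partial_inverse_fourier:
  assumes "g \<in> rapid"
  shows "partial_x (\<lambda>z. fourier_integral g (- z)) = (\<lambda>z. fourier_integral (\<lambda>\<zeta>. \<i> * of_real (fst \<zeta>) * g \<zeta>) (- z))"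
    and "partial_y (\<lambda>z. fourier_integral g (- z)) = (\<lambda>z. fourier_integral (\<lambda>\<zeta>. \<i> * of_real (snd \<zeta>) * g \<zeta>) (- z))"
proof -
  have shift: "(f has_vector_derivative d) (at x)" if "((\<lambda>h. f (x + h)) has_vector_derivative d) (at 0)"
    for f :: "real \<Rightarrow> complex" and d x
    using that unfolding has_vector_derivative_def has_derivative_at by simp
  have e: "norm ((1, 0) :: plane) \<le> 1" "norm ((0, 1) :: plane) \<le> 1" by (auto simp: norm_Pair)
  show "partial_x (\<lambda>z. fourier_integral g (- z)) = (\<lambda>z. fourier_integral (\<lambda>\<zeta>. \<i> * of_real (fst \<zeta>) * g \<zeta>) (- z))"
    unfolding partial_x_def
  proof (intro ext, clarify)
    fix x y
    show "vector_derivative (\<lambda>u. fourier_integral g (- (u, y))) (at x) =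
       fourier_integral (\<lambda>\<zeta>. \<i> * of_real (fst \<zeta>) * g \<zeta>) (- (x, y))"
      by (rule vector_derivative_at, rule shift)
        (use inverse_fourier_has_vector_derivative[OF assms e(1), of "(x, y)"] in \<open>simp add: inner_prod_def\<close>)
  qed
  show "partial_y (\<lambda>z. fourier_integral g (- z)) = (\<lambda>z. fourier_integral (\<lambda>\<zeta>. \<i> * of_real (snd \<zeta>) * g \<zeta>) (- z))"
    unfolding partial_y_def
  proof (intro ext, clarify)
    fix x y
    show "vector_derivative (\<lambda>u. fourier_integral g (- (x, u))) (at y) =
       fourier_integral (\<lambda>\<zeta>. \<i> * of_real (snd \<zeta>) * g \<zeta>) (- (x, y))"
      by (rule vector_derivative_at, rule shift)
        (use inverse_fourier_has_vector_derivative[OF assms e(2), of "(x, y)"] in \<open>simp add: inner_prod_def\<close>)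
  qed
qed

lemma continuous_on_fourier_integral:
  assumes "integrable lborel g" shows "continuous_on UNIV (fourier_integral g)"
  unfolding continuous_on_eq_continuous_within continuous_within_sequentially
proof (safe, simp add: o_def)
  fix x :: "nat \<Rightarrow> plane" and a assume x: "x \<longlonglongrightarrow> a"
  have "(\<lambda>n. LINT z|lborel. cis (- (z \<bullet> x n)) * g z) \<longlonglongrightarrow> (LINT z|lborel. cis (- (z \<bullet> a)) * g z)"
  proof (rule integral_dominated_convergence[where w = "\<lambda>z. norm (g z)"])
    show "AE z in lborel. (\<lambda>n. cis (- (z \<bullet> x n)) * g z) \<longlonglongrightarrow> cis (- (z \<bullet> a)) * g z"
      unfolding cis_conv_exp by (intro AE_I2 tendsto_intros x)
  qed (use assms in \<open>auto simp: norm_mult\<close>)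
  then show "(\<lambda>n. fourier_integral g (x n)) \<longlonglongrightarrow> fourier_integral g a"
    unfolding fourier_integral_def by (intro tendsto_intros)
qed

lemma AE_eq_continuous_imp_eq:
  fixes f g :: "plane \<Rightarrow> complex"
  assumes "continuous_on UNIV f" "continuous_on UNIV g" "AE z in lborel. f z = g z"
  shows "f = g"
proof
  fix z
  have "closed {z. f z = g z}" by (rule closed_Collect_eq[OF assms(1,2)])
  then show "f z = g z" using mem_closed_if_AE_lebesgue[of "{z. f z = g z}" z] AE_completion[OF assms(3)] by simp
qed

text \<open>Membership in \<open>H_infinity\<close> includes continuity, so almost everywhere
  equality with the inverse integral becomes equality at every point. The classical partial
  derivatives can then be computed through the transform.\<close>

lemma H_infinity_inversion:
  assumes "f \<in> H_infinity" shows "f = (\<lambda>z. fourier_integral (fourier f) (- z))"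
proof (rule AE_eq_continuous_imp_eq)
  have r: "fourier f \<in> rapid" using assms by (rule H_infinity_rapid)
  show "continuous_on UNIV f" using assms by (simp add: H_infinity_def)
  have "continuous_on UNIV (fourier_integral (fourier f) \<circ> uminus)"
    by (intro continuous_on_compose continuous_intros continuous_on_subset[OF continuous_on_fourier_integral] rapid_integrable r) auto
  then show "continuous_on UNIV (\<lambda>z. fourier_integral (fourier f) (- z))" by (simp add: o_def)
  show "AE z in lborel. f z = fourier_integral (fourier f) (- z)"
    by (rule is_fourier_AE_inj[OF is_fourier_fourier[OF H_infinity_L2[OF assms]] 
        is_fourier_inverse_integral[OF rapid_L2[OF r] rapid_integrable[OF r]]]) simp
qed

lemma partial_x_eq:
  assumes "f \<in> H_infinity"
  shows "partial_x f = (\<lambda>z. fourier_integral (\<lambda>\<zeta>. \<i> * of_real (fst \<zeta>) * fourier f \<zeta>) (- z))"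
  by (subst H_infinity_inversion[OF assms], rule partial_inverse_fourier(1)[OF H_infinity_rapid[OF assms]])

lemma partial_y_eq:
  assumes "f \<in> H_infinity"
  shows "partial_y f = (\<lambda>z. fourier_integral (\<lambda>\<zeta>. \<i> * of_real (snd \<zeta>) * fourier f \<zeta>) (- z))"
  by (subst H_infinity_inversion[OF assms], rule partial_inverse_fourier(2)[OF H_infinity_rapid[OF assms]])

lemma rapid_fst: "g \<in> rapid \<Longrightarrow> (\<lambda>\<zeta>. \<i> * of_real (fst \<zeta>) * g \<zeta>) \<in> rapid"
  and rapid_snd: "g \<in> rapid \<Longrightarrow> (\<lambda>\<zeta>. \<i> * of_real (snd \<zeta>) * g \<zeta>) \<in> rapid"
  using rapid_inner_mult[of g "(1,0)"] rapid_inner_mult[of g "(0,1)"] by (simp_all add: inner_prod_def norm_Pair)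

lemma is_fourier_inverse_rapid: "g \<in> rapid \<Longrightarrow> is_fourier (\<lambda>z. fourier_integral g (- z)) g"
  by (intro is_fourier_inverse_integral rapid_L2 rapid_integrable)

text \<open>The symbol of the spatial operator divided by i: D_x^\<alpha> d/dx has symbol i \<xi>
  |\<xi>|^\<alpha>, and the product of - i sgn \<xi> with the square of i \<eta> is i sgn \<xi>
  \<eta>^2.\<close>

definition dispersion :: "real \<Rightarrow> plane \<Rightarrow> real" where
  "dispersion \<alpha> \<zeta> = fst \<zeta> * \<bar>fst \<zeta>\<bar> powr \<alpha> + sgn (fst \<zeta>) * (snd \<zeta>)\<^sup>2"

text \<open>\<open>fourier f\<close> is only one representative of the transform; this version
  permits an explicit representative \<open>g\<close> in its place.\<close>

lemma is_fourier_multiplier_AE: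
  assumes "is_fourier f g" "(\<lambda>\<zeta>. m \<zeta> * g \<zeta>) \<in> L2" and [measurable]: "m \<in> borel_measurable borel"
  shows "is_fourier (fourier_multiplier m f) (\<lambda>\<zeta>. m \<zeta> * g \<zeta>)"
proof -
  have ae: "AE \<zeta> in lborel. m \<zeta> * g \<zeta> = m \<zeta> * fourier f \<zeta>"
    using fourier_AE_eq[OF assms(1)] by eventually_elim simp
  have [measurable]: "fourier f \<in> borel_measurable borel" 
    using fourier_L2 is_fourier_L2(1)[OF assms(1)] L2_measurable by blast
  have "(\<lambda>\<zeta>. m \<zeta> * fourier f \<zeta>) \<in> L2" 
    by (rule L2_AE_cong[OF assms(2) _ ae]) measurable
  note * = is_fourier_multiplier[OF this]
  show ?thesis
    by (rule is_fourier_AE_cong[OF *]) 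
      (use ae L2_measurable[OF is_fourier_L2(1)[OF *]] L2_measurable[OF assms(2)] in \<open>auto elim: eventually_mono\<close>)
qed

lemma fourier_dispersive_terms:
  assumes "f \<in> H_infinity" "0 < \<alpha>" "\<alpha> \<le> 1"
  shows "is_fourier (\<lambda>z. frac_deriv_x \<alpha> (partial_x f) z + hilbert_x (partial_y (partial_y f)) z)
    (\<lambda>\<zeta>. \<i> * of_real (dispersion \<alpha> \<zeta>) * fourier f \<zeta>)"
proof -
  let ?g = "fourier f"
  have r: "?g \<in> rapid" using assms(1) by (rule H_infinity_rapid)
  have px: "is_fourier (partial_x f) (\<lambda>\<zeta>. \<i> * of_real (fst \<zeta>) * ?g \<zeta>)"
    unfolding partial_x_eq[OF assms(1)] by (intro is_fourier_inverse_rapid rapid_fst r)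
  have pyy: "is_fourier (partial_y (partial_y f)) (\<lambda>\<zeta>. \<i> * of_real (snd \<zeta>) * (\<i> * of_real (snd \<zeta>) * ?g \<zeta>))"
    unfolding partial_y_eq[OF assms(1)] partial_inverse_fourier(2)[OF rapid_snd[OF r]]
    by (intro is_fourier_inverse_rapid rapid_snd r)
  let ?m = "\<lambda>(\<xi>, \<eta>::real). complex_of_real (\<bar>\<xi>\<bar> powr \<alpha>)"
  have "norm (?m \<zeta>) \<le> (1 + (norm \<zeta>)\<^sup>2) powr (\<alpha> / 2)" for \<zeta>
  proof -
    have "\<bar>fst \<zeta>\<bar> powr \<alpha> \<le> ((1 + (norm \<zeta>)\<^sup>2) powr (1 / 2)) powr \<alpha>"
      using assms(2) order_trans[OF abs_fst_le_norm norm_le_weight] by (intro powr_mono2) auto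
    then show ?thesis by (simp add: powr_powr case_prod_beta)
  qed
  then have "(\<lambda>\<zeta>. ?m \<zeta> * (\<i> * of_real (fst \<zeta>) * ?g \<zeta>)) \<in> rapid"
    using assms(2) by (intro rapid_mult[OF rapid_fst[OF r], where r=\<alpha>]) (auto simp: borel_prod[symmetric])
  then have 1: "is_fourier (frac_deriv_x \<alpha> (partial_x f)) (\<lambda>\<zeta>. ?m \<zeta> * (\<i> * of_real (fst \<zeta>) * ?g \<zeta>))"
    unfolding frac_deriv_x_def 
    by (intro is_fourier_multiplier_AE[OF px] rapid_L2) (auto simp: borel_prod[symmetric])
  let ?h = "\<lambda>(\<xi>, \<eta>::real). - \<i> * complex_of_real (sgn \<xi>)"
  have hm: "?h \<in> borel_measurable borel" by (auto simp: borel_prod[symmetric])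
  have "(\<lambda>\<zeta>. ?h \<zeta> * (\<i> * of_real (snd \<zeta>) * (\<i> * of_real (snd \<zeta>) * ?g \<zeta>))) \<in> rapid"
    by (rule rapid_mult[OF rapid_snd[OF rapid_snd[OF r]] hm, where r=0]) (auto simp: norm_mult sgn_if)
  then have 2: "is_fourier (hilbert_x (partial_y (partial_y f))) (\<lambda>\<zeta>. ?h \<zeta> * (\<i> * of_real (snd \<zeta>) * (\<i> * of_real (snd \<zeta>) * ?g \<zeta>)))"
    unfolding hilbert_x_def by (intro is_fourier_multiplier_AE[OF pyy] rapid_L2 hm)
  have "?m \<zeta> * (\<i> * of_real (fst \<zeta>) * ?g \<zeta>) + ?h \<zeta> * (\<i> * of_real (snd \<zeta>) * (\<i> * of_real (snd \<zeta>) * ?g \<zeta>))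
     = \<i> * of_real (dispersion \<alpha> \<zeta>) * ?g \<zeta>" for \<zeta>
    by (simp add: dispersion_def case_prod_beta algebra_simps power2_eq_square)
  with is_fourier_add[OF 1 2] show ?thesis by simp
qed

section \<open>The equation on the Fourier side\<close>

lemma fourier_diff_AE:
  assumes "f \<in> L2" "g \<in> L2"
  shows "AE \<zeta> in lborel. fourier (\<lambda>z. f z - g z) \<zeta> = fourier f \<zeta> - fourier g \<zeta>"
  by (intro fourier_AE_eq is_fourier_diff is_fourier_fourier assms)

text \<open>\<open>fourier\<close> chooses a representative for each function separately and is
  therefore linear only up to null sets; the Sobolev norm of a difference is compared with the
  difference of transforms through almost everywhere equality.\<close>

lemma C_H_infinity_fourier:
  assumes "C_H_infinity T u" "t \<in> {0..T}"
  shows "u t \<in> H_infinity"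
    and "0 \<le> s \<Longrightarrow> ((\<lambda>\<tau>. l2 (bessel s (\<lambda>\<zeta>. fourier (u \<tau>) \<zeta> - fourier (u t) \<zeta>))) \<longlongrightarrow> 0) (at t within {0..T})"
proof -
  show H: "u t \<in> H_infinity" using assms by (auto simp: C_H_infinity_def)
  assume "0 \<le> s"
  then have lim: "((\<lambda>\<tau>. sobolev_norm s (\<lambda>z. u \<tau> z - u t z)) \<longlongrightarrow> 0) (at t within {0..T})"
    using assms by (auto simp: C_H_infinity_def)
  have L: "bessel s (\<lambda>\<zeta>. fourier (u \<tau>) \<zeta> - fourier (u t) \<zeta>) \<in> L2"
    and eq: "sobolev_norm s (\<lambda>z. u \<tau> z - u t z) = ennreal (l2 (bessel s (\<lambda>\<zeta>. fourier (u \<tau>) \<zeta> - fourier (u t) \<zeta>)))"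
    if "\<tau> \<in> {0..T}" for \<tau>
  proof -
    have H': "u \<tau> \<in> H_infinity" using assms that by (auto simp: C_H_infinity_def)
    have uL: "u \<tau> \<in> L2" "u t \<in> L2" using H H' H_infinity_L2 by auto
    show L: "bessel s (\<lambda>\<zeta>. fourier (u \<tau>) \<zeta> - fourier (u t) \<zeta>) \<in> L2"
      unfolding bessel_diff by (intro L2_diff rapid_bessel_L2 H_infinity_rapid H H' \<open>0 \<le> s\<close>)
    have [measurable]: "fourier (u \<tau>) \<in> borel_measurable borel" "fourier (u t) \<in> borel_measurable borel"
      "fourier (\<lambda>z. u \<tau> z - u t z) \<in> borel_measurable borel"
      using fourier_L2 L2_measurable L2_diff uL by blast+
    have ae: "AE \<zeta> in lborel. bessel s (fourier (\<lambda>z. u \<tau> z - u t z)) \<zeta> = bessel s (\<lambda>\<zeta>. fourier (u \<tau>) \<zeta> - fourier (u t) \<zeta>) \<zeta>"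
      using fourier_diff_AE[OF uL] by eventually_elim (simp add: bessel_def)
    have ae': "AE \<zeta> in lborel. bessel s (\<lambda>\<zeta>. fourier (u \<tau>) \<zeta> - fourier (u t) \<zeta>) \<zeta> = bessel s (fourier (\<lambda>z. u \<tau> z - u t z)) \<zeta>"
      using ae by eventually_elim simp
    have L': "bessel s (fourier (\<lambda>z. u \<tau> z - u t z)) \<in> L2"
      by (rule L2_AE_cong[OF L _ ae']) measurable
    show "sobolev_norm s (\<lambda>z. u \<tau> z - u t z) = ennreal (l2 (bessel s (\<lambda>\<zeta>. fourier (u \<tau>) \<zeta> - fourier (u t) \<zeta>)))"
      unfolding sobolev_norm_eq[OF L2_diff[OF uL]] L2_norm_eq[OF L'] 
      by (rule arg_cong[where f=ennreal], rule l2_AE_cong[OF _ _ ae]) measurable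
  qed
  have "((\<lambda>\<tau>. ennreal (l2 (bessel s (\<lambda>\<zeta>. fourier (u \<tau>) \<zeta> - fourier (u t) \<zeta>)))) \<longlongrightarrow> ennreal 0) (at t within {0..T})"
    unfolding ennreal_0 by (rule Lim_transform_eventually[OF lim]) (auto simp: eventually_at_filter eq)
  then show "((\<lambda>\<tau>. l2 (bessel s (\<lambda>\<zeta>. fourier (u \<tau>) \<zeta> - fourier (u t) \<zeta>))) \<longlongrightarrow> 0) (at t within {0..T})"
    by (subst (asm) tendsto_ennreal_iff) auto
qed

text \<open>The isometry transports the limit of the difference quotients to frequency space, and
  the equation identifies the transform of the time derivative almost everywhere.\<close>

lemma smooth_solution_fourier_derivative:
  assumes "smooth_solution \<alpha> T w F" "0 < \<alpha>" "\<alpha> \<le> 1" "t \<in> {0..T}"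
  shows "((\<lambda>\<tau>. l2 (\<lambda>\<zeta>. (fourier (w \<tau>) \<zeta> - fourier (w t) \<zeta>) / of_real (\<tau> - t)
      - (fourier (F t) \<zeta> - \<i> * of_real (dispersion \<alpha> \<zeta>) * fourier (w t) \<zeta>))) \<longlongrightarrow> 0) (at t within {0..T})"
proof -
  have C: "C_H_infinity T w" "C_H_infinity T F" using assms by (auto simp: smooth_solution_def)
  obtain w\<^sub>t where ex: "\<forall>t\<in>{0..T}. has_L2_time_derivative w (w\<^sub>t t) t {0..T} \<and>
      (AE z in lborel. w\<^sub>t t z + frac_deriv_x \<alpha> (partial_x (w t)) z + hilbert_x (partial_y (partial_y (w t))) z = F t z)"
    using assms(1) unfolding smooth_solution_def by blast
  have d: "has_L2_time_derivative w (w\<^sub>t t) t {0..T}"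
    and eqn: "AE z in lborel. w\<^sub>t t z + frac_deriv_x \<alpha> (partial_x (w t)) z + hilbert_x (partial_y (partial_y (w t))) z = F t z"
    using ex[rule_format, OF assms(4)] by blast+
  let ?v = "w\<^sub>t t"
  let ?D = "\<lambda>\<zeta>. \<i> * complex_of_real (dispersion \<alpha> \<zeta>) * fourier (w t) \<zeta>"
  have vL: "?v \<in> L2" using d by (simp add: has_L2_time_derivative_def)
  have H: "w t \<in> H_infinity" "F t \<in> H_infinity" using C_H_infinity_fourier(1) C assms by auto
  have L: "w \<tau> \<in> L2" if "\<tau> \<in> {0..T}" for \<tau> using C_H_infinity_fourier(1)[OF C(1) that] H_infinity_L2 by blast
  have FL: "F t \<in> L2" using H H_infinity_L2 by blast
  note disp = fourier_dispersive_terms[OF H(1) assms(2,3)]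
  have DL: "?D \<in> L2" using disp is_fourier_L2 by blast
  have "AE \<zeta> in lborel. fourier ?v \<zeta> + ?D \<zeta> = fourier (F t) \<zeta>"
    using is_fourier_AE_unique[OF is_fourier_add[OF is_fourier_fourier[OF vL] disp] is_fourier_fourier[OF FL]] eqn
    by (simp add: add.assoc)
  then have ae: "AE \<zeta> in lborel. fourier ?v \<zeta> = fourier (F t) \<zeta> - ?D \<zeta>"
    by eventually_elim (simp add: algebra_simps)
  have m [measurable]: "fourier ?v \<in> borel_measurable borel" "fourier (F t) \<in> borel_measurable borel" "?D \<in> borel_measurable borel"
     using vL FL DL fourier_L2 L2_measurable by blast+
  let ?q = "\<lambda>\<tau> z. (w \<tau> z - w t z) / complex_of_real (\<tau> - t) - ?v z"
  let ?Q = "\<lambda>\<tau> \<zeta>. (fourier (w \<tau>) \<zeta> - fourier (w t) \<zeta>) / complex_of_real (\<tau> - t)"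
  have fq: "is_fourier (?q \<tau>) (\<lambda>\<zeta>. ?Q \<tau> \<zeta> - fourier ?v \<zeta>)" if "\<tau> \<in> {0..T}" for \<tau>
    using is_fourier_diff[OF is_fourier_cmult[OF is_fourier_diff[OF is_fourier_fourier[OF L[OF that]] is_fourier_fourier[OF L[OF assms(4)]]], 
        of "1 / complex_of_real (\<tau> - t)"] is_fourier_fourier[OF vL]] by simp
  have "((\<lambda>\<tau>. L2_norm (?q \<tau>)) \<longlongrightarrow> 0) (at t within {0..T})" using d by (simp add: has_L2_time_derivative_def)
  then have lim: "((\<lambda>\<tau>. l2 (?q \<tau>)) \<longlongrightarrow> 0) (at t within {0..T})"
    by (subst (asm) tendsto_L2_norm_iff) (use is_fourier_L2(1)[OF fq] in \<open>auto simp: eventually_at_filter\<close>)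
  have eq: "l2 (?q \<tau>) = l2 (\<lambda>\<zeta>. ?Q \<tau> \<zeta> - (fourier (F t) \<zeta> - ?D \<zeta>))" if "\<tau> \<in> {0..T}" for \<tau>
  proof -
    have [measurable]: "fourier (w \<tau>) \<in> borel_measurable borel" "fourier (w t) \<in> borel_measurable borel" 
      using L assms(4) that fourier_L2 L2_measurable by blast+
    have "l2 (?q \<tau>) = l2 (\<lambda>\<zeta>. ?Q \<tau> \<zeta> - fourier ?v \<zeta>)"
      using is_fourier_isometry[OF fq[OF that]] by simp
    also have "\<dots> = l2 (\<lambda>\<zeta>. ?Q \<tau> \<zeta> - (fourier (F t) \<zeta> - ?D \<zeta>))"
    proof (rule l2_AE_cong)
      show "AE \<zeta> in lborel. ?Q \<tau> \<zeta> - fourier ?v \<zeta> = ?Q \<tau> \<zeta> - (fourier (F t) \<zeta> - ?D \<zeta>)"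
        using ae by eventually_elim simp
    qed measurable
    finally show ?thesis .
  qed
  show ?thesis
    by (rule Lim_transform_eventually[OF lim]) (use eq in \<open>auto simp: eventually_at_filter\<close>)
qed

section \<open>Van der Corput's lemma\<close>

text \<open>Integration by parts in the form of a primitive: adding \<open>E\<close> to the integral
  cancels the main term of its derivative, and what is left has norm \<phi>'' / \<phi>'^2, the
  derivative of - 1 / \<phi>'. The variation contributes 1 / \<rho>, and the two boundary values of
  \<open>E\<close> contribute the other 2 / \<rho>.\<close>

lemma van_der_Corput_first:
  fixes \<phi> \<phi>' \<phi>'' :: "real \<Rightarrow> real"
  assumes "a \<le> b"
    and d1: "\<And>x. x \<in> {a..b} \<Longrightarrow> (\<phi> has_real_derivative \<phi>' x) (at x)"
    and d2: "\<And>x. x \<in> {a..b} \<Longrightarrow> (\<phi>' has_real_derivative \<phi>'' x) (at x)"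
    and nonneg: "\<And>x. x \<in> {a..b} \<Longrightarrow> 0 \<le> \<phi>'' x"
    and \<rho>: "0 < \<rho>" "\<rho> \<le> \<phi>' a"
  shows "norm (integral {a..b} (\<lambda>x. cis (\<phi> x))) \<le> 3 / \<rho>"
proof (cases "a = b")
  case False
  then have "a < b" using assms(1) by simp
  have ge: "\<rho> \<le> \<phi>' x" if "x \<in> {a..b}" for x
  proof -
    have "\<phi>' a \<le> \<phi>' x"
    proof (rule DERIV_nonneg_imp_nondecreasing[of a x \<phi>'])
      show "a \<le> x" using that by simp
      show "\<exists>y. (\<phi>' has_real_derivative y) (at u) \<and> 0 \<le> y" if "a \<le> u" "u \<le> x" for u
        using that \<open>x \<in> {a..b}\<close> d2[of u] nonneg[of u] by auto
    qed
    then show ?thesis using \<rho> by simp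
  qed
  have c\<phi>: "continuous_on {a..b} \<phi>" "continuous_on {a..b} \<phi>'"
    using d1 d2 by (meson DERIV_isCont continuous_at_imp_continuous_on)+
  have cc: "continuous_on {a..b} (\<lambda>x. cis (\<phi> x))"
    unfolding cis_conv_exp by (intro continuous_intros c\<phi>)
  define E where "E x = \<i> * cis (\<phi> x) / of_real (\<phi>' x)" for x
  define G where "G x = integral {a..x} (\<lambda>x. cis (\<phi> x)) + E x" for x
  have dcis: "((\<lambda>x. cis (\<phi> x)) has_vector_derivative (\<i> * of_real (\<phi>' x) * cis (\<phi> x))) (at x)" if "x \<in> {a..b}" for x
  proof -
    have "((\<lambda>x. \<i> * of_real (\<phi> x)) has_vector_derivative \<i> * of_real (\<phi>' x)) (at x)"
      using d1[OF that] by (intro has_vector_derivative_mult_right has_vector_derivative_of_real) 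
        (simp add: has_real_derivative_iff_has_vector_derivative)
    from field_vector_diff_chain_at[OF this DERIV_exp] show ?thesis by (simp add: cis_conv_exp o_def)
  qed
  have "norm (G b - G a) \<le> - 1 / \<phi>' b - (- 1 / \<phi>' a)"
  proof (rule differentiable_bound_general[OF \<open>a < b\<close>])
    show "continuous_on {a..b} (\<lambda>x. - 1 / \<phi>' x)"
      using ge \<rho>(1) by (intro continuous_intros c\<phi>) force
    have "continuous_on {a..b} (\<lambda>x. integral {a..x} (\<lambda>x. cis (\<phi> x)))"
      by (intro indefinite_integral_continuous_1 integrable_continuous_interval cc)
    then show "continuous_on {a..b} G"
      unfolding G_def E_def using ge \<rho>(1) by (intro continuous_intros c\<phi> cc) force+
    fix x assume x: "a < x" "x < b"
    then have xi: "x \<in> {a..b}" by simp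
    have ne: "\<phi>' x \<noteq> 0" using ge[OF xi] \<rho>(1) by simp
    show "((\<lambda>x. - 1 / \<phi>' x) has_vector_derivative \<phi>'' x / (\<phi>' x)\<^sup>2) (at x)"
      using d2[OF xi] ne unfolding has_real_derivative_iff_has_vector_derivative[symmetric]
      by (auto intro!: derivative_eq_intros simp: power2_eq_square)
    have 1: "((\<lambda>x. integral {a..x} (\<lambda>x. cis (\<phi> x))) has_vector_derivative cis (\<phi> x)) (at x)"
      using integral_has_vector_derivative[OF cc xi] at_within_Icc_at[OF x] by simp
    have 2: "((\<lambda>x. inverse (\<phi>' x)) has_vector_derivative (- \<phi>'' x / (\<phi>' x)\<^sup>2)) (at x)"
      using d2[OF xi] ne unfolding has_real_derivative_iff_has_vector_derivative[symmetric]
      by (auto intro!: derivative_eq_intros simp: power2_eq_square field_simps)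
    have "((\<lambda>x. inverse (\<phi>' x) *\<^sub>R (\<i> * cis (\<phi> x))) has_vector_derivative
       (inverse (\<phi>' x) *\<^sub>R (\<i> * (\<i> * of_real (\<phi>' x) * cis (\<phi> x))) + (- \<phi>'' x / (\<phi>' x)\<^sup>2) *\<^sub>R (\<i> * cis (\<phi> x)))) (at x)"
      by (intro has_vector_derivative_scaleR has_vector_derivative_mult_right dcis[OF xi])
        (use 2 in \<open>simp add: has_real_derivative_iff_has_vector_derivative\<close>)
    moreover have "(\<lambda>x. inverse (\<phi>' x) *\<^sub>R (\<i> * cis (\<phi> x))) = E"
      by (auto simp: E_def scaleR_conv_of_real divide_inverse)
    moreover have "inverse (\<phi>' x) *\<^sub>R (\<i> * (\<i> * of_real (\<phi>' x) * cis (\<phi> x))) = - cis (\<phi> x)"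
      using ne by (simp add: scaleR_conv_of_real mult.assoc[symmetric])
    ultimately have "(E has_vector_derivative (- cis (\<phi> x) + (- \<phi>'' x / (\<phi>' x)\<^sup>2) *\<^sub>R (\<i> * cis (\<phi> x)))) (at x)" by simp
    from has_vector_derivative_add[OF 1 this]
    show "(G has_vector_derivative ((- \<phi>'' x / (\<phi>' x)\<^sup>2) *\<^sub>R (\<i> * cis (\<phi> x)))) (at x)"
      by (simp add: G_def[abs_def])
    show "norm ((- \<phi>'' x / (\<phi>' x)\<^sup>2) *\<^sub>R (\<i> * cis (\<phi> x))) \<le> \<phi>'' x / (\<phi>' x)\<^sup>2"
      using nonneg[OF xi] by (simp add: norm_mult)
  qed
  also have "\<dots> \<le> 1 / \<rho>"
  proof -
    have "1 / \<phi>' a \<le> 1 / \<rho>" "0 \<le> 1 / \<phi>' b" using ge[of a] ge[of b] \<rho> \<open>a < b\<close> by (auto simp: frac_le)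
    then show ?thesis unfolding minus_divide_left[symmetric] by linarith
  qed
  finally have Gle: "norm (G b - G a) \<le> 1 / \<rho>" .
  have Ele: "norm (E x) \<le> 1 / \<rho>" if "x \<in> {a..b}" for x
    using ge[OF that] \<rho>(1) by (simp add: E_def norm_mult norm_divide frac_le)
  have "integral {a..b} (\<lambda>x. cis (\<phi> x)) = (G b - G a) - E b + E a"
    by (simp add: G_def)
  then have "norm (integral {a..b} (\<lambda>x. cis (\<phi> x))) \<le> norm (G b - G a) + norm (E b) + norm (E a)"
    by (metis norm_triangle_ineq norm_triangle_ineq4 add_right_mono order_trans)
  then show ?thesis using Gle Ele[of a] Ele[of b] \<open>a < b\<close> by simp
qed (use \<rho> in simp)

lemma norm_integral_cis_le:
  fixes \<phi> :: "real \<Rightarrow> real"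
  assumes "a \<le> b" "continuous_on {a..b} \<phi>"
  shows "norm (integral {a..b} (\<lambda>x. cis (\<phi> x))) \<le> b - a"
proof -
  have "continuous_on {a..b} (\<lambda>x. cis (\<phi> x))"
    unfolding cis_conv_exp by (intro continuous_intros assms)
  then show ?thesis using integral_bound[OF assms(1), of "\<lambda>x. cis (\<phi> x)" 1] by simp
qed

text \<open>Within distance 1 / sqrt \<mu> of the left end the trivial bound is used. Beyond it the
  mean value theorem gives \<phi>' \<ge> sqrt \<mu>, and the first derivative test adds 3 / sqrt
  \<mu>.\<close>

lemma van_der_Corput_half:
  fixes \<phi> \<phi>' \<phi>'' :: "real \<Rightarrow> real"
  assumes "a \<le> b"
    and d1: "\<And>x. x \<in> {a..b} \<Longrightarrow> (\<phi> has_real_derivative \<phi>' x) (at x)"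
    and d2: "\<And>x. x \<in> {a..b} \<Longrightarrow> (\<phi>' has_real_derivative \<phi>'' x) (at x)"
    and \<mu>: "0 < \<mu>" "\<And>x. x \<in> {a..b} \<Longrightarrow> \<mu> \<le> \<phi>'' x"
    and "0 \<le> \<phi>' a"
  shows "norm (integral {a..b} (\<lambda>x. cis (\<phi> x))) \<le> 4 / sqrt \<mu>"
proof -
  define r where "r = 1 / sqrt \<mu>"
  have r: "0 < r" "\<mu> * r = sqrt \<mu>" using \<mu>(1) by (simp_all add: r_def real_div_sqrt)
  have c\<phi>: "continuous_on {a..b} \<phi>" using d1 by (meson DERIV_isCont continuous_at_imp_continuous_on)
  show ?thesis
  proof (cases "b \<le> a + r")
    case True
    then have "norm (integral {a..b} (\<lambda>x. cis (\<phi> x))) \<le> r"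
      using norm_integral_cis_le[OF assms(1) c\<phi>] by simp
    also have "\<dots> \<le> 4 / sqrt \<mu>" using \<mu>(1) by (simp add: r_def divide_right_mono)
    finally show ?thesis .
  next
    case False
    let ?c = "a + r"
    have "\<exists>z>a. z < ?c \<and> \<phi>' ?c - \<phi>' a = (?c - a) * \<phi>'' z"
      by (rule MVT2) (use r False d2 in auto)
    then obtain z where "a < z" "z < ?c" "\<phi>' ?c - \<phi>' a = r * \<phi>'' z" by auto
    moreover have "r * \<mu> \<le> r * \<phi>'' z" using \<mu>(2)[of z] r calculation False by (intro mult_left_mono) auto
    ultimately have ge: "sqrt \<mu> \<le> \<phi>' ?c" using assms(6) r by (simp add: mult.commute)
    have "integral {a..b} (\<lambda>x. cis (\<phi> x)) = integral {a..?c} (\<lambda>x. cis (\<phi> x)) + integral {?c..b} (\<lambda>x. cis (\<phi> x))"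
    proof (rule Henstock_Kurzweil_Integration.integral_combine[symmetric])
      show "(\<lambda>x. cis (\<phi> x)) integrable_on {a..b}"
        unfolding cis_conv_exp by (intro integrable_continuous_interval continuous_intros c\<phi>)
    qed (use r False in auto)
    also have "norm \<dots> \<le> r + 3 / sqrt \<mu>"
    proof (rule norm_triangle_le[OF add_mono])
      show "norm (integral {a..?c} (\<lambda>x. cis (\<phi> x))) \<le> r"
        using norm_integral_cis_le[of a ?c \<phi>] continuous_on_subset[OF c\<phi>, of "{a..?c}"] r False by auto
      show "norm (integral {?c..b} (\<lambda>x. cis (\<phi> x))) \<le> 3 / sqrt \<mu>"
        by (rule van_der_Corput_first[where \<phi>'=\<phi>' and \<phi>''=\<phi>''])
          (use r False d1 d2 \<mu> ge in \<open>auto intro: order_trans[OF less_imp_le]\<close>)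
    qed
    finally show ?thesis by (simp add: r_def)
  qed
qed

text \<open>\<phi>' is increasing. Splitting at its zero, if there is one, and reflecting the left
  piece reduces to intervals whose left end has a nonnegative derivative.\<close>

lemma van_der_Corput_pos:
  fixes \<phi> \<phi>' \<phi>'' :: "real \<Rightarrow> real"
  assumes "a \<le> b"
    and d1: "\<And>x. x \<in> {a..b} \<Longrightarrow> (\<phi> has_real_derivative \<phi>' x) (at x)"
    and d2: "\<And>x. x \<in> {a..b} \<Longrightarrow> (\<phi>' has_real_derivative \<phi>'' x) (at x)"
    and \<mu>: "0 < \<mu>" "\<And>x. x \<in> {a..b} \<Longrightarrow> \<mu> \<le> \<phi>'' x"
  shows "norm (integral {a..b} (\<lambda>x. cis (\<phi> x))) \<le> 8 / sqrt \<mu>"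
proof -
  have right: "norm (integral {c..b} (\<lambda>x. cis (\<phi> x))) \<le> 4 / sqrt \<mu>" if "c \<in> {a..b}" "0 \<le> \<phi>' c" for c
    by (rule van_der_Corput_half[where \<phi>'=\<phi>' and \<phi>''=\<phi>'']) (use that assms in auto)
  have left: "norm (integral {a..c} (\<lambda>x. cis (\<phi> x))) \<le> 4 / sqrt \<mu>" if "c \<in> {a..b}" "\<phi>' c \<le> 0" for c
  proof -
    have "norm (integral {-c..-a} (\<lambda>x. cis (\<phi> (- x)))) \<le> 4 / sqrt \<mu>"
    proof (rule van_der_Corput_half[where \<phi>'="\<lambda>x. - \<phi>' (- x)" and \<phi>''="\<lambda>x. \<phi>'' (- x)"])
      fix x assume x: "x \<in> {-c..-a}"
      then have x': "- x \<in> {a..b}" using that by auto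
      show "((\<lambda>x. \<phi> (- x)) has_real_derivative - \<phi>' (- x)) (at x)"
        using DERIV_chain2[OF d1[OF x'] DERIV_minus[OF DERIV_ident]] by simp
      show "((\<lambda>x. - \<phi>' (- x)) has_real_derivative \<phi>'' (- x)) (at x)"
        using DERIV_minus[OF DERIV_chain2[OF d2[OF x'] DERIV_minus[OF DERIV_ident]]] by simp
      show "\<mu> \<le> \<phi>'' (- x)" using \<mu>(2)[OF x'] .
    qed (use that \<mu> in auto)
    then show ?thesis using Henstock_Kurzweil_Integration.integral_reflect_real[of c a "\<lambda>x. cis (\<phi> x)"] by simp
  qed
  have le: "4 / sqrt \<mu> \<le> 8 / sqrt \<mu>" using \<mu>(1) by (simp add: divide_right_mono)
  consider "0 \<le> \<phi>' a" | "\<phi>' b \<le> 0" | "\<phi>' a \<le> 0" "0 \<le> \<phi>' b" by linarith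
  then show ?thesis
  proof cases
    case 1 then show ?thesis using right[of a] assms(1) le by auto
  next
    case 2 then show ?thesis using left[of b] assms(1) le by auto
  next
    case 3
    have c: "continuous_on {a..b} \<phi>" "continuous_on {a..b} \<phi>'"
      using d1 d2 by (meson DERIV_isCont continuous_at_imp_continuous_on)+
    obtain c where c0: "c \<in> {a..b}" "\<phi>' c = 0" using IVT'[OF 3 assms(1) c(2)] by auto
    have "integral {a..b} (\<lambda>x. cis (\<phi> x)) = integral {a..c} (\<lambda>x. cis (\<phi> x)) + integral {c..b} (\<lambda>x. cis (\<phi> x))"
    proof (rule Henstock_Kurzweil_Integration.integral_combine[symmetric])
      show "(\<lambda>x. cis (\<phi> x)) integrable_on {a..b}"
        unfolding cis_conv_exp by (intro integrable_continuous_interval continuous_intros c)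
    qed (use c0 in auto)
    also have "norm \<dots> \<le> 4 / sqrt \<mu> + 4 / sqrt \<mu>"
      by (intro norm_triangle_le[OF add_mono] left right) (use c0 in auto)
    finally show ?thesis by simp
  qed
qed

text \<open>Conjugation exchanges convex and concave phases. The sign \<sigma> is carried explicitly
  so that one statement serves both signs of t in the kernel.\<close>

theorem van_der_Corput:
  fixes \<phi> \<phi>' \<phi>'' :: "real \<Rightarrow> real"
  assumes "a \<le> b"
    and d1: "\<And>x. x \<in> {a..b} \<Longrightarrow> (\<phi> has_real_derivative \<phi>' x) (at x)"
    and d2: "\<And>x. x \<in> {a..b} \<Longrightarrow> (\<phi>' has_real_derivative \<sigma> * \<phi>'' x) (at x)"
    and \<mu>: "0 < \<mu>" "\<And>x. x \<in> {a..b} \<Longrightarrow> \<mu> \<le> \<phi>'' x" and \<sigma>: "\<sigma> = 1 \<or> \<sigma> = - 1"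
  shows "norm (integral {a..b} (\<lambda>x. cis (\<phi> x))) \<le> 8 / sqrt \<mu>"
  using \<sigma>
proof
  assume "\<sigma> = 1" then show ?thesis
    by (intro van_der_Corput_pos[where \<phi>'=\<phi>' and \<phi>''=\<phi>'']) (use assms in auto)
next
  assume s: "\<sigma> = - 1"
  have "norm (integral {a..b} (\<lambda>x. cis (- \<phi> x))) \<le> 8 / sqrt \<mu>"
  proof (rule van_der_Corput_pos[where \<phi>'="\<lambda>x. - \<phi>' x" and \<phi>''=\<phi>''])
    fix x assume x: "x \<in> {a..b}"
    show "((\<lambda>x. - \<phi> x) has_real_derivative - \<phi>' x) (at x)" using DERIV_minus[OF d1[OF x]] .
    show "((\<lambda>x. - \<phi>' x) has_real_derivative \<phi>'' x) (at x)" using DERIV_minus[OF d2[OF x]] s by simp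
  qed (use assms in auto)
  also have "integral {a..b} (\<lambda>x. cis (- \<phi> x)) = cnj (integral {a..b} (\<lambda>x. cis (\<phi> x)))"
    by (subst Henstock_Kurzweil_Integration.integral_cnj) (simp add: cis_cnj)
  finally show ?thesis by simp
qed

section \<open>The kernel of the group on dyadic shells\<close>

lemma integrable_indicator_cis:
  fixes g :: "'a::euclidean_space \<Rightarrow> real"
  assumes "S \<in> sets borel" "emeasure lborel S < \<infinity>" and [measurable]: "g \<in> borel_measurable borel"
  shows "integrable lborel (\<lambda>x. complex_of_real (indicator S x) * cis (g x))"
proof -
  have "integrable lborel (\<lambda>x. complex_of_real (indicator S x))"
    using assms by (intro integrable_of_real integrable_real_indicator) auto
  from integrable_cis_mult[OF this, of g] show ?thesis by (simp add: mult.commute)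
qed

lemma norm_integral_indicator_cis_le:
  fixes g :: "'a::euclidean_space \<Rightarrow> real"
  assumes "S \<in> sets borel" "emeasure lborel S < \<infinity>" "g \<in> borel_measurable borel"
  shows "norm (LINT x|lborel. complex_of_real (indicator S x) * cis (g x)) \<le> measure lborel S"
proof -
  have "norm (LINT x|lborel. complex_of_real (indicator S x) * cis (g x)) \<le> (LINT x|lborel. indicator S x)"
    by (rule Bochner_Integration.integral_norm_bound_integral[OF integrable_indicator_cis[OF assms]])
      (use assms in \<open>auto intro!: integrable_real_indicator simp: norm_mult\<close>)
  then show ?thesis using assms by simp
qed

lemma integral_indicator_cis_Icc:
  fixes \<phi> :: "real \<Rightarrow> real"
  assumes "\<phi> \<in> borel_measurable borel"
  shows "(LINT x|lborel. complex_of_real (indicator {a..b} x) * cis (\<phi> x)) = integral {a..b} (\<lambda>x. cis (\<phi> x))"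
proof -
  have "integrable lborel (\<lambda>x. complex_of_real (indicator {a..b} x) * cis (\<phi> x))"
    by (rule integrable_indicator_cis) (use assms in \<open>auto simp: emeasure_lborel_Icc_eq\<close>)
  then have "set_integrable lborel {a..b} (\<lambda>x. cis (\<phi> x))"
    by (simp add: set_integrable_def scaleR_conv_of_real)
  from set_borel_integral_eq_integral(2)[OF this] show ?thesis
    by (simp add: set_lebesgue_integral_def scaleR_conv_of_real)
qed

lemma oscillatory_integral_y:
  assumes "t \<noteq> 0" "0 < \<Lambda>"
  shows "norm (LINT \<eta>|lborel. complex_of_real (indicator {-\<Lambda>..\<Lambda>} \<eta>) * cis (y * \<eta> - t * \<eta>\<^sup>2)) \<le> 8 / sqrt (2 * \<bar>t\<bar>)"
proof -
  have "norm (integral {-\<Lambda>..\<Lambda>} (\<lambda>\<eta>. cis (y * \<eta> - t * \<eta>\<^sup>2))) \<le> 8 / sqrt (2 * \<bar>t\<bar>)"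
    by (rule van_der_Corput[where \<phi>'="\<lambda>\<eta>. y - 2 * t * \<eta>" and \<phi>''="\<lambda>_. 2 * \<bar>t\<bar>" and \<sigma>="- sgn t"])
      (use assms in \<open>auto intro!: derivative_eq_intros simp: sgn_if\<close>)
  then show ?thesis by (subst integral_indicator_cis_Icc) auto
qed

text \<open>For \<alpha> \<le> 1 the power \<xi>^(\<alpha> - 1) in the second derivative is smallest
  at \<Lambda>, which fixes the lower bound in van der Corput's test. The phase is not twice
  differentiable at 0 in general, so the test is applied on intervals that stay away from 0, with a
  bound independent of their left end.\<close>

lemma oscillatory_integral_x:
  assumes "t \<noteq> 0" "0 < \<Lambda>" "0 < \<alpha>" "\<alpha> \<le> 1"
  shows "norm (LINT \<xi>|lborel. complex_of_real (indicator {0<..\<Lambda>} \<xi>) * cis (x * \<xi> - t * (\<xi> * \<bar>\<xi>\<bar> powr \<alpha>)))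
     \<le> 8 / sqrt (\<alpha> * (1 + \<alpha>) * \<bar>t\<bar> * \<Lambda> powr (\<alpha> - 1))"
proof -
  let ?\<phi> = "\<lambda>\<xi>. x * \<xi> - t * (\<xi> * \<bar>\<xi>\<bar> powr \<alpha>)"
  let ?R = "8 / sqrt (\<alpha> * (1 + \<alpha>) * \<bar>t\<bar> * \<Lambda> powr (\<alpha> - 1))"
  let ?I = "\<lambda>S. LINT \<xi>|lborel. complex_of_real (indicator S \<xi>) * cis (?\<phi> \<xi>)"
  have \<phi>m: "?\<phi> \<in> borel_measurable borel" by measurable
  have main: "norm (?I {e..\<Lambda>}) \<le> ?R" if e: "0 < e" "e \<le> \<Lambda>" for e
  proof -
    let ?\<psi> = "\<lambda>\<xi>. x * \<xi> - t * \<xi> powr (1 + \<alpha>)"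
    have "norm (integral {e..\<Lambda>} (\<lambda>\<xi>. cis (?\<psi> \<xi>))) \<le> ?R"
    proof (rule van_der_Corput[where \<phi>'="\<lambda>\<xi>. x - t * ((1 + \<alpha>) * \<xi> powr \<alpha>)" 
          and \<phi>''="\<lambda>\<xi>. \<bar>t\<bar> * ((1 + \<alpha>) * (\<alpha> * \<xi> powr (\<alpha> - 1)))" and \<sigma>="- sgn t"])
      fix \<xi> assume \<xi>: "\<xi> \<in> {e..\<Lambda>}"
      then have pos: "0 < \<xi>" "\<xi> \<le> \<Lambda>" using e by auto
      show "(?\<psi> has_real_derivative x - t * ((1 + \<alpha>) * \<xi> powr \<alpha>)) (at \<xi>)"
        using pos by (auto intro!: derivative_eq_intros)
      have "- sgn t * (\<bar>t\<bar> * ((1 + \<alpha>) * (\<alpha> * \<xi> powr (\<alpha> - 1)))) = - t * ((1 + \<alpha>) * (\<alpha> * \<xi> powr (\<alpha> - 1)))"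
        by (simp add: sgn_if)
      then show "((\<lambda>\<xi>. x - t * ((1 + \<alpha>) * \<xi> powr \<alpha>)) has_real_derivative 
          - sgn t * (\<bar>t\<bar> * ((1 + \<alpha>) * (\<alpha> * \<xi> powr (\<alpha> - 1))))) (at \<xi>)"
        using pos by (auto intro!: derivative_eq_intros)
      have "\<Lambda> powr (\<alpha> - 1) \<le> \<xi> powr (\<alpha> - 1)" using pos assms by (intro powr_mono2') auto
      then have "(\<alpha> * (1 + \<alpha>) * \<bar>t\<bar>) * \<Lambda> powr (\<alpha> - 1) \<le> (\<alpha> * (1 + \<alpha>) * \<bar>t\<bar>) * \<xi> powr (\<alpha> - 1)"
        using assms by (intro mult_left_mono) auto
      then show "\<alpha> * (1 + \<alpha>) * \<bar>t\<bar> * \<Lambda> powr (\<alpha> - 1) \<le> \<bar>t\<bar> * ((1 + \<alpha>) * (\<alpha> * \<xi> powr (\<alpha> - 1)))"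
        by (simp add: mult_ac)
    qed (use assms e in \<open>auto simp: sgn_if\<close>)
    also have "integral {e..\<Lambda>} (\<lambda>\<xi>. cis (?\<psi> \<xi>)) = integral {e..\<Lambda>} (\<lambda>\<xi>. cis (?\<phi> \<xi>))"
      by (rule Henstock_Kurzweil_Integration.integral_cong) (use e in \<open>auto simp: powr_add\<close>)
    finally show ?thesis by (simp only: integral_indicator_cis_Icc[OF \<phi>m])
  qed
  show ?thesis
  proof (rule field_le_epsilon)
    fix d :: real assume "0 < d"
    \<comment> \<open>The omitted piece between 0 and e contributes at most its length, which is at
      most d.\<close>
    define e where "e = min d \<Lambda>"
    have e: "0 < e" "e \<le> \<Lambda>" "e \<le> d" using \<open>0 < d\<close> assms by (auto simp: e_def)
    have i: "integrable lborel (\<lambda>\<xi>. complex_of_real (indicator S \<xi>) * cis (?\<phi> \<xi>))" if "S = {0<..<e} \<or> S = {e..\<Lambda>}" for S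
      by (rule integrable_indicator_cis) (use that \<phi>m e in auto)
    have "complex_of_real (indicator {0<..\<Lambda>} \<xi>) * cis (?\<phi> \<xi>) = 
       complex_of_real (indicator {0<..<e} \<xi>) * cis (?\<phi> \<xi>) + complex_of_real (indicator {e..\<Lambda>} \<xi>) * cis (?\<phi> \<xi>)" for \<xi>
      using e by (auto simp: indicator_def)
    then have "?I {0<..\<Lambda>} = ?I {0<..<e} + ?I {e..\<Lambda>}"
      using i by simp
    also have "norm \<dots> \<le> e + ?R"
    proof (intro norm_triangle_le add_mono main e)
      have "norm (?I {0<..<e}) \<le> measure lborel {0<..<e}"
        by (rule norm_integral_indicator_cis_le[OF _ _ \<phi>m]) (use e in auto)
      then show "norm (?I {0<..<e}) \<le> e" using e by simp
    qed
    finally show "norm (?I {0<..\<Lambda>}) \<le> ?R + d" using e by simp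
  qed
qed

section \<open>Kernels of squares and shells\<close>

definition square :: "real \<Rightarrow> plane set" where
  "square \<Lambda> = {-\<Lambda>..\<Lambda>} \<times> {-\<Lambda>..\<Lambda>}"

text \<open>The convolution kernel of the free group cut to the frequencies in \<open>E\<close>,
  without normalizing factor. In this form its values are exactly the inner products in
  \<open>L2\<close> of plane waves cut to \<open>E\<close>.\<close>

definition osc_kernel :: "real \<Rightarrow> plane set \<Rightarrow> real \<Rightarrow> plane \<Rightarrow> complex" where
  "osc_kernel \<alpha> E t z = (LINT \<zeta>|lborel. complex_of_real (indicator E \<zeta>) * cis (z \<bullet> \<zeta> - t * dispersion \<alpha> \<zeta>))"

lemma dispersion_measurable [measurable]: "dispersion \<alpha> \<in> borel_measurable borel"
  unfolding dispersion_def[abs_def] borel_prod[symmetric] by measurable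

lemma square_measurable [measurable]: "square \<Lambda> \<in> sets borel"
  unfolding square_def borel_prod[symmetric] by measurable

lemma emeasure_square: "0 \<le> \<Lambda> \<Longrightarrow> emeasure lborel (square \<Lambda>) = ennreal (4 * \<Lambda>\<^sup>2)"
  unfolding square_def lborel_prod[symmetric]
  by (subst lborel.emeasure_pair_measure_Times) (auto simp: ennreal_mult[symmetric] power2_eq_square)

text \<open>On the half-planes \<xi> > 0 and \<xi> < 0 the factor sgn \<xi> is constant, so the
  phase separates and the kernel is a sum of two products. In each product both variables supply a
  factor |t|^(-1/2); the constant 128 is 2 * 8 * 8.\<close>

lemma osc_kernel_square_le:
  assumes "t \<noteq> 0" "0 < \<Lambda>" "0 < \<alpha>" "\<alpha> \<le> 1"
  shows "norm (osc_kernel \<alpha> (square \<Lambda>) t z) \<le> 128 / sqrt (2 * \<alpha> * (1 + \<alpha>)) * \<Lambda> powr ((1 - \<alpha>) / 2) / \<bar>t\<bar>"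
proof -
  define x y where "x = fst z" and "y = snd z"
  let ?p = "\<lambda>t x \<xi>. x * \<xi> - t * (\<xi> * \<bar>\<xi>\<bar> powr \<alpha>)" and ?q = "\<lambda>t y \<eta>. y * \<eta> - t * \<eta>\<^sup>2"
  let ?f = "\<lambda>S t x \<xi>. complex_of_real (indicator S \<xi>) * cis (?p t x \<xi>)"
  let ?g = "\<lambda>t y \<eta>. complex_of_real (indicator {-\<Lambda>..\<Lambda>} \<eta>) * cis (?q t y \<eta>)"
  let ?X = "8 / sqrt (\<alpha> * (1 + \<alpha>) * \<bar>t\<bar> * \<Lambda> powr (\<alpha> - 1))" and ?Y = "8 / sqrt (2 * \<bar>t\<bar>)"
  have fi: "integrable lborel (?f S t x)" if "S \<in> {{0<..\<Lambda>}, {-\<Lambda>..<0}, {0}}" for S t x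
    by (rule integrable_indicator_cis) (use that assms in auto)
  have gi: "integrable lborel (?g t y)" for t y
    by (rule integrable_indicator_cis) (use assms in auto)
  have ti: "integrable lborel (\<lambda>\<zeta>. ?f S t x (fst \<zeta>) * ?g t' y (snd \<zeta>))" if "S \<in> {{0<..\<Lambda>}, {-\<Lambda>..<0}, {0}}" for S t x t' y
    using integrable_tensor[OF fi[OF that] gi] by (simp only: lborel_prod)
  \<comment> \<open>Left of the axis sgn \<xi> reverses the sign of t in the \<eta>-phase, hence the
    argument - t there. The line \<xi> = 0 is split off as a piece with vanishing integral.\<close>
  have split: "complex_of_real (indicator (square \<Lambda>) \<zeta>) * cis (z \<bullet> \<zeta> - t * dispersion \<alpha> \<zeta>)
     = ?f {0<..\<Lambda>} t x (fst \<zeta>) * ?g t y (snd \<zeta>) + ?f {-\<Lambda>..<0} t x (fst \<zeta>) * ?g (- t) y (snd \<zeta>)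
       + ?f {0} t x (fst \<zeta>) * ?g 0 y (snd \<zeta>)" for \<zeta>
  proof -
    obtain \<xi> \<eta> where \<zeta>: "\<zeta> = (\<xi>, \<eta>)" by (cases \<zeta>)
    have z: "z = (x, y)" by (simp add: x_def y_def)
    show ?thesis
    proof (cases "\<eta> \<in> {-\<Lambda>..\<Lambda>}")
      case True
      consider "\<xi> < 0" | "\<xi> = 0" | "0 < \<xi>" by linarith
      then show ?thesis
        using True assms(2) unfolding \<zeta> z
        by cases (auto simp: square_def dispersion_def indicator_def cis_mult algebra_simps)
    qed (auto simp: \<zeta> square_def)
  qed
  have "osc_kernel \<alpha> (square \<Lambda>) t z = 
      (LINT \<xi>|lborel. ?f {0<..\<Lambda>} t x \<xi>) * (LINT \<eta>|lborel. ?g t y \<eta>)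
    + (LINT \<xi>|lborel. ?f {-\<Lambda>..<0} t x \<xi>) * (LINT \<eta>|lborel. ?g (- t) y \<eta>)
    + (LINT \<xi>|lborel. ?f {0} t x \<xi>) * (LINT \<eta>|lborel. ?g 0 y \<eta>)"
    unfolding osc_kernel_def split
    by (subst Bochner_Integration.integral_add Bochner_Integration.integral_add,
        (intro Bochner_Integration.integrable_add ti; simp)+)+
       (simp only: integral_tensor[OF fi gi] insertI1 insertI2)
  also have "(LINT \<xi>|lborel. ?f {0} t x \<xi>) = 0"
    using norm_integral_indicator_cis_le[of "{0::real}" "?p t x"] by simp
  \<comment> \<open>The \<xi>-phase is odd in \<xi>, so reflection amounts to changing the signs of
    both t and x.\<close>
  also have "(LINT \<xi>|lborel. ?f {-\<Lambda>..<0} t x \<xi>) = (LINT \<xi>|lborel. ?f {0<..\<Lambda>} (- t) (- x) \<xi>)"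
    by (subst lborel_integral_real_affine[where c="-1" and t=0])
       (auto intro!: Bochner_Integration.integral_cong simp: indicator_def)
  finally have K: "osc_kernel \<alpha> (square \<Lambda>) t z = 
      (LINT \<xi>|lborel. ?f {0<..\<Lambda>} t x \<xi>) * (LINT \<eta>|lborel. ?g t y \<eta>)
    + (LINT \<xi>|lborel. ?f {0<..\<Lambda>} (- t) (- x) \<xi>) * (LINT \<eta>|lborel. ?g (- t) y \<eta>)" by simp
  have "norm (osc_kernel \<alpha> (square \<Lambda>) t z) \<le> ?X * ?Y + ?X * ?Y"
    unfolding K
  proof (intro norm_triangle_le add_mono; unfold norm_mult; intro mult_mono)
    show "norm (LINT \<xi>|lborel. ?f {0<..\<Lambda>} t x \<xi>) \<le> ?X" by (rule oscillatory_integral_x[OF assms])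
    show "norm (LINT \<xi>|lborel. ?f {0<..\<Lambda>} (- t) (- x) \<xi>) \<le> ?X"
      using oscillatory_integral_x[of "- t" \<Lambda> \<alpha> "- x"] assms by simp
    show "norm (LINT \<eta>|lborel. ?g t y \<eta>) \<le> ?Y" by (rule oscillatory_integral_y[OF assms(1,2)])
    show "norm (LINT \<eta>|lborel. ?g (- t) y \<eta>) \<le> ?Y"
      using oscillatory_integral_y[of "- t" \<Lambda> y] assms by simp
  qed (use assms in auto)
  also have "?X * ?Y + ?X * ?Y = 128 / sqrt (2 * \<alpha> * (1 + \<alpha>)) * \<Lambda> powr ((1 - \<alpha>) / 2) / \<bar>t\<bar>"
  proof -
    have "sqrt (\<Lambda> powr (\<alpha> - 1)) = \<Lambda> powr ((\<alpha> - 1) / 2)"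
      using assms by (simp add: powr_half_sqrt[symmetric] powr_powr)
    moreover have "1 / \<Lambda> powr ((\<alpha> - 1) / 2) = \<Lambda> powr ((1 - \<alpha>) / 2)"
      by (simp add: powr_minus_divide[symmetric] minus_divide_left)
    moreover have "sqrt \<bar>t\<bar> * sqrt \<bar>t\<bar> = \<bar>t\<bar>" by simp
    moreover have "sqrt (2 * \<alpha> * (1 + \<alpha>)) = sqrt 2 * sqrt (\<alpha> * (1 + \<alpha>))"
      by (simp only: real_sqrt_mult mult.assoc)
    moreover have "?X = 8 / (sqrt (\<alpha> * (1 + \<alpha>)) * sqrt \<bar>t\<bar> * sqrt (\<Lambda> powr (\<alpha> - 1)))"
      "?Y = 8 / (sqrt 2 * sqrt \<bar>t\<bar>)" by (simp_all only: real_sqrt_mult)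
    moreover have "8 / (s * u * v) * (8 / (r * u)) + 8 / (s * u * v) * (8 / (r * u)) = 128 / (r * s) * (1 / v) / (u * u)" for s u v r :: real
      by (simp add: mult_ac)
    ultimately have "?X * ?Y + ?X * ?Y = 128 / sqrt (2 * \<alpha> * (1 + \<alpha>)) * (1 / sqrt (\<Lambda> powr (\<alpha> - 1))) / (sqrt \<bar>t\<bar> * sqrt \<bar>t\<bar>)"
      by (simp only:)
    then show ?thesis using \<open>sqrt (\<Lambda> powr (\<alpha> - 1)) = _\<close> \<open>1 / \<Lambda> powr ((\<alpha> - 1) / 2) = _\<close> \<open>sqrt \<bar>t\<bar> * sqrt \<bar>t\<bar> = _\<close>
      by (simp only:)
  qed
  finally show ?thesis .
qed

text \<open>The zeroth shell is a full square and collects the low frequencies. Every other shell is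
  a difference of two squares and inherits their kernel bound at the price of a factor 2.\<close>

definition shell :: "nat \<Rightarrow> plane set" where
  "shell j = (if j = 0 then square 1 else square (2 ^ j) - square (2 ^ (j - 1)))"

lemma shell_measurable [measurable]: "shell j \<in> sets borel"
  unfolding shell_def by auto

lemma square_mono: "\<Lambda> \<le> \<mu> \<Longrightarrow> square \<Lambda> \<subseteq> square \<mu>"
  by (auto simp: square_def)

lemma shell_subset: "shell j \<subseteq> square (2 ^ j)"
  by (auto simp: shell_def)

lemma emeasure_shell_le: "emeasure lborel (shell j) \<le> ennreal (4 * (2 ^ j)\<^sup>2)"
  using emeasure_mono[OF shell_subset[of j], of lborel] by (simp add: emeasure_square)

lemma osc_kernel_shell_le_measure: "norm (osc_kernel \<alpha> (shell j) t z) \<le> 4 * (2 ^ j)\<^sup>2"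
proof -
  have fin: "emeasure lborel (shell j) < \<infinity>" using le_less_trans[OF emeasure_shell_le] by simp
  have "norm (osc_kernel \<alpha> (shell j) t z) \<le> measure lborel (shell j)"
    unfolding osc_kernel_def by (rule norm_integral_indicator_cis_le[OF _ fin]) measurable
  also have "\<dots> \<le> 4 * (2 ^ j)\<^sup>2" 
    unfolding measure_def using enn2real_mono[OF emeasure_shell_le[of j]] by simp
  finally show ?thesis .
qed

lemma osc_kernel_shell_le_decay:
  assumes "t \<noteq> 0" "0 < \<alpha>" "\<alpha> \<le> 1"
  shows "norm (osc_kernel \<alpha> (shell j) t z) \<le> 256 / sqrt (2 * \<alpha> * (1 + \<alpha>)) * (2 ^ j) powr ((1 - \<alpha>) / 2) / \<bar>t\<bar>"
proof -
  let ?B = "128 / sqrt (2 * \<alpha> * (1 + \<alpha>)) * (2 ^ j) powr ((1 - \<alpha>) / 2) / \<bar>t\<bar>"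
  have B: "norm (osc_kernel \<alpha> (square (2 ^ j)) t z) \<le> ?B" by (rule osc_kernel_square_le) (use assms in auto)
  have B0: "0 \<le> ?B" using assms by simp
  have R: "256 / sqrt (2 * \<alpha> * (1 + \<alpha>)) * (2 ^ j) powr ((1 - \<alpha>) / 2) / \<bar>t\<bar> = ?B + ?B" by simp
  show ?thesis
  proof (cases "j = 0")
    case True
    then have "shell j = square (2 ^ j)" by (simp add: shell_def)
    show ?thesis unfolding R \<open>shell j = _\<close> by (rule add_increasing2[OF B0 B])
  next
    case False
    let ?k = "\<lambda>E \<zeta>. complex_of_real (indicator E \<zeta>) * cis (z \<bullet> \<zeta> - t * dispersion \<alpha> \<zeta>)"
    have i: "integrable lborel (?k (square \<Lambda>))" if "0 < \<Lambda>" for \<Lambda>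
      by (rule integrable_indicator_cis) (use that in \<open>auto simp: emeasure_square\<close>)
    have sub: "square (2 ^ (j - 1)) \<subseteq> square (2 ^ j)" by (intro square_mono power_increasing) auto
    have "?k (shell j) \<zeta> = ?k (square (2 ^ j)) \<zeta> - ?k (square (2 ^ (j - 1))) \<zeta>" for \<zeta>
      using False sub by (auto simp: shell_def indicator_def)
    then have "osc_kernel \<alpha> (shell j) t z = osc_kernel \<alpha> (square (2 ^ j)) t z - osc_kernel \<alpha> (square (2 ^ (j - 1))) t z"
      unfolding osc_kernel_def using i by simp
    also have "norm \<dots> \<le> norm (osc_kernel \<alpha> (square (2 ^ j)) t z) + norm (osc_kernel \<alpha> (square (2 ^ (j - 1))) t z)"
      by (rule norm_triangle_ineq4)
    also have "norm (osc_kernel \<alpha> (square (2 ^ (j - 1))) t z) \<le> 128 / sqrt (2 * \<alpha> * (1 + \<alpha>)) * (2 ^ (j - 1)) powr ((1 - \<alpha>) / 2) / \<bar>t\<bar>"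
      by (rule osc_kernel_square_le) (use assms in auto)
    also have "\<dots> \<le> ?B"
      using assms by (intro divide_right_mono mult_left_mono powr_mono2) auto
    finally have "norm (osc_kernel \<alpha> (shell j) t z) \<le> norm (osc_kernel \<alpha> (square (2 ^ j)) t z) + ?B" by simp
    also have "\<dots> \<le> ?B + ?B" by (rule add_right_mono[OF B])
    finally show ?thesis unfolding R .
  qed
qed

lemma osc_kernel_shell_le:
  assumes "t \<noteq> 0" "0 < \<alpha>" "\<alpha> \<le> 1" "0 < \<theta>" "\<theta> < 1"
  shows "norm (osc_kernel \<alpha> (shell j) t z) \<le> (4 * (2 ^ j)\<^sup>2) powr \<theta> 
      * (256 / sqrt (2 * \<alpha> * (1 + \<alpha>)) * (2 ^ j) powr ((1 - \<alpha>) / 2)) powr (1 - \<theta>) * \<bar>t\<bar> powr (\<theta> - 1)"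
proof -
  let ?X = "norm (osc_kernel \<alpha> (shell j) t z)" and ?A = "4 * (2 ^ j)\<^sup>2 :: real"
  let ?B = "256 / sqrt (2 * \<alpha> * (1 + \<alpha>)) * (2 ^ j) powr ((1 - \<alpha>) / 2)"
  have "?X = ?X powr \<theta> * ?X powr (1 - \<theta>)"
    using assms by (cases "?X = 0") (auto simp: powr_add[symmetric])
  also have "\<dots> \<le> ?A powr \<theta> * (?B / \<bar>t\<bar>) powr (1 - \<theta>)"
    using assms by (intro mult_mono powr_mono2 osc_kernel_shell_le_measure osc_kernel_shell_le_decay) auto
  also have "(?B / \<bar>t\<bar>) powr (1 - \<theta>) = ?B powr (1 - \<theta>) * \<bar>t\<bar> powr (\<theta> - 1)"
  proof -
    have "0 \<le> ?B" using assms by simp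
    then have "(?B / \<bar>t\<bar>) powr (1 - \<theta>) = ?B powr (1 - \<theta>) / \<bar>t\<bar> powr (1 - \<theta>)" by (simp only: powr_divide abs_ge_zero)
    moreover have "\<bar>t\<bar> powr (\<theta> - 1) = 1 / \<bar>t\<bar> powr (1 - \<theta>)"
      using powr_minus_divide[of "\<bar>t\<bar>" "1 - \<theta>"] by simp
    ultimately show ?thesis by simp
  qed
  finally show ?thesis by (simp add: mult.assoc)
qed

section \<open>Discrete \<open>T T\<^sup>*\<close> argument and Duhamel's formula\<close>

text \<open>By the mean value theorem each term is at most the increment of the primitive m^\<theta>
  / \<theta> over the preceding unit interval, and the increments telescope.\<close>

lemma sum_powr_le:
  assumes "0 < \<theta>" "\<theta> < 1"
  shows "(\<Sum>m=1..N. real m powr (\<theta> - 1)) \<le> real N powr \<theta> / \<theta>"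
proof (induction N)
  case (Suc N)
  have "real (Suc N) powr (\<theta> - 1) \<le> (real (Suc N) powr \<theta> - real N powr \<theta>) / \<theta>"
  proof (cases "N = 0")
    case False
    have "\<exists>z>real N. z < real (Suc N) \<and> real (Suc N) powr \<theta> - real N powr \<theta> = (real (Suc N) - real N) * (\<theta> * z powr (\<theta> - 1))"
      by (rule MVT2) (use False in \<open>auto intro!: derivative_eq_intros\<close>)
    then obtain z where z: "real N < z" "z < real (Suc N)" "real (Suc N) powr \<theta> - real N powr \<theta> = \<theta> * z powr (\<theta> - 1)"
      by auto
    have "real (Suc N) powr (\<theta> - 1) \<le> z powr (\<theta> - 1)"
      using z False assms by (intro powr_mono2') auto
    then show ?thesis using z(3) assms by simp
  qed (use assms in simp)
  then have "(\<Sum>m=1..N. real m powr (\<theta> - 1)) + real (Suc N) powr (\<theta> - 1)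
     \<le> real N powr \<theta> / \<theta> + (real (Suc N) powr \<theta> - real N powr \<theta>) / \<theta>"
    using Suc by (intro add_mono)
  then show ?case by (simp add: diff_divide_distrib)
qed simp

text \<open>Seen from a fixed index, distance 0 occurs once and every other distance at most twice;
  the second sum therefore starts at 1.\<close>

lemma sum_dist_le:
  fixes f :: "nat \<Rightarrow> real"
  assumes "k < N" "\<And>m. 0 \<le> f m"
  shows "(\<Sum>l<N. f (if l \<le> k then k - l else l - k)) \<le> (\<Sum>m<N. f m) + (\<Sum>m=1..<N. f m)"
proof -
  have U: "{..<N} = {..k} \<union> {k<..<N}" using assms(1) by auto
  have "(\<Sum>l<N. f (if l \<le> k then k - l else l - k)) = 
     (\<Sum>l\<in>{..k}. f (if l \<le> k then k - l else l - k)) + (\<Sum>l\<in>{k<..<N}. f (if l \<le> k then k - l else l - k))"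
    unfolding U by (rule sum.union_disjoint) auto
  also have "(\<Sum>l\<in>{..k}. f (if l \<le> k then k - l else l - k)) = (\<Sum>m\<in>(\<lambda>l. k - l) ` {..k}. f m)"
    by (subst sum.reindex) (auto simp: inj_on_def)
  also have "\<dots> \<le> (\<Sum>m<N. f m)"
    by (rule sum_mono2) (use assms in auto)
  also have "(\<Sum>l\<in>{k<..<N}. f (if l \<le> k then k - l else l - k)) = (\<Sum>m\<in>(\<lambda>l. l - k) ` {k<..<N}. f m)"
    by (subst sum.reindex) (auto simp: inj_on_def)
  also have "\<dots> \<le> (\<Sum>m=1..<N. f m)"
    by (rule sum_mono2) (use assms in auto)
  finally show ?thesis by simp
qed

text \<open>Row sum for Schur's test. Sample points in equal or adjacent cells may be arbitrarily
  close, so up to three entries carry only the crude bound A. Points whose cell indices differ by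
  \<open>Suc m\<close> are at least m cell lengths apart, which accounts for the shift by
  one.\<close>

lemma sum_kernel_row_le:
  assumes "k < N" "0 < \<theta>" "\<theta> < 1" "0 < h" "0 \<le> A" "0 \<le> D"
    and near: "\<And>l. l < N \<Longrightarrow> x l \<le> A"
    and far: "\<And>l m. l < N \<Longrightarrow> 0 < m \<Longrightarrow> l = k + Suc m \<or> k = l + Suc m \<Longrightarrow> x l \<le> D * (real m * h) powr (\<theta> - 1)"
  shows "(\<Sum>l<N. x l) \<le> 3 * A + 2 * D * h powr (\<theta> - 1) * (real N powr \<theta> / \<theta>)"
proof -
  define f where "f m = (if m \<le> 1 then A else D * (real (m - 1) * h) powr (\<theta> - 1))" for m :: nat
  have f0: "0 \<le> f m" for m using assms by (simp add: f_def)
  have "(\<Sum>l<N. x l) \<le> (\<Sum>l<N. f (if l \<le> k then k - l else l - k))"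
  proof (rule sum_mono)
    fix l assume "l \<in> {..<N}"
    then have l: "l < N" by simp
    show "x l \<le> f (if l \<le> k then k - l else l - k)"
    proof (cases "(if l \<le> k then k - l else l - k) \<le> 1")
      case True then show ?thesis using near[OF l] by (simp only: f_def if_True)
    next
      case False
      define m where "m = (if l \<le> k then k - l else l - k) - 1"
      have "0 < m" "l = k + Suc m \<or> k = l + Suc m" using False by (auto simp: m_def split: if_splits)
      from far[OF l this] show ?thesis using False by (simp only: f_def if_False m_def)
    qed
  qed
  also have "\<dots> \<le> (\<Sum>m<N. f m) + (\<Sum>m=1..<N. f m)"
    by (rule sum_dist_le[OF assms(1) f0])
  \<comment> \<open>The longer range lets the shifted index run over exactly 1..N; the added terms
    are nonnegative.\<close>
  also have "\<dots> \<le> (\<Sum>m<N+2. f m) + (\<Sum>m=1..<N+2. f m)"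
    using f0 by (intro add_mono sum_mono2) auto
  also have "\<dots> = f 0 + 2 * (\<Sum>m=1..<N+2. f m)"
    by (simp add: lessThan_atLeast0 sum.atLeast_Suc_lessThan[of 0])
  also have "(\<Sum>m=1..<N+2. f m) = f 1 + (\<Sum>m=2..<N+2. f m)"
    by (subst sum.atLeast_Suc_lessThan) (auto simp: numeral_2_eq_2)
  also have "(\<Sum>m=2..<N+2. f m) = (\<Sum>m=1..N. D * (real m * h) powr (\<theta> - 1))"
    by (rule sum.reindex_bij_witness[of _ Suc "\<lambda>m. m - 1"]) (auto simp: f_def)
  also have "\<dots> = D * h powr (\<theta> - 1) * (\<Sum>m=1..N. real m powr (\<theta> - 1))"
    using assms by (simp add: powr_mult sum_distrib_left mult_ac)
  also have "f 0 + 2 * (f 1 + D * h powr (\<theta> - 1) * (\<Sum>m=1..N. real m powr (\<theta> - 1)))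
      \<le> 3 * A + 2 * (D * h powr (\<theta> - 1) * (real N powr \<theta> / \<theta>))"
    using mult_left_mono[OF sum_powr_le[OF assms(2,3), of N], of "D * h powr (\<theta> - 1)"] assms(6)
    by (simp add: f_def)
  finally show ?thesis by (simp add: mult_ac)
qed

lemma L2_bounded_support:
  assumes "E \<in> sets borel" "emeasure lborel E < \<infinity>" "g \<in> borel_measurable borel"
    "\<And>\<zeta>. norm (g \<zeta>) \<le> C * indicator E \<zeta>"
  shows "g \<in> L2"
proof (rule L2_dominated(1)[of "\<lambda>\<zeta>. of_real (indicator E \<zeta>)" _ C])
  have i: "integrable lborel (\<lambda>\<zeta>. indicator E \<zeta> :: real)"
    using assms by (intro integrable_real_indicator) auto
  have [measurable]: "E \<in> sets borel" by fact
  have "integrable lborel (\<lambda>\<zeta>. (norm (complex_of_real (indicator E \<zeta>)))\<^sup>2)"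
    by (rule Bochner_Integration.integrable_cong[THEN iffD1, OF refl _ i]) (auto simp: indicator_def)
  then show "(\<lambda>\<zeta>. complex_of_real (indicator E \<zeta>)) \<in> L2" unfolding L2_iff by simp
qed (use assms in auto)

text \<open>The \<open>T T\<^sup>*\<close> argument in discrete form: the kernel of the squared norm is \<open>osc_kernel\<close>.\<close>

lemma l2_sum_waves_le:
  fixes z :: "nat \<Rightarrow> plane" and \<tau> :: "nat \<Rightarrow> real" and c :: "nat \<Rightarrow> complex"
  assumes E: "E \<in> sets borel" "emeasure lborel E < \<infinity>"
    and A: "\<And>t z. norm (osc_kernel \<alpha> E t z) \<le> A" 
    and D: "\<And>t z. t \<noteq> 0 \<Longrightarrow> norm (osc_kernel \<alpha> E t z) \<le> D * \<bar>t\<bar> powr (\<theta> - 1)" "0 \<le> D"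
    and \<theta>: "0 < \<theta>" "\<theta> < 1" and h: "0 < h"
    and \<tau>: "\<And>k. k < N \<Longrightarrow> \<tau> k \<in> {a + real k * h..a + real (Suc k) * h}"
    and c: "\<And>k. norm (c k) \<le> 1"
  shows "(l2 (\<lambda>\<zeta>. of_real (indicator E \<zeta>) * (\<Sum>k<N. c k * cis (z k \<bullet> \<zeta> - \<tau> k * dispersion \<alpha> \<zeta>))))\<^sup>2
     \<le> real N * (3 * A + 2 * D * h powr (\<theta> - 1) * (real N powr \<theta> / \<theta>))"
proof -
  let ?p = "\<lambda>k \<zeta>. z k \<bullet> \<zeta> - \<tau> k * dispersion \<alpha> \<zeta>"
  let ?P = "\<lambda>\<zeta>. of_real (indicator E \<zeta>) * (\<Sum>k<N. c k * cis (?p k \<zeta>))"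
  let ?K = "\<lambda>k l. osc_kernel \<alpha> E (\<tau> k - \<tau> l) (z k - z l)"
  let ?k = "\<lambda>k l \<zeta>. complex_of_real (indicator E \<zeta>) * cis ((z k - z l) \<bullet> \<zeta> - (\<tau> k - \<tau> l) * dispersion \<alpha> \<zeta>)"
  have A0: "0 \<le> A" using A[of 0 0] norm_ge_zero order_trans by blast
  have i: "integrable lborel (?k k l)" for k l
    by (rule integrable_indicator_cis[OF E]) measurable
  \<comment> \<open>The squared modulus as a double sum over pairs of waves. After integration each
    pair becomes the kernel at the difference of the times and of the points.\<close>
  have eq: "complex_of_real ((norm (?P \<zeta>))\<^sup>2) = (\<Sum>k<N. \<Sum>l<N. c k * cnj (c l) * ?k k l \<zeta>)" for \<zeta>
  proof -
    have "complex_of_real ((norm (?P \<zeta>))\<^sup>2) = ?P \<zeta> * cnj (?P \<zeta>)" by (rule complex_norm_square)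
    also have "\<dots> = of_real (indicator E \<zeta>) * ((\<Sum>k<N. c k * cis (?p k \<zeta>)) * (\<Sum>l<N. cnj (c l) * cis (- ?p l \<zeta>)))"
      by (simp add: cnj_sum cis_cnj indicator_def)
    also have "\<dots> = (\<Sum>k<N. \<Sum>l<N. of_real (indicator E \<zeta>) * ((c k * cis (?p k \<zeta>)) * (cnj (c l) * cis (- ?p l \<zeta>))))"
      by (subst sum_product) (simp only: sum_distrib_left)
    also have "\<dots> = (\<Sum>k<N. \<Sum>l<N. c k * cnj (c l) * ?k k l \<zeta>)"
    proof (intro sum.cong refl)
      fix k l
      have "cis ((z k - z l) \<bullet> \<zeta> - (\<tau> k - \<tau> l) * dispersion \<alpha> \<zeta>) = cis (?p k \<zeta>) * cis (- ?p l \<zeta>)"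
        by (simp add: cis_mult inner_diff_left algebra_simps)
      then show "of_real (indicator E \<zeta>) * ((c k * cis (?p k \<zeta>)) * (cnj (c l) * cis (- ?p l \<zeta>))) = c k * cnj (c l) * ?k k l \<zeta>"
        by (simp only: mult_ac)
    qed
    finally show ?thesis .
  qed
  have "complex_of_real ((l2 ?P)\<^sup>2) = (LINT \<zeta>|lborel. complex_of_real ((norm (?P \<zeta>))\<^sup>2))"
    unfolding l2_square by (rule integral_complex_of_real[symmetric])
  also have "\<dots> = (\<Sum>k<N. \<Sum>l<N. c k * cnj (c l) * ?K k l)"
    unfolding eq osc_kernel_def using i by (simp add: Bochner_Integration.integral_sum)
  finally have "norm (complex_of_real ((l2 ?P)\<^sup>2)) = norm (\<Sum>k<N. \<Sum>l<N. c k * cnj (c l) * ?K k l)" by simp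
  then have "(l2 ?P)\<^sup>2 = norm (\<Sum>k<N. \<Sum>l<N. c k * cnj (c l) * ?K k l)" by (simp only: norm_of_real abs_power2)
  also have "\<dots> \<le> (\<Sum>k<N. \<Sum>l<N. norm (?K k l))"
  proof (intro sum_norm_le)
    fix k l
    have "norm (c k) * norm (c l) \<le> 1 * 1" by (intro mult_mono c) auto
    then show "norm (c k * cnj (c l) * ?K k l) \<le> norm (?K k l)"
      using mult_right_mono[of "norm (c k) * norm (c l)" 1 "norm (?K k l)"] by (simp add: norm_mult)
  qed
  also have "\<dots> \<le> (\<Sum>k<N. 3 * A + 2 * D * h powr (\<theta> - 1) * (real N powr \<theta> / \<theta>))"
  proof (rule sum_mono)
    fix k assume "k \<in> {..<N}"
    then have k: "k < N" by simp
    show "(\<Sum>l<N. norm (?K k l)) \<le> 3 * A + 2 * D * h powr (\<theta> - 1) * (real N powr \<theta> / \<theta>)"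
    proof (rule sum_kernel_row_le[OF k \<theta> h A0 D(2)])
      fix l m assume l: "l < N" "0 < m" and m: "l = k + Suc m \<or> k = l + Suc m"
      have "\<bar>\<tau> k - \<tau> l\<bar> \<ge> real m * h"
        using m \<tau>[OF k] \<tau>[OF l(1)] h by (auto simp: algebra_simps)
      moreover have "0 < real m * h" using l h by simp
      ultimately have "norm (?K k l) \<le> D * \<bar>\<tau> k - \<tau> l\<bar> powr (\<theta> - 1)"
        and "\<bar>\<tau> k - \<tau> l\<bar> powr (\<theta> - 1) \<le> (real m * h) powr (\<theta> - 1)"
        using \<theta> by (auto intro!: D powr_mono2')
      then show "norm (?K k l) \<le> D * (real m * h) powr (\<theta> - 1)"
        using D(2) by (meson mult_left_mono order_trans)
    qed (rule A)
  qed
  finally show ?thesis by simp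
qed

section \<open>The weak form of Duhamel's formula\<close>

lemma norm_cis_diff_le: "norm (cis (s * x) - cis (t * x)) \<le> \<bar>s - t\<bar> * \<bar>x\<bar>"
proof -
  have "cis (s * x) - cis (t * x) = cis (t * x) * (cis ((s - t) * x) - 1)"
    by (simp add: algebra_simps cis_mult)
  then show ?thesis using cis_approx1[of "(s - t) * x"] by (simp add: abs_mult)
qed

lemma norm_cis_quotient_le:
  assumes "s \<noteq> t"
  shows "norm ((cis (s * x) - cis (t * x)) / of_real (s - t) - \<i> * of_real x * cis (t * x)) \<le> \<bar>s - t\<bar> * \<bar>x\<^sup>2\<bar>"
proof -
  have "(cis (s * x) - cis (t * x)) / of_real (s - t) - \<i> * of_real x * cis (t * x)
     = cis (t * x) * (cis ((s - t) * x) - 1 - \<i> * of_real ((s - t) * x)) / of_real (s - t)"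
  proof -
    have gen: "(u * v - u) / d - \<i> * y * u = u * (v - 1 - \<i> * (d * y)) / d" if "d \<noteq> 0" for u v d y :: complex
      using that by (simp add: field_simps)
    have eq: "cis (s * x) = cis (t * x) * cis ((s - t) * x)" by (simp add: cis_mult algebra_simps)
    have ne: "complex_of_real (s - t) \<noteq> 0" using assms by (metis of_real_eq_0_iff right_minus_eq)
    show ?thesis unfolding of_real_mult eq by (rule gen[OF ne])
  qed
  also have "norm \<dots> \<le> ((s - t) * x)\<^sup>2 / \<bar>s - t\<bar>"
    using cis_approx2[of "(s - t) * x"] by (simp add: norm_divide norm_mult divide_right_mono flip: of_real_diff)
  also have "\<dots> = \<bar>s - t\<bar> * \<bar>x\<^sup>2\<bar>"
  proof -
    have "((s - t) * x)\<^sup>2 = \<bar>s - t\<bar> * (\<bar>s - t\<bar> * \<bar>x\<^sup>2\<bar>)" by (simp add: power_mult_distrib power2_eq_square)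
    then show ?thesis using assms by simp
  qed
  finally show ?thesis .
qed

text \<open>\<open>W\<close> and \<open>G\<close> stand for the transforms of the solution and of
  the force. Everything is stated in \<open>L2\<close> of frequency space; Sobolev bounds join only
  when the shells are estimated and summed.\<close>

locale dispersive_flow =
  fixes \<alpha> T :: real and W G :: "real \<Rightarrow> plane \<Rightarrow> complex"
  assumes W: "\<And>t. t \<in> {0..T} \<Longrightarrow> W t \<in> L2"
    and G: "\<And>t. t \<in> {0..T} \<Longrightarrow> G t \<in> L2"
    and disp_W: "\<And>t. t \<in> {0..T} \<Longrightarrow> (\<lambda>\<zeta>. \<i> * of_real (dispersion \<alpha> \<zeta>) * W t \<zeta>) \<in> L2"
    and W_cont: "\<And>t. t \<in> {0..T} \<Longrightarrow> ((\<lambda>\<tau>. l2 (\<lambda>\<zeta>. W \<tau> \<zeta> - W t \<zeta>)) \<longlongrightarrow> 0) (at t within {0..T})"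
    and G_cont: "\<And>t. t \<in> {0..T} \<Longrightarrow> ((\<lambda>\<tau>. l2 (\<lambda>\<zeta>. G \<tau> \<zeta> - G t \<zeta>)) \<longlongrightarrow> 0) (at t within {0..T})"
    and W_deriv: "\<And>t. t \<in> {0..T} \<Longrightarrow> ((\<lambda>\<tau>. l2 (\<lambda>\<zeta>. (W \<tau> \<zeta> - W t \<zeta>) / of_real (\<tau> - t)
      - (G t \<zeta> - \<i> * of_real (dispersion \<alpha> \<zeta>) * W t \<zeta>))) \<longlongrightarrow> 0) (at t within {0..T})"
begin

text \<open>\<open>pairing V t \<Psi>\<close> tests \<open>V t\<close>, transported back by the free group, against \<open>\<Psi>\<close>.\<close>

definition pairing :: "(real \<Rightarrow> plane \<Rightarrow> complex) \<Rightarrow> real \<Rightarrow> (plane \<Rightarrow> complex) \<Rightarrow> complex" where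
  "pairing V t \<Psi> = (LINT \<zeta>|lborel. (cis (t * dispersion \<alpha> \<zeta>) * V t \<zeta>) * \<Psi> \<zeta>)"

lemma cis_mult_L2:
  assumes "g \<in> L2" and [measurable]: "f \<in> borel_measurable borel"
  shows "(\<lambda>\<zeta>. cis (f \<zeta>) * g \<zeta>) \<in> L2"
proof (rule L2_mono(1)[OF assms(1)])
  have [measurable]: "g \<in> borel_measurable borel" using assms(1) by (rule L2_measurable)
  show "(\<lambda>\<zeta>. cis (f \<zeta>) * g \<zeta>) \<in> borel_measurable borel" by measurable
qed simp

text \<open>The growth of the multiplier \<open>k\<close> is charged to \<open>\<Psi>\<close>
  through the weight \<open>m\<close>, so that \<open>f\<close> itself has to be in
  \<open>L2\<close> only. The test functions used later live on a set where the dispersion is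
  bounded and absorb these weights.\<close>

lemma norm_triple_integral_le:
  assumes "f \<in> L2" "(\<lambda>\<zeta>. of_real (m \<zeta>) * \<Psi> \<zeta>) \<in> L2" "k \<in> borel_measurable borel" "\<Psi> \<in> borel_measurable borel"
    and k: "\<And>\<zeta>. norm (k \<zeta>) \<le> C * \<bar>m \<zeta>\<bar>" and "0 \<le> C"
  shows "integrable lborel (\<lambda>\<zeta>. k \<zeta> * f \<zeta> * \<Psi> \<zeta>)"
    and "norm (LINT \<zeta>|lborel. k \<zeta> * f \<zeta> * \<Psi> \<zeta>) \<le> l2 f * (C * l2 (\<lambda>\<zeta>. of_real (m \<zeta>) * \<Psi> \<zeta>))"
proof -
  have kp: "norm (k \<zeta> * \<Psi> \<zeta>) \<le> C * norm (complex_of_real (m \<zeta>) * \<Psi> \<zeta>)" for \<zeta>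
    using mult_right_mono[OF k[of \<zeta>], of "norm (\<Psi> \<zeta>)"] by (simp add: norm_mult mult.assoc)
  have L: "(\<lambda>\<zeta>. k \<zeta> * \<Psi> \<zeta>) \<in> L2" and le: "l2 (\<lambda>\<zeta>. k \<zeta> * \<Psi> \<zeta>) \<le> C * l2 (\<lambda>\<zeta>. of_real (m \<zeta>) * \<Psi> \<zeta>)"
    using L2_dominated[OF assms(2) _ kp] assms(3,4,6) by auto
  have eq: "(\<lambda>\<zeta>. k \<zeta> * f \<zeta> * \<Psi> \<zeta>) = (\<lambda>\<zeta>. f \<zeta> * (k \<zeta> * \<Psi> \<zeta>))" by (simp add: mult_ac)
  show "integrable lborel (\<lambda>\<zeta>. k \<zeta> * f \<zeta> * \<Psi> \<zeta>)"
    unfolding eq by (rule L2_mult_integrable[OF assms(1) L])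
  show "norm (LINT \<zeta>|lborel. k \<zeta> * f \<zeta> * \<Psi> \<zeta>) \<le> l2 f * (C * l2 (\<lambda>\<zeta>. of_real (m \<zeta>) * \<Psi> \<zeta>))"
    unfolding eq using Cauchy_Schwarz_l2_integral[OF assms(1) L] le
    by (meson l2_nonneg mult_left_mono order_trans)
qed

text \<open>Product rule in weak form: the derivative of the phase cancels the dispersive term and
  only the force remains. Testing transfers the factors \<omega> and \<omega>^2 of the Taylor
  remainders from the solution to \<open>\<Psi>\<close>.\<close>

lemma pairing_has_vector_derivative:
  assumes t: "t \<in> {0..T}" and \<Psi>0: "\<Psi> \<in> L2" 
    and \<Psi>1: "(\<lambda>\<zeta>. of_real (dispersion \<alpha> \<zeta>) * \<Psi> \<zeta>) \<in> L2"
    and \<Psi>2: "(\<lambda>\<zeta>. of_real ((dispersion \<alpha> \<zeta>)\<^sup>2) * \<Psi> \<zeta>) \<in> L2"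
  shows "((\<lambda>\<tau>. pairing W \<tau> \<Psi>) has_vector_derivative pairing G t \<Psi>) (at t within {0..T})"
proof -
  let ?\<omega> = "dispersion \<alpha>"
  have [measurable]: "\<Psi> \<in> borel_measurable borel" using \<Psi>0 L2_measurable by blast
  define V where "V \<zeta> = G t \<zeta> - \<i> * of_real (?\<omega> \<zeta>) * W t \<zeta>" for \<zeta>
  have VL: "V \<in> L2" unfolding V_def[abs_def] by (intro L2_diff G disp_W t)
  define Q where "Q \<tau> \<zeta> = (W \<tau> \<zeta> - W t \<zeta>) / of_real (\<tau> - t) - V \<zeta>" for \<tau> \<zeta>
  have QL: "Q \<tau> \<in> L2" if "\<tau> \<in> {0..T}" for \<tau>
    using L2_diff[OF L2_cmult[OF L2_diff[OF W[OF that] W[OF t]], of "1 / of_real (\<tau> - t)"] VL]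
    by (simp add: Q_def[abs_def])
  have Q0: "((\<lambda>\<tau>. l2 (Q \<tau>)) \<longlongrightarrow> 0) (at t within {0..T})"
    using W_deriv[OF t] by (simp add: Q_def[abs_def] V_def)
  let ?e = "\<lambda>\<tau>. l2 (Q \<tau>) * l2 \<Psi> + (l2 V * (\<bar>\<tau> - t\<bar> * l2 (\<lambda>\<zeta>. of_real (?\<omega> \<zeta>) * \<Psi> \<zeta>))
       + l2 (W t) * (\<bar>\<tau> - t\<bar> * l2 (\<lambda>\<zeta>. of_real ((?\<omega> \<zeta>)\<^sup>2) * \<Psi> \<zeta>)))"
  have main: "norm (pairing W \<tau> \<Psi> - pairing W t \<Psi> - of_real (\<tau> - t) * pairing G t \<Psi>) \<le> \<bar>\<tau> - t\<bar> * ?e \<tau>"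
    if \<tau>: "\<tau> \<in> {0..T}" "\<tau> \<noteq> t" for \<tau>
  proof -
    let ?a = "\<lambda>\<zeta>. cis (\<tau> * ?\<omega> \<zeta>) * Q \<tau> \<zeta> * \<Psi> \<zeta>"
    let ?b = "\<lambda>\<zeta>. (cis (\<tau> * ?\<omega> \<zeta>) - cis (t * ?\<omega> \<zeta>)) * V \<zeta> * \<Psi> \<zeta>"
    let ?c = "\<lambda>\<zeta>. ((cis (\<tau> * ?\<omega> \<zeta>) - cis (t * ?\<omega> \<zeta>)) / of_real (\<tau> - t) - \<i> * of_real (?\<omega> \<zeta>) * cis (t * ?\<omega> \<zeta>)) * W t \<zeta> * \<Psi> \<zeta>"
    have a: "integrable lborel ?a" "norm (LINT \<zeta>|lborel. ?a \<zeta>) \<le> l2 (Q \<tau>) * (1 * l2 (\<lambda>\<zeta>. of_real 1 * \<Psi> \<zeta>))"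
      using norm_triple_integral_le[of "Q \<tau>" "\<lambda>_. 1" \<Psi> "\<lambda>\<zeta>. cis (\<tau> * ?\<omega> \<zeta>)" 1] QL[OF \<tau>(1)] \<Psi>0 by auto
    have bk: "norm (cis (\<tau> * ?\<omega> \<zeta>) - cis (t * ?\<omega> \<zeta>)) \<le> \<bar>\<tau> - t\<bar> * \<bar>?\<omega> \<zeta>\<bar>" for \<zeta>
      by (rule norm_cis_diff_le)
    have ck: "norm ((cis (\<tau> * ?\<omega> \<zeta>) - cis (t * ?\<omega> \<zeta>)) / of_real (\<tau> - t) - \<i> * of_real (?\<omega> \<zeta>) * cis (t * ?\<omega> \<zeta>))
        \<le> \<bar>\<tau> - t\<bar> * \<bar>(?\<omega> \<zeta>)\<^sup>2\<bar>" for \<zeta>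
      by (rule norm_cis_quotient_le[OF \<tau>(2)])
    have bm: "(\<lambda>\<zeta>. cis (\<tau> * ?\<omega> \<zeta>) - cis (t * ?\<omega> \<zeta>)) \<in> borel_measurable borel" by measurable
    have cm: "(\<lambda>\<zeta>. (cis (\<tau> * ?\<omega> \<zeta>) - cis (t * ?\<omega> \<zeta>)) / of_real (\<tau> - t) - \<i> * of_real (?\<omega> \<zeta>) * cis (t * ?\<omega> \<zeta>)) \<in> borel_measurable borel"
      by measurable
    have \<Psi>m: "\<Psi> \<in> borel_measurable borel" by measurable
    have b1: "integrable lborel ?b"
      by (rule norm_triple_integral_le(1)[OF VL \<Psi>1 bm \<Psi>m bk abs_ge_zero])
    have b2: "norm (LINT \<zeta>|lborel. ?b \<zeta>) \<le> l2 V * (\<bar>\<tau> - t\<bar> * l2 (\<lambda>\<zeta>. of_real (?\<omega> \<zeta>) * \<Psi> \<zeta>))"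
      by (rule norm_triple_integral_le(2)[OF VL \<Psi>1 bm \<Psi>m bk abs_ge_zero])
    have c1: "integrable lborel ?c"
      by (rule norm_triple_integral_le(1)[OF W[OF t] \<Psi>2 cm \<Psi>m ck abs_ge_zero])
    have c2: "norm (LINT \<zeta>|lborel. ?c \<zeta>) \<le> l2 (W t) * (\<bar>\<tau> - t\<bar> * l2 (\<lambda>\<zeta>. of_real ((?\<omega> \<zeta>)\<^sup>2) * \<Psi> \<zeta>))"
      by (rule norm_triple_integral_le(2)[OF W[OF t] \<Psi>2 cm \<Psi>m ck abs_ge_zero])
    have pi: "integrable lborel (\<lambda>\<zeta>. (cis (s * ?\<omega> \<zeta>) * V \<zeta>) * \<Psi> \<zeta>)" if "V \<in> L2" for s V
      by (rule L2_mult_integrable[OF cis_mult_L2[OF that] \<Psi>0]) measurable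
    have ne: "complex_of_real (\<tau> - t) \<noteq> 0" using \<tau> by (metis of_real_eq_0_iff right_minus_eq)
    \<comment> \<open>Exact splitting of the increment: \<open>?a\<close> carries the error of the
      difference quotient of \<open>W\<close>, \<open>?b\<close> the change of phase against the
      derivative \<open>V\<close>, and \<open>?c\<close> the second-order remainder of the phase
      against \<open>W t\<close>.\<close>
    have id: "(cis (\<tau> * ?\<omega> \<zeta>) * W \<tau> \<zeta>) * \<Psi> \<zeta> - (cis (t * ?\<omega> \<zeta>) * W t \<zeta>) * \<Psi> \<zeta>
       - of_real (\<tau> - t) * ((cis (t * ?\<omega> \<zeta>) * G t \<zeta>) * \<Psi> \<zeta>) = of_real (\<tau> - t) * (?a \<zeta> + (?b \<zeta> + ?c \<zeta>))" for \<zeta>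
    proof -
      have gen: "(x * w' * p - y * w * p - d * (y * g * p)) = d * (x * ((w' - w) / d - (g - io * w)) * p
         + ((x - y) * (g - io * w) * p + ((x - y) / d - io * y) * w * p))" if "d \<noteq> 0" for x y w w' g io p d :: complex
        using that by (simp add: field_simps)
      show ?thesis unfolding Q_def V_def by (rule gen[OF ne])
    qed
    have "pairing W \<tau> \<Psi> - pairing W t \<Psi> - of_real (\<tau> - t) * pairing G t \<Psi>
       = (LINT \<zeta>|lborel. of_real (\<tau> - t) * (?a \<zeta> + (?b \<zeta> + ?c \<zeta>)))"
      unfolding pairing_def id[symmetric] using pi[OF W[OF \<tau>(1)]] pi[OF W[OF t]] pi[OF G[OF t]] by simp
    also have "\<dots> = of_real (\<tau> - t) * ((LINT \<zeta>|lborel. ?a \<zeta>) + ((LINT \<zeta>|lborel. ?b \<zeta>) + (LINT \<zeta>|lborel. ?c \<zeta>)))"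
      using a(1) b1 c1 by (simp only: integral_mult_right_zero Bochner_Integration.integral_add Bochner_Integration.integrable_add)
    finally have eq: "pairing W \<tau> \<Psi> - pairing W t \<Psi> - of_real (\<tau> - t) * pairing G t \<Psi>
       = of_real (\<tau> - t) * ((LINT \<zeta>|lborel. ?a \<zeta>) + ((LINT \<zeta>|lborel. ?b \<zeta>) + (LINT \<zeta>|lborel. ?c \<zeta>)))" .
    show ?thesis
      unfolding eq norm_mult norm_of_real
      by (intro mult_left_mono norm_triangle_le add_mono b2 c2) (use a(2) in auto)
  qed
  have "((\<lambda>\<tau>. \<bar>\<tau> - t\<bar>) \<longlongrightarrow> 0) (at t within {0..T})"
    by (rule tendsto_rabs_zero[OF LIM_zero[OF tendsto_ident_at]])
  from tendsto_add[OF tendsto_mult_right[OF Q0] tendsto_add[OF tendsto_mult_left[OF tendsto_mult_right[OF this]] tendsto_mult_left[OF tendsto_mult_right[OF this]]]]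
  have e0: "(?e \<longlongrightarrow> 0) (at t within {0..T})" by (simp only: mult_zero_left mult_zero_right add_0_left)
  show ?thesis
    unfolding has_vector_derivative_def has_derivative_within
  proof (intro conjI bounded_linear_scaleR_left Lim_null_comparison[OF _ e0])
    show "\<forall>\<^sub>F \<tau> in at t within {0..T}. norm ((1 / norm (\<tau> - t)) *\<^sub>R (pairing W \<tau> \<Psi> - (pairing W t \<Psi> + (\<tau> - t) *\<^sub>R pairing G t \<Psi>))) \<le> ?e \<tau>"
      unfolding eventually_at_filter
    proof (intro always_eventually allI impI)
      fix \<tau> assume \<tau>: "\<tau> \<noteq> t" "\<tau> \<in> {0..T}"
      then have "0 < \<bar>\<tau> - t\<bar>" by simp
      moreover have "pairing W \<tau> \<Psi> - (pairing W t \<Psi> + (\<tau> - t) *\<^sub>R pairing G t \<Psi>)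
          = pairing W \<tau> \<Psi> - pairing W t \<Psi> - of_real (\<tau> - t) * pairing G t \<Psi>"
        unfolding scaleR_conv_of_real by (rule diff_diff_eq[symmetric])
      ultimately have "norm (pairing W \<tau> \<Psi> - (pairing W t \<Psi> + (\<tau> - t) *\<^sub>R pairing G t \<Psi>)) / \<bar>\<tau> - t\<bar> \<le> ?e \<tau>"
        using main[OF \<tau>(2,1)] by (simp only: pos_divide_le_eq mult.commute)
      then show "norm ((1 / norm (\<tau> - t)) *\<^sub>R (pairing W \<tau> \<Psi> - (pairing W t \<Psi> + (\<tau> - t) *\<^sub>R pairing G t \<Psi>))) \<le> ?e \<tau>"
        by (simp only: norm_scaleR real_norm_def abs_divide abs_abs abs_one times_divide_eq_left mult_1_left)
    qed
  qed
qed

text \<open>Testing first makes this a statement about scalar functions of time, namely the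
  fundamental theorem of calculus; no integral with values in a function space occurs.\<close>

lemma pairing_duhamel:
  assumes "0 \<le> a" "a \<le> t" "t \<le> T" and "\<Psi> \<in> L2" 
    "(\<lambda>\<zeta>. of_real (dispersion \<alpha> \<zeta>) * \<Psi> \<zeta>) \<in> L2" "(\<lambda>\<zeta>. of_real ((dispersion \<alpha> \<zeta>)\<^sup>2) * \<Psi> \<zeta>) \<in> L2"
  shows "((\<lambda>s. pairing G s \<Psi>) has_integral (pairing W t \<Psi> - pairing W a \<Psi>)) {a..t}"
proof (rule fundamental_theorem_of_calculus[OF assms(2)])
  fix x assume x: "x \<in> {a..t}"
  then have "((\<lambda>\<tau>. pairing W \<tau> \<Psi>) has_vector_derivative pairing G x \<Psi>) (at x within {0..T})"
    using assms by (intro pairing_has_vector_derivative) auto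
  then show "((\<lambda>\<tau>. pairing W \<tau> \<Psi>) has_vector_derivative pairing G x \<Psi>) (at x within {a..t})"
    by (rule has_vector_derivative_within_subset) (use assms in auto)
qed

end

text \<open>An upper Riemann sum whose maxima are attained by continuity. One sample per cell keeps
  samples of distant cells apart, as the row sums require.\<close>

lemma integral_le_cell_sum:
  fixes S :: "real \<Rightarrow> real"
  assumes "continuous_on {a..b} S" "a < b" "0 < N"
  defines "h \<equiv> (b - a) / real N"
  obtains \<tau> where "\<And>k. k < N \<Longrightarrow> \<tau> k \<in> {a + real k * h..a + real (Suc k) * h}"
    "\<And>k. k < N \<Longrightarrow> \<tau> k \<in> {a..b}" "integral {a..b} S \<le> h * (\<Sum>k<N. S (\<tau> k))"
proof -
  let ?c = "\<lambda>k. {a + real k * h..a + real (Suc k) * h}"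
  have h: "0 < h" "real N * h = b - a" using assms by (auto simp: h_def)
  have pos: "a + real n * h \<le> b" if "n \<le> N" for n
    using mult_right_mono[of "real n" "real N" h] that h by simp
  have ge: "a \<le> a + real n * h" for n using h by simp
  have sub: "?c k \<subseteq> {a..b}" if "k < N" for k
    using pos[of "Suc k"] ge[of k] that by auto
  have "\<exists>x\<in>?c k. \<forall>y\<in>?c k. S y \<le> S x" if "k < N" for k
    by (rule continuous_attains_sup) (use h sub[OF that] continuous_on_subset[OF assms(1)] in \<open>auto simp: mult_right_mono\<close>)
  then obtain \<tau> where \<tau>: "\<And>k. k < N \<Longrightarrow> \<tau> k \<in> ?c k" "\<And>k y. k < N \<Longrightarrow> y \<in> ?c k \<Longrightarrow> S y \<le> S (\<tau> k)" by metis
  have int: "S integrable_on {a..b}" using assms(1) by (rule integrable_continuous_interval)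
  have "integral {a..a + real n * h} S \<le> h * (\<Sum>k<n. S (\<tau> k))" if "n \<le> N" for n
    using that
  proof (induction n)
    case (Suc n)
    let ?m = "a + real n * h" and ?r = "a + real (Suc n) * h"
    have mr: "?m \<le> ?r" "?r - ?m = h" using h by (auto simp: algebra_simps)
    have int': "S integrable_on {a..?r}"
      by (rule integrable_on_subinterval[OF int]) (use pos[OF Suc.prems] in auto)
    have "integral {a..?r} S = integral {a..?m} S + integral {?m..?r} S"
      by (rule Henstock_Kurzweil_Integration.integral_combine[symmetric]) (use int' mr ge in auto)
    moreover have "integral {?m..?r} S \<le> integral {?m..?r} (\<lambda>_. S (\<tau> n))"
      by (rule integral_le) (use Suc.prems \<tau>(2)[of n] integrable_on_subinterval[OF int sub[of n]] in auto)
    moreover have "integral {?m..?r} (\<lambda>_. S (\<tau> n)) = h * S (\<tau> n)" using mr by simp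
    ultimately have "integral {a..?r} S \<le> h * (\<Sum>k<n. S (\<tau> k)) + h * S (\<tau> n)"
      using Suc.IH Suc.prems by linarith
    then show ?case by (simp only: sum.lessThan_Suc distrib_left)
  qed simp
  from this[of N] have "integral {a..b} S \<le> h * (\<Sum>k<N. S (\<tau> k))" by (simp add: h)
  then show ?thesis using that \<tau>(1) sub by blast
qed

definition freq_cut :: "plane set \<Rightarrow> (plane \<Rightarrow> complex) \<Rightarrow> plane \<Rightarrow> complex" where
  "freq_cut E f \<zeta> = of_real (indicator E \<zeta>) * f \<zeta>"

lemma freq_cut_measurable [measurable]:
  assumes [measurable]: "E \<in> sets borel" "f \<in> borel_measurable borel"
  shows "freq_cut E f \<in> borel_measurable borel"
  unfolding freq_cut_def[abs_def] by measurable

lemma norm_freq_cut_le: "norm (freq_cut E f \<zeta>) \<le> norm (f \<zeta>)"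
  by (simp add: freq_cut_def indicator_def)

lemma freq_cut_L2: "E \<in> sets borel \<Longrightarrow> f \<in> L2 \<Longrightarrow> freq_cut E f \<in> L2"
  and l2_freq_cut_le: "E \<in> sets borel \<Longrightarrow> f \<in> L2 \<Longrightarrow> l2 (freq_cut E f) \<le> l2 f"
  using L2_mono[of f "freq_cut E f"] norm_freq_cut_le L2_measurable by auto

context dispersive_flow
begin

lemma l2_freq_cut_continuous:
  assumes "E \<in> sets borel" "\<And>t. t \<in> {0..T} \<Longrightarrow> V t \<in> L2" 
    "\<And>t. t \<in> {0..T} \<Longrightarrow> ((\<lambda>\<tau>. l2 (\<lambda>\<zeta>. V \<tau> \<zeta> - V t \<zeta>)) \<longlongrightarrow> 0) (at t within {0..T})"
  shows "continuous_on {0..T} (\<lambda>t. l2 (freq_cut E (V t)))"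
proof (rule continuous_on_by_modulus[OF assms(3)])
  fix t \<tau> assume t: "t \<in> {0..T}" "\<tau> \<in> {0..T}"
  have "\<bar>l2 (freq_cut E (V \<tau>)) - l2 (freq_cut E (V t))\<bar> \<le> l2 (\<lambda>\<zeta>. freq_cut E (V \<tau>) \<zeta> - freq_cut E (V t) \<zeta>)"
    by (intro l2_abs_diff_le freq_cut_L2 assms t)
  also have "\<dots> = l2 (freq_cut E (\<lambda>\<zeta>. V \<tau> \<zeta> - V t \<zeta>))" by (simp add: freq_cut_def[abs_def] right_diff_distrib)
  also have "\<dots> \<le> l2 (\<lambda>\<zeta>. V \<tau> \<zeta> - V t \<zeta>)" by (intro l2_freq_cut_le L2_diff assms t)
  finally show "\<bar>l2 (freq_cut E (V \<tau>)) - l2 (freq_cut E (V t))\<bar> \<le> l2 (\<lambda>\<zeta>. V \<tau> \<zeta> - V t \<zeta>)" .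
qed

lemma norm_pairing_le:
  assumes "t \<in> {0..T}" "E \<in> sets borel" "V t \<in> L2" "\<Psi> \<in> L2" "\<And>\<zeta>. \<zeta> \<notin> E \<Longrightarrow> \<Psi> \<zeta> = 0"
  shows "norm (pairing V t \<Psi>) \<le> l2 (freq_cut E (V t)) * l2 \<Psi>"
proof -
  have eq: "(cis (t * dispersion \<alpha> \<zeta>) * V t \<zeta>) * \<Psi> \<zeta> = (cis (t * dispersion \<alpha> \<zeta>) * freq_cut E (V t) \<zeta>) * \<Psi> \<zeta>" for \<zeta>
    using assms(5) by (cases "\<zeta> \<in> E") (auto simp: freq_cut_def)
  have cL: "(\<lambda>\<zeta>. cis (t * dispersion \<alpha> \<zeta>) * freq_cut E (V t) \<zeta>) \<in> L2"
    by (intro cis_mult_L2 freq_cut_L2 assms) measurable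
  have "norm (pairing V t \<Psi>) \<le> l2 (\<lambda>\<zeta>. cis (t * dispersion \<alpha> \<zeta>) * freq_cut E (V t) \<zeta>) * l2 \<Psi>"
    unfolding pairing_def eq by (rule Cauchy_Schwarz_l2_integral[OF cL assms(4)])
  also have "l2 (\<lambda>\<zeta>. cis (t * dispersion \<alpha> \<zeta>) * freq_cut E (V t) \<zeta>) = l2 (freq_cut E (V t))"
    by (simp add: l2_def)
  finally show ?thesis .
qed

lemma pairing_sum:
  assumes "V t \<in> L2" "\<And>k. k \<in> K \<Longrightarrow> \<Psi> k \<in> L2"
  shows "pairing V t (\<lambda>\<zeta>. \<Sum>k\<in>K. c k * \<Psi> k \<zeta>) = (\<Sum>k\<in>K. c k * pairing V t (\<Psi> k))"
proof -
  have i: "integrable lborel (\<lambda>\<zeta>. (cis (t * dispersion \<alpha> \<zeta>) * V t \<zeta>) * \<Psi> k \<zeta>)" if "k \<in> K" for k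
    by (intro L2_mult_integrable cis_mult_L2 assms that) measurable
  have eq: "(cis (t * dispersion \<alpha> \<zeta>) * V t \<zeta>) * (\<Sum>k\<in>K. c k * \<Psi> k \<zeta>) = 
      (\<Sum>k\<in>K. c k * ((cis (t * dispersion \<alpha> \<zeta>) * V t \<zeta>) * \<Psi> k \<zeta>))" for \<zeta>
    by (simp add: sum_distrib_left mult_ac)
  show ?thesis unfolding pairing_def eq
    using i by (simp add: Bochner_Integration.integral_sum)
qed

text \<open>By Duhamel the values at the points \<open>\<tau> k\<close> are pairings with the data at \<open>a\<close> and with the force,
  so the left-hand side is controlled by the \<open>l2\<close>-norm of sums of plane waves.\<close>

lemma sum_wave_values_le:
  assumes E: "E \<in> sets borel" "emeasure lborel E < \<infinity>" and \<Omega>: "\<And>\<zeta>. \<zeta> \<in> E \<Longrightarrow> \<bar>dispersion \<alpha> \<zeta>\<bar> \<le> \<Omega>"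
    and ab: "0 \<le> a" "a \<le> b" "b \<le> T"
    and M: "M \<in> borel_measurable borel" "\<And>\<zeta>. \<zeta> \<in> E \<Longrightarrow> norm (M \<zeta>) \<le> \<Lambda>" "0 \<le> \<Lambda>"
    and \<tau>: "\<And>k. k < N \<Longrightarrow> \<tau> k \<in> {a..b}"
    and B: "\<And>c :: nat \<Rightarrow> complex. (\<And>k. norm (c k) \<le> 1) \<Longrightarrow> 
       l2 (\<lambda>\<zeta>. of_real (indicator E \<zeta>) * (\<Sum>k<N. c k * cis (z k \<bullet> \<zeta> - \<tau> k * dispersion \<alpha> \<zeta>))) \<le> B"
  shows "(\<Sum>k<N. norm (fourier_integral (\<lambda>\<zeta>. M \<zeta> * freq_cut E (W (\<tau> k)) \<zeta>) (- z k)))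
     \<le> \<Lambda> * B * (l2 (freq_cut E (W a)) + integral {a..b} (\<lambda>s. l2 (freq_cut E (G s))))"
proof -
  let ?\<omega> = "dispersion \<alpha>"
  have [measurable]: "E \<in> sets borel" "M \<in> borel_measurable borel" by fact+
  \<comment> \<open>The test function whose pairing with \<open>W\<close> at time
    \<open>\<tau> k\<close> is, up to 1 / (2 pi), the value at \<open>z k\<close>: its
    time-dependent phase undoes the transport built into \<open>pairing\<close>.\<close>
  define \<Psi> where "\<Psi> k \<zeta> = of_real (indicator E \<zeta>) * (M \<zeta> * cis (z k \<bullet> \<zeta> - \<tau> k * ?\<omega> \<zeta>))" for k \<zeta>
  have \<Psi>m [measurable]: "\<Psi> k \<in> borel_measurable borel" for k unfolding \<Psi>_def[abs_def] by measurable
  have \<Psi>le: "norm (\<Psi> k \<zeta>) \<le> \<Lambda> * indicator E \<zeta>" for k \<zeta>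
    using M(2)[of \<zeta>] by (auto simp: \<Psi>_def indicator_def norm_mult)
  have "0 \<le> \<Omega>" if "E \<noteq> {}" using \<Omega> that by force
  then have mult_le: "norm (of_real (m \<zeta>) * \<Psi> k \<zeta>) \<le> (C * \<Lambda>) * indicator E \<zeta>" 
    if "\<And>\<zeta>. \<zeta> \<in> E \<Longrightarrow> \<bar>m \<zeta>\<bar> \<le> C" for m C k \<zeta>
    using \<Psi>le[of k \<zeta>] that[of \<zeta>] M(3) by (cases "\<zeta> \<in> E") (auto simp: norm_mult intro!: mult_mono)
  have \<Psi>0: "\<Psi> k \<in> L2" for k by (rule L2_bounded_support[OF E \<Psi>m \<Psi>le])
  have \<Psi>1: "(\<lambda>\<zeta>. of_real (?\<omega> \<zeta>) * \<Psi> k \<zeta>) \<in> L2" for k 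
    by (rule L2_bounded_support[OF E _ mult_le[OF \<Omega>]]) measurable
  have \<omega>2: "\<bar>(?\<omega> \<zeta>)\<^sup>2\<bar> \<le> \<Omega>\<^sup>2" if "\<zeta> \<in> E" for \<zeta>
    using power_mono[OF \<Omega>[OF that], of 2] by simp
  have \<Psi>2: "(\<lambda>\<zeta>. of_real ((?\<omega> \<zeta>)\<^sup>2) * \<Psi> k \<zeta>) \<in> L2" for k
    by (rule L2_bounded_support[OF E _ mult_le[OF \<omega>2]]) measurable
  let ?u = "\<lambda>k. fourier_integral (\<lambda>\<zeta>. M \<zeta> * freq_cut E (W (\<tau> k)) \<zeta>) (- z k)"
  have u: "?u k = of_real (1 / (2 * pi)) * pairing W (\<tau> k) (\<Psi> k)" for k
  proof -
    have "cis (- (\<zeta> \<bullet> - z k)) * (M \<zeta> * freq_cut E (W (\<tau> k)) \<zeta>) = (cis (\<tau> k * ?\<omega> \<zeta>) * W (\<tau> k) \<zeta>) * \<Psi> k \<zeta>" for \<zeta>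
    proof -
      have "cis (- (\<zeta> \<bullet> - z k)) = cis (\<tau> k * ?\<omega> \<zeta>) * cis (z k \<bullet> \<zeta> - \<tau> k * ?\<omega> \<zeta>)"
        by (simp add: cis_mult inner_commute)
      then show ?thesis unfolding freq_cut_def \<Psi>_def by (simp only: mult_ac)
    qed
    then show ?thesis unfolding fourier_integral_def pairing_def by simp
  qed
  have u_le: "norm (?u k) \<le> norm (pairing W (\<tau> k) (\<Psi> k))" for k
    unfolding u norm_mult norm_of_real using pi_ge_two
    by (intro mult_left_le_one_le) auto
  \<comment> \<open>Phases that turn the sum of moduli into a linear expression. \<open>sgn\<close>
    vanishes at 0, so these coefficients have modulus at most 1 in every case.\<close>
  define c where "c k = cnj (sgn (pairing W (\<tau> k) (\<Psi> k)))" for k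
  have c1: "norm (c k) \<le> 1" for k by (simp add: c_def norm_sgn)
  have cn: "c k * pairing W (\<tau> k) (\<Psi> k) = of_real (norm (pairing W (\<tau> k) (\<Psi> k)))" for k
  proof -
    let ?p = "pairing W (\<tau> k) (\<Psi> k)"
    have "cnj (sgn ?p) * ?p = (?p * cnj ?p) / of_real (norm ?p)" by (simp add: sgn_eq)
    also have "\<dots> = of_real ((norm ?p)\<^sup>2) / of_real (norm ?p)" by (simp only: complex_norm_square)
    finally show ?thesis unfolding c_def by (simp add: power2_eq_square)
  qed
  have sum_le: "norm (pairing V s (\<lambda>\<zeta>. \<Sum>k<N. d k * \<Psi> k \<zeta>)) \<le> \<Lambda> * B * l2 (freq_cut E (V s))"
    if V: "V s \<in> L2" and s: "s \<in> {0..T}" and d: "\<And>k. norm (d k) \<le> 1" for V s and d :: "nat \<Rightarrow> complex"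
  proof -
    let ?P = "\<lambda>\<zeta>. of_real (indicator E \<zeta>) * (\<Sum>k<N. d k * cis (z k \<bullet> \<zeta> - \<tau> k * ?\<omega> \<zeta>))"
    have eq: "(\<Sum>k<N. d k * \<Psi> k \<zeta>) = M \<zeta> * ?P \<zeta>" for \<zeta>
      by (simp add: \<Psi>_def sum_distrib_left mult_ac)
    have Pm: "?P \<in> borel_measurable borel" by measurable
    have Ple: "norm (?P \<zeta>) \<le> real N * indicator E \<zeta>" for \<zeta>
    proof -
      have "norm (\<Sum>k<N. d k * cis (z k \<bullet> \<zeta> - \<tau> k * ?\<omega> \<zeta>)) \<le> (\<Sum>k<N. 1)"
        by (intro sum_norm_le) (simp add: norm_mult d)
      then show ?thesis by (auto simp: norm_mult indicator_def)
    qed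
    have PL: "?P \<in> L2" by (rule L2_bounded_support[OF E Pm Ple])
    have MP: "norm (M \<zeta> * ?P \<zeta>) \<le> \<Lambda> * norm (?P \<zeta>)" for \<zeta>
      using M(2)[of \<zeta>] by (cases "\<zeta> \<in> E") (auto simp: norm_mult intro!: mult_right_mono)
    have MPm: "(\<lambda>\<zeta>. M \<zeta> * ?P \<zeta>) \<in> borel_measurable borel" by measurable
    have SL: "(\<lambda>\<zeta>. \<Sum>k<N. d k * \<Psi> k \<zeta>) \<in> L2" and Sle: "l2 (\<lambda>\<zeta>. \<Sum>k<N. d k * \<Psi> k \<zeta>) \<le> \<Lambda> * l2 ?P"
      unfolding eq using L2_dominated[OF PL MPm MP] M(3) by auto
    have "norm (pairing V s (\<lambda>\<zeta>. \<Sum>k<N. d k * \<Psi> k \<zeta>)) \<le> l2 (freq_cut E (V s)) * l2 (\<lambda>\<zeta>. \<Sum>k<N. d k * \<Psi> k \<zeta>)"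
      by (rule norm_pairing_le[where V=V and t=s, OF s E(1) V SL]) (simp add: \<Psi>_def)
    also have "\<dots> \<le> l2 (freq_cut E (V s)) * (\<Lambda> * B)"
      using Sle mult_left_mono[OF B[of d, OF d] M(3)] by (intro mult_left_mono) auto
    finally show ?thesis by (simp add: mult.commute)
  qed
  \<comment> \<open>The condition s \<le> \<tau> of Duhamel's formula is put into the coefficients.
    They remain bounded by 1, so at every s the retarded term obeys the same bound as the
    data.\<close>
  define q where "q s = pairing G s (\<lambda>\<zeta>. \<Sum>k<N. (if s \<le> \<tau> k then c k else 0) * \<Psi> k \<zeta>)" for s
  have q_eq: "q s = (\<Sum>k<N. c k * (if s \<in> {a..\<tau> k} then pairing G s (\<Psi> k) else 0))" if "s \<in> {a..b}" for s
    unfolding q_def using that ab \<Psi>0 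
    by (subst pairing_sum[OF G]) (auto intro!: sum.cong)
  have "((\<lambda>s. if s \<in> {a..\<tau> k} then pairing G s (\<Psi> k) else 0) has_integral 
      (pairing W (\<tau> k) (\<Psi> k) - pairing W a (\<Psi> k))) {a..b}" if "k < N" for k
    using pairing_duhamel[OF ab(1) _ _ \<Psi>0 \<Psi>1 \<Psi>2, of "\<tau> k" k] \<tau>[OF that] ab
    by (subst has_integral_restrict) auto
  then have "((\<lambda>s. \<Sum>k<N. c k * (if s \<in> {a..\<tau> k} then pairing G s (\<Psi> k) else 0)) has_integral 
      (\<Sum>k<N. c k * (pairing W (\<tau> k) (\<Psi> k) - pairing W a (\<Psi> k)))) {a..b}"
    by (intro has_integral_sum has_integral_mult_right) auto
  then have qi: "(q has_integral (\<Sum>k<N. c k * (pairing W (\<tau> k) (\<Psi> k) - pairing W a (\<Psi> k)))) {a..b}"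
    by (rule has_integral_eq[rotated]) (simp add: q_eq)
  have "complex_of_real (\<Sum>k<N. norm (pairing W (\<tau> k) (\<Psi> k))) = (\<Sum>k<N. c k * pairing W (\<tau> k) (\<Psi> k))"
    by (simp add: cn)
  also have "\<dots> = pairing W a (\<lambda>\<zeta>. \<Sum>k<N. c k * \<Psi> k \<zeta>) + integral {a..b} q"
    using integral_unique[OF qi] pairing_sum[where V=W and t=a and K="{..<N}" and \<Psi>=\<Psi> and c=c] W[of a] ab \<Psi>0
    by (simp add: right_diff_distrib sum_subtractf)
  finally have "norm (complex_of_real (\<Sum>k<N. norm (pairing W (\<tau> k) (\<Psi> k)))) = norm (pairing W a (\<lambda>\<zeta>. \<Sum>k<N. c k * \<Psi> k \<zeta>) + integral {a..b} q)"
    by (rule arg_cong)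
  then have eq: "(\<Sum>k<N. norm (pairing W (\<tau> k) (\<Psi> k))) = norm (pairing W a (\<lambda>\<zeta>. \<Sum>k<N. c k * \<Psi> k \<zeta>) + integral {a..b} q)"
    by (simp only: norm_of_real abs_of_nonneg sum_nonneg norm_ge_zero)
  have contG: "continuous_on {a..b} (\<lambda>s. l2 (freq_cut E (G s)))"
    by (rule continuous_on_subset[OF l2_freq_cut_continuous[OF E(1) G G_cont]]) (use ab in auto)
  have "norm (integral {a..b} q) \<le> integral {a..b} (\<lambda>s. \<Lambda> * B * l2 (freq_cut E (G s)))"
  proof (rule Henstock_Kurzweil_Integration.integral_norm_bound_integral)
    show "q integrable_on {a..b}" using qi by blast
    show "(\<lambda>s. \<Lambda> * B * l2 (freq_cut E (G s))) integrable_on {a..b}"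
      by (intro integrable_continuous_interval continuous_intros contG)
    show "norm (q s) \<le> \<Lambda> * B * l2 (freq_cut E (G s))" if "s \<in> {a..b}" for s
      unfolding q_def using that ab c1 by (intro sum_le G) auto
  qed
  moreover have "norm (pairing W a (\<lambda>\<zeta>. \<Sum>k<N. c k * \<Psi> k \<zeta>)) \<le> \<Lambda> * B * l2 (freq_cut E (W a))"
    using ab by (intro sum_le W c1) auto
  ultimately have "(\<Sum>k<N. norm (pairing W (\<tau> k) (\<Psi> k))) \<le> \<Lambda> * B * l2 (freq_cut E (W a)) + \<Lambda> * B * integral {a..b} (\<lambda>s. l2 (freq_cut E (G s)))"
    unfolding eq by (intro norm_triangle_le) simp
  then show ?thesis
    using sum_mono[of "{..<N}" "\<lambda>k. norm (?u k)", OF u_le] by (simp add: distrib_left)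
qed

text \<open>The discrete estimate is applied to N cells and N tends to infinity. Under the root the
  near-diagonal part of the row sums contributes only a multiple of L^2 / N, while the remaining
  part is the same multiple of L^(1 + \<theta>) for every N.\<close>

lemma strichartz_interval:
  assumes E: "E \<in> sets borel" "emeasure lborel E < \<infinity>" and \<Omega>: "\<And>\<zeta>. \<zeta> \<in> E \<Longrightarrow> \<bar>dispersion \<alpha> \<zeta>\<bar> \<le> \<Omega>"
    and A: "\<And>t z. norm (osc_kernel \<alpha> E t z) \<le> A" 
    and D: "\<And>t z. t \<noteq> 0 \<Longrightarrow> norm (osc_kernel \<alpha> E t z) \<le> D * \<bar>t\<bar> powr (\<theta> - 1)" "0 \<le> D"
    and \<theta>: "0 < \<theta>" "\<theta> < 1"
    and ab: "0 \<le> a" "a < b" "b \<le> T"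
    and M: "M \<in> borel_measurable borel" "\<And>\<zeta>. \<zeta> \<in> E \<Longrightarrow> norm (M \<zeta>) \<le> \<Lambda>" "0 \<le> \<Lambda>"
    and S: "continuous_on {a..b} S"
    and Su: "\<And>t e. t \<in> {a..b} \<Longrightarrow> 0 < e \<Longrightarrow> \<exists>z. S t \<le> norm (fourier_integral (\<lambda>\<zeta>. M \<zeta> * freq_cut E (W t) \<zeta>) (- z)) + e"
  shows "integral {a..b} S \<le> \<Lambda> * sqrt (2 * D / \<theta> * (b - a) powr (1 + \<theta>)) *
      (l2 (freq_cut E (W a)) + integral {a..b} (\<lambda>s. l2 (freq_cut E (G s))))"
proof -
  define X where "X = l2 (freq_cut E (W a)) + integral {a..b} (\<lambda>s. l2 (freq_cut E (G s)))"
  define L where "L = b - a"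
  have L: "0 < L" using ab by (simp add: L_def)
  have step: "integral {a..b} S \<le> \<Lambda> * sqrt (3 * A * L\<^sup>2 / real N + 2 * D / \<theta> * L powr (1 + \<theta>)) * X + L / real N"
    if N: "0 < N" for N
  proof -
    define h where "h = L / real N"
    have h: "0 < h" "real N * h = L" using L N by (auto simp: h_def)
    obtain \<tau> where \<tau>: "\<And>k. k < N \<Longrightarrow> \<tau> k \<in> {a + real k * h..a + real (Suc k) * h}"
      "\<And>k. k < N \<Longrightarrow> \<tau> k \<in> {a..b}" and le: "integral {a..b} S \<le> h * (\<Sum>k<N. S (\<tau> k))"
      using integral_le_cell_sum[OF S ab(2) N] unfolding h_def L_def by blast
    \<comment> \<open>Near-maximizers with slack 1 / N: the N slacks add up to 1, which the factor h
      sends to 0.\<close>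
    have "\<exists>z. S (\<tau> k) \<le> norm (fourier_integral (\<lambda>\<zeta>. M \<zeta> * freq_cut E (W (\<tau> k)) \<zeta>) (- z)) + 1 / real N" if "k < N" for k
      using Su[OF \<tau>(2)[OF that]] N by simp
    then obtain z where z: "\<And>k. k < N \<Longrightarrow> S (\<tau> k) \<le> norm (fourier_integral (\<lambda>\<zeta>. M \<zeta> * freq_cut E (W (\<tau> k)) \<zeta>) (- z k)) + 1 / real N"
      by metis
    define B where "B = sqrt (real N * (3 * A + 2 * D * h powr (\<theta> - 1) * (real N powr \<theta> / \<theta>)))"
    have "(\<Sum>k<N. norm (fourier_integral (\<lambda>\<zeta>. M \<zeta> * freq_cut E (W (\<tau> k)) \<zeta>) (- z k))) \<le> \<Lambda> * B * X"
      unfolding X_def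
    proof (rule sum_wave_values_le[OF E \<Omega> ab(1) less_imp_le[OF ab(2)] ab(3) M \<tau>(2)])
      fix c :: "nat \<Rightarrow> complex" assume c: "\<And>k. norm (c k) \<le> 1"
      show "l2 (\<lambda>\<zeta>. of_real (indicator E \<zeta>) * (\<Sum>k<N. c k * cis (z k \<bullet> \<zeta> - \<tau> k * dispersion \<alpha> \<zeta>))) \<le> B"
        unfolding B_def by (rule real_le_rsqrt, rule l2_sum_waves_le[OF E A D \<theta> h(1) \<tau>(1) c])
    qed
    moreover have "(\<Sum>k<N. S (\<tau> k)) \<le> (\<Sum>k<N. norm (fourier_integral (\<lambda>\<zeta>. M \<zeta> * freq_cut E (W (\<tau> k)) \<zeta>) (- z k)) + 1 / real N)"
      by (intro sum_mono z) simp
    ultimately have "(\<Sum>k<N. S (\<tau> k)) \<le> \<Lambda> * B * X + 1"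
      using N by (simp add: sum.distrib)
    then have "integral {a..b} S \<le> h * (\<Lambda> * B * X + 1)"
      using order_trans[OF le mult_left_mono[of "\<Sum>k<N. S (\<tau> k)" "\<Lambda> * B * X + 1" h]] h(1) by simp
    also have "\<dots> = \<Lambda> * (h * B) * X + L / real N" by (simp add: algebra_simps h_def)
    \<comment> \<open>In the second summand all powers of N combine with those of h into a power of
      h * N = L.\<close>
    also have "h * B = sqrt (3 * A * L\<^sup>2 / real N + 2 * D / \<theta> * L powr (1 + \<theta>))"
    proof -
      have e1: "h\<^sup>2 * real N * (3 * A) = 3 * A * L\<^sup>2 / real N"
        using N by (simp add: h_def power2_eq_square)
      have p1: "real N powr (1 + \<theta>) = real N * real N powr \<theta>" using N by (simp add: powr_add)
      have p2: "h powr (1 + \<theta>) = h * h * h powr (\<theta> - 1)" using h(1) by (simp add: powr_add powr_diff)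
      have "L powr (1 + \<theta>) = (real N * h) powr (1 + \<theta>)" by (simp only: h(2))
      also have "\<dots> = (real N * real N powr \<theta>) * (h * h * h powr (\<theta> - 1))"
        by (simp only: powr_mult p1 p2)
      finally have e2: "h\<^sup>2 * real N * (2 * D * h powr (\<theta> - 1) * (real N powr \<theta> / \<theta>)) = 2 * D / \<theta> * L powr (1 + \<theta>)"
        by (simp add: power2_eq_square mult_ac)
      have "h * B = sqrt (h\<^sup>2) * B" using h by simp
      also have "\<dots> = sqrt (h\<^sup>2 * (real N * (3 * A + 2 * D * h powr (\<theta> - 1) * (real N powr \<theta> / \<theta>))))"
        unfolding B_def by (rule real_sqrt_mult[symmetric])
      also have "h\<^sup>2 * (real N * (3 * A + 2 * D * h powr (\<theta> - 1) * (real N powr \<theta> / \<theta>))) = 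
          h\<^sup>2 * real N * (3 * A) + h\<^sup>2 * real N * (2 * D * h powr (\<theta> - 1) * (real N powr \<theta> / \<theta>))"
        by (simp only: distrib_left mult.assoc)
      finally show ?thesis unfolding e1 e2 .
    qed
    finally show ?thesis .
  qed
  have "(\<lambda>n. \<Lambda> * sqrt (3 * A * L\<^sup>2 / real (Suc n) + 2 * D / \<theta> * L powr (1 + \<theta>)) * X + L / real (Suc n))
     \<longlonglongrightarrow> \<Lambda> * sqrt (0 + 2 * D / \<theta> * L powr (1 + \<theta>)) * X + 0"
    by (intro tendsto_intros LIMSEQ_Suc[OF lim_const_over_n])
  from LIMSEQ_le_const[OF this, of "integral {a..b} S"] show ?thesis
    using step[OF zero_less_Suc] by (auto simp: X_def L_def)
qed

end

section \<open>Summation over intervals and shells\<close>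

text \<open>The supremum norm of the function with transform \<open>m * V\<close>. The frequency cut
  will sit in \<open>m\<close>, which puts \<open>m\<close> into \<open>L2\<close>; by
  Cauchy-Schwarz the supremum is then finite and continuous along continuous \<open>L2\<close>
  curves.\<close>

definition wave_sup :: "(plane \<Rightarrow> complex) \<Rightarrow> (plane \<Rightarrow> complex) \<Rightarrow> real" where
  "wave_sup m V = (SUP z. norm (fourier_integral (\<lambda>\<zeta>. m \<zeta> * V \<zeta>) (- z)))"

lemma norm_fourier_integral_mult_le:
  assumes "m \<in> L2" "V \<in> L2"
  shows "norm (fourier_integral (\<lambda>\<zeta>. m \<zeta> * V \<zeta>) z) \<le> l2 m * l2 V"
proof -
  have "norm (fourier_integral (\<lambda>\<zeta>. m \<zeta> * V \<zeta>) z) \<le> 1 / (2 * pi) * (LINT \<zeta>|lborel. norm (m \<zeta>) * norm (V \<zeta>))"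
    using norm_fourier_integral_le[of "\<lambda>\<zeta>. m \<zeta> * V \<zeta>"] by (simp only: norm_mult)
  also have "\<dots> \<le> 1 * (l2 m * l2 V)"
    using pi_ge_two by (intro mult_mono Cauchy_Schwarz_l2 assms) auto
  finally show ?thesis by simp
qed

lemma wave_sup_upper:
  assumes "m \<in> L2" "V \<in> L2"
  shows "norm (fourier_integral (\<lambda>\<zeta>. m \<zeta> * V \<zeta>) (- z)) \<le> wave_sup m V"
  unfolding wave_sup_def
  by (rule cSUP_upper) (auto intro!: bdd_aboveI2 norm_fourier_integral_mult_le assms)

lemma wave_sup_nonneg: "m \<in> L2 \<Longrightarrow> V \<in> L2 \<Longrightarrow> 0 \<le> wave_sup m V"
  using wave_sup_upper[of m V 0] norm_ge_zero order_trans by blast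

lemma wave_sup_attained:
  assumes "0 < e" shows "\<exists>z. wave_sup m V \<le> norm (fourier_integral (\<lambda>\<zeta>. m \<zeta> * V \<zeta>) (- z)) + e"
proof (rule ccontr)
  assume *: "\<nexists>z. wave_sup m V \<le> norm (fourier_integral (\<lambda>\<zeta>. m \<zeta> * V \<zeta>) (- z)) + e"
  have "(SUP z. norm (fourier_integral (\<lambda>\<zeta>. m \<zeta> * V \<zeta>) (- z))) \<le> wave_sup m V - e"
  proof (rule cSUP_least)
    fix z
    have "norm (fourier_integral (\<lambda>\<zeta>. m \<zeta> * V \<zeta>) (- z)) + e < wave_sup m V"
      using * not_le by blast
    then show "norm (fourier_integral (\<lambda>\<zeta>. m \<zeta> * V \<zeta>) (- z)) \<le> wave_sup m V - e" by linarith
  qed simp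
  then have "wave_sup m V \<le> wave_sup m V - e" by (simp only: wave_sup_def)
  then show False using assms by simp
qed

lemma wave_sup_diff_le:
  assumes "m \<in> L2" "V \<in> L2" "V' \<in> L2"
  shows "wave_sup m V \<le> wave_sup m V' + l2 m * l2 (\<lambda>\<zeta>. V \<zeta> - V' \<zeta>)"
  unfolding wave_sup_def[of m V]
proof (rule cSUP_least)
  fix z
  have "fourier_integral (\<lambda>\<zeta>. m \<zeta> * V \<zeta>) (- z) = fourier_integral (\<lambda>\<zeta>. m \<zeta> * V' \<zeta>) (- z) + fourier_integral (\<lambda>\<zeta>. m \<zeta> * (V \<zeta> - V' \<zeta>)) (- z)"
    by (subst fourier_integral_add[symmetric]) (auto intro!: L2_mult_integrable L2_diff assms simp: algebra_simps)
  then show "norm (fourier_integral (\<lambda>\<zeta>. m \<zeta> * V \<zeta>) (- z)) \<le> wave_sup m V' + l2 m * l2 (\<lambda>\<zeta>. V \<zeta> - V' \<zeta>)"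
    using norm_triangle_mono[OF wave_sup_upper[OF assms(1,3)] norm_fourier_integral_mult_le[OF assms(1) L2_diff[OF assms(2,3)]]] by simp
qed simp

lemma wave_sup_continuous:
  assumes "m \<in> L2" "\<And>t. t \<in> {0..T} \<Longrightarrow> V t \<in> L2"
    "\<And>t. t \<in> {0..T} \<Longrightarrow> ((\<lambda>\<tau>. l2 (\<lambda>\<zeta>. V \<tau> \<zeta> - V t \<zeta>)) \<longlongrightarrow> 0) (at t within {0..T})"
  shows "continuous_on {0..T} (\<lambda>t. wave_sup m (V t))"
proof (rule continuous_on_by_modulus)
  show "((\<lambda>\<tau>. l2 m * l2 (\<lambda>\<zeta>. V \<tau> \<zeta> - V t \<zeta>)) \<longlongrightarrow> 0) (at t within {0..T})" if "t \<in> {0..T}" for t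
    using tendsto_mult_left[OF assms(3)[OF that], of "l2 m"] by simp
  show "\<bar>wave_sup m (V \<tau>) - wave_sup m (V t)\<bar> \<le> l2 m * l2 (\<lambda>\<zeta>. V \<tau> \<zeta> - V t \<zeta>)" if "t \<in> {0..T}" "\<tau> \<in> {0..T}" for t \<tau>
    using wave_sup_diff_le[OF assms(1) assms(2)[OF that(2)] assms(2)[OF that(1)]]
      wave_sup_diff_le[OF assms(1) assms(2)[OF that(1)] assms(2)[OF that(2)]] l2_minus_commute[of "V t" "V \<tau>"] by simp
qed

lemma emeasure_shell_finite: "emeasure lborel (shell j) < \<infinity>"
  using le_less_trans[OF emeasure_shell_le] by simp

lemma dispersion_shell_le:
  assumes "0 < \<alpha>" "\<zeta> \<in> shell j"
  shows "\<bar>dispersion \<alpha> \<zeta>\<bar> \<le> 2 ^ j * (2 ^ j) powr \<alpha> + (2 ^ j)\<^sup>2"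
proof -
  have \<zeta>: "\<bar>fst \<zeta>\<bar> \<le> 2 ^ j" "\<bar>snd \<zeta>\<bar> \<le> 2 ^ j"
    using shell_subset[of j] assms(2) by (auto simp: square_def abs_le_iff mem_Times_iff)
  have "\<bar>fst \<zeta> * \<bar>fst \<zeta>\<bar> powr \<alpha>\<bar> \<le> 2 ^ j * (2 ^ j) powr \<alpha>"
    unfolding abs_mult using \<zeta> assms(1) by (intro mult_mono) (auto intro: powr_mono2)
  moreover have "\<bar>sgn (fst \<zeta>) * (snd \<zeta>)\<^sup>2\<bar> \<le> 1 * (2 ^ j)\<^sup>2"
    unfolding abs_mult using power_mono[OF \<zeta>(2), of 2] by (intro mult_mono) (auto simp: sgn_if)
  ultimately show ?thesis unfolding dispersion_def by linarith
qed

text \<open>Outside the square of half-width 2^(j - 1) one coordinate exceeds that number. Halving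
  2^j gives a lower bound that also covers j = 0, where the summand 1 of the weight is
  enough.\<close>

lemma shell_weight_ge:
  assumes "\<zeta> \<in> shell j" "0 \<le> s"
  shows "(2 ^ j / 2) powr s \<le> (1 + (norm \<zeta>)\<^sup>2) powr (s / 2)"
proof -
  have "(2 ^ j / 2)\<^sup>2 \<le> 1 + (norm \<zeta>)\<^sup>2"
  proof (cases "j = 0")
    case True then show ?thesis by (simp add: power_divide add_increasing2)
  next
    case False
    then have e: "2 ^ j / 2 = (2::real) ^ (j - 1)" by (cases j) auto
    have "\<zeta> \<notin> square (2 ^ (j - 1))" using assms(1) False by (auto simp: shell_def)
    then have "2 ^ (j - 1) \<le> \<bar>fst \<zeta>\<bar> \<or> 2 ^ (j - 1) \<le> \<bar>snd \<zeta>\<bar>" 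
      by (auto simp: square_def mem_Times_iff)
    then have "2 ^ (j - 1) \<le> norm \<zeta>" using abs_fst_le_norm[of \<zeta>] abs_snd_le_norm[of \<zeta>] by linarith
    then have "(2 ^ (j - 1))\<^sup>2 \<le> (norm \<zeta>)\<^sup>2" by (intro power_mono) auto
    then show ?thesis unfolding e by linarith
  qed
  then have "((2 ^ j / 2)\<^sup>2) powr (s / 2) \<le> (1 + (norm \<zeta>)\<^sup>2) powr (s / 2)"
    using assms(2) by (intro powr_mono2) auto
  moreover have "((2 ^ j / 2)\<^sup>2) powr (s / 2) = (2 ^ j / 2 :: real) powr s"
    by (simp add: powr_powr flip: powr_numeral)
  ultimately show ?thesis by simp
qed

lemma l2_freq_cut_shell_le:
  assumes "0 \<le> s" "bessel s V \<in> L2" "V \<in> borel_measurable borel"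
  shows "l2 (freq_cut (shell j) V) \<le> (2 ^ j / 2) powr (- s) * l2 (bessel s V)"
proof (rule L2_dominated(2)[OF assms(2)])
  show "freq_cut (shell j) V \<in> borel_measurable borel" using assms by simp
  show "norm (freq_cut (shell j) V \<zeta>) \<le> (2 ^ j / 2) powr (- s) * norm (bessel s V \<zeta>)" for \<zeta>
  proof (cases "\<zeta> \<in> shell j")
    case True
    have "1 = (2 ^ j / 2 :: real) powr (- s) * (2 ^ j / 2) powr s" by (simp add: powr_add[symmetric])
    also have "\<dots> \<le> (2 ^ j / 2) powr (- s) * (1 + (norm \<zeta>)\<^sup>2) powr (s / 2)"
      by (intro mult_left_mono shell_weight_ge True assms) auto
    finally show ?thesis using True mult_right_mono[of 1 _ "norm (V \<zeta>)"]
      by (simp add: freq_cut_def norm_bessel mult.assoc[symmetric])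
  qed (simp add: freq_cut_def)
qed simp

lemma integral_sum_cells:
  fixes S :: "real \<Rightarrow> real"
  assumes "S integrable_on {0..real N * h}" "0 \<le> h" "n \<le> N"
  shows "integral {0..real n * h} S = (\<Sum>i<n. integral {real i * h..real (Suc i) * h} S)"
  using assms(3)
proof (induction n)
  case (Suc n)
  have "integral {0..real n * h} S + integral {real n * h..real (Suc n) * h} S = integral {0..real (Suc n) * h} S"
  proof (rule Henstock_Kurzweil_Integration.integral_combine)
    have "real (Suc n) * h \<le> real N * h" using Suc.prems assms(2) by (intro mult_right_mono) auto
    then show "S integrable_on {0..real (Suc n) * h}"
      by (intro integrable_on_subinterval[OF assms(1)]) auto
  qed (use assms(2) in \<open>auto intro!: mult_right_mono\<close>)
  then show ?case using Suc by simp
qed simp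

text \<open>The factor of |t|^(\<theta> - 1) in \<open>osc_kernel_shell_le\<close>, kept folded
  until the powers of 2^j are counted.\<close>

definition shell_const :: "real \<Rightarrow> real \<Rightarrow> nat \<Rightarrow> real" where
  "shell_const \<alpha> \<theta> j = (4 * (2 ^ j)\<^sup>2) powr \<theta> * (256 / sqrt (2 * \<alpha> * (1 + \<alpha>)) * (2 ^ j) powr ((1 - \<alpha>) / 2)) powr (1 - \<theta>)"

lemma shell_const_nonneg: "0 \<le> shell_const \<alpha> \<theta> j"
  by (simp add: shell_const_def)

context dispersive_flow
begin

lemma wave_sup_shell_le:
  assumes \<alpha>: "0 < \<alpha>" "\<alpha> \<le> 1" and \<theta>: "0 < \<theta>" "\<theta> < 1" and T: "0 < T"
    and M: "M \<in> borel_measurable borel" "\<And>\<zeta>. \<zeta> \<in> shell j \<Longrightarrow> norm (M \<zeta>) \<le> 2 ^ j"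
  shows "integral {0..T} (\<lambda>t. wave_sup (freq_cut (shell j) M) (W t))
    \<le> 2 ^ j * sqrt (2 * shell_const \<alpha> \<theta> j / \<theta> * (T / 2 ^ j) powr (1 + \<theta>)) *
       ((\<Sum>i<2^j. l2 (freq_cut (shell j) (W (real i * (T / 2 ^ j))))) + integral {0..T} (\<lambda>s. l2 (freq_cut (shell j) (G s))))"
proof -
  let ?E = "shell j" and ?m = "freq_cut (shell j) M"
  define h where "h = T / 2 ^ j"
  have h: "0 < h" "real (2 ^ j) * h = T" using T by (auto simp: h_def)
  have mL: "?m \<in> L2"
  proof (rule L2_bounded_support[OF shell_measurable emeasure_shell_finite])
    show "?m \<in> borel_measurable borel" using M(1) by simp
    show "norm (?m \<zeta>) \<le> 2 ^ j * indicator (shell j) \<zeta>" for \<zeta>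
      using M(2)[of \<zeta>] by (auto simp: freq_cut_def indicator_def)
  qed
  have S: "continuous_on {0..T} (\<lambda>t. wave_sup ?m (W t))"
    by (rule wave_sup_continuous[OF mL W W_cont])
  have Gc: "continuous_on {0..T} (\<lambda>s. l2 (freq_cut ?E (G s)))"
    by (rule l2_freq_cut_continuous[OF shell_measurable G G_cont])
  \<comment> \<open>The cut may sit on either factor: \<open>wave_sup\<close> has it on the
    multiplier, the interval estimate on the solution.\<close>
  have eqm: "(\<lambda>\<zeta>. ?m \<zeta> * V \<zeta>) = (\<lambda>\<zeta>. M \<zeta> * freq_cut ?E V \<zeta>)" for V
    by (simp add: freq_cut_def mult_ac)
  let ?R = "2 ^ j * sqrt (2 * shell_const \<alpha> \<theta> j / \<theta> * h powr (1 + \<theta>))"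
  have cell: "integral {real i * h..real (Suc i) * h} (\<lambda>t. wave_sup ?m (W t)) \<le> 
      ?R * (l2 (freq_cut ?E (W (real i * h))) + integral {real i * h..real (Suc i) * h} (\<lambda>s. l2 (freq_cut ?E (G s))))"
    if i: "i < 2 ^ j" for i
  proof -
    let ?a = "real i * h" and ?b = "real (Suc i) * h"
    have ab: "0 \<le> ?a" "?a < ?b" "?b \<le> T"
    proof -
      have "real (Suc i) \<le> real (2 ^ j)" using i by (intro of_nat_mono) simp
      then have "?b \<le> real (2 ^ j) * h" using h by (intro mult_right_mono) auto
      then show "?b \<le> T" by (simp only: h)
    qed (use h in \<open>auto simp: distrib_right\<close>)
    have "integral {?a..?b} (\<lambda>t. wave_sup ?m (W t)) \<le> 
       2 ^ j * sqrt (2 * shell_const \<alpha> \<theta> j / \<theta> * (?b - ?a) powr (1 + \<theta>)) * (l2 (freq_cut ?E (W ?a)) + integral {?a..?b} (\<lambda>s. l2 (freq_cut ?E (G s))))"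
    proof (rule strichartz_interval[OF shell_measurable emeasure_shell_finite dispersion_shell_le[OF \<alpha>(1)] 
          osc_kernel_shell_le_measure _ shell_const_nonneg \<theta> ab M])
      show "norm (osc_kernel \<alpha> ?E t z) \<le> shell_const \<alpha> \<theta> j * \<bar>t\<bar> powr (\<theta> - 1)" if "t \<noteq> 0" for t z
        unfolding shell_const_def by (rule osc_kernel_shell_le[OF that \<alpha> \<theta>])
      show "continuous_on {?a..?b} (\<lambda>t. wave_sup ?m (W t))"
        by (rule continuous_on_subset[OF S]) (use ab in auto)
      show "\<exists>z. wave_sup ?m (W t) \<le> norm (fourier_integral (\<lambda>\<zeta>. M \<zeta> * freq_cut ?E (W t) \<zeta>) (- z)) + e" if "0 < e" for t e
        using wave_sup_attained[OF that, of ?m "W t"] by (simp only: eqm)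
    qed auto
    moreover have "?b - ?a = h" by (simp add: algebra_simps)
    ultimately show ?thesis by simp
  qed
  have "integral {0..T} (\<lambda>t. wave_sup ?m (W t)) = (\<Sum>i<2^j. integral {real i * h..real (Suc i) * h} (\<lambda>t. wave_sup ?m (W t)))"
    using integral_sum_cells[of "\<lambda>t. wave_sup ?m (W t)" "2^j" h "2^j"] integrable_continuous_interval[OF S] h by simp
  also have "\<dots> \<le> (\<Sum>i<2^j. ?R * (l2 (freq_cut ?E (W (real i * h))) + integral {real i * h..real (Suc i) * h} (\<lambda>s. l2 (freq_cut ?E (G s)))))"
    by (intro sum_mono cell) simp
  \<comment> \<open>The data enter once per interval, 2^j times in all, whereas the force integrals
    over the intervals add up to a single one.\<close>
  also have "\<dots> = ?R * ((\<Sum>i<2^j. l2 (freq_cut ?E (W (real i * h)))) + (\<Sum>i<2^j. integral {real i * h..real (Suc i) * h} (\<lambda>s. l2 (freq_cut ?E (G s)))))"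
    by (simp only: sum_distrib_left[symmetric] sum.distrib)
  also have "(\<Sum>i<2^j. integral {real i * h..real (Suc i) * h} (\<lambda>s. l2 (freq_cut ?E (G s)))) = integral {0..T} (\<lambda>s. l2 (freq_cut ?E (G s)))"
    using integral_sum_cells[of "\<lambda>s. l2 (freq_cut ?E (G s))" "2^j" h "2^j"] integrable_continuous_interval[OF Gc] h by simp
  finally show ?thesis by (simp only: h_def)
qed

end

text \<open>Count of the powers of x = 2^j with \<theta> = 2 * \<delta>: the derivative gives 1, the
  number of intervals 1, the kernel \<theta> + (1 - \<alpha>) / 4 * (1 - \<theta>), and the interval
  length - (1 + \<theta>) / 2. At \<delta> = 0 these add up to 3 / 2 + (1 - \<alpha>) / 4, which is
  the origin of \<open>s_crit\<close>; the additional regularity 2 * \<delta> leaves a negative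
  power.\<close>

lemma shell_exponents:
  fixes \<alpha> \<delta> T :: real
  assumes \<alpha>: "0 < \<alpha>" "\<alpha> \<le> 1" and \<delta>: "0 < \<delta>" "\<delta> < 1 / 2" and T: "0 < T"
  shows "2 ^ j * sqrt (2 * shell_const \<alpha> (2 * \<delta>) j / (2 * \<delta>) * (T / 2 ^ j) powr (1 + 2 * \<delta>)) * (2 ^ j * (2 ^ j / 2) powr (- (s_crit \<alpha> + 2 * \<delta>)))
    \<le> sqrt (1 / \<delta> * 4 powr (2 * \<delta>) * (256 / sqrt (2 * \<alpha> * (1 + \<alpha>))) powr (1 - 2 * \<delta>)) * 2 powr (s_crit \<alpha> + 2 * \<delta>)
       * T powr (1 / 2 + \<delta>) * (2 powr (- \<delta>)) ^ j"
proof -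
  define x :: real where "x = 2 ^ j"
  have x: "1 \<le> x" "0 < x" by (auto simp: x_def)
  define C0 where "C0 = 256 / sqrt (2 * \<alpha> * (1 + \<alpha>))"
  define \<theta> where "\<theta> = 2 * \<delta>"
  define s where "s = s_crit \<alpha> + 2 * \<delta>"
  have C0: "0 < C0" using \<alpha> by (simp add: C0_def)
  have pow2: "(x\<^sup>2) powr \<theta> = x powr (2 * \<theta>)" using x by (simp add: powr_powr flip: powr_numeral)
  have D: "shell_const \<alpha> \<theta> j = 4 powr \<theta> * C0 powr (1 - \<theta>) * x powr (2 * \<theta> + (1 - \<alpha>) / 2 * (1 - \<theta>))"
    unfolding shell_const_def x_def[symmetric] C0_def[symmetric]
    by (simp add: powr_mult pow2 powr_powr powr_add)
  have Tx: "(T / x) powr (1 + \<theta>) = T powr (1 + \<theta>) * x powr (- (1 + \<theta>))"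
    by (simp only: powr_divide powr_minus_divide) simp
  have "2 * shell_const \<alpha> \<theta> j / \<theta> * (T / x) powr (1 + \<theta>)
      = (1 / \<delta> * 4 powr \<theta> * C0 powr (1 - \<theta>)) * T powr (1 + \<theta>) * x powr (2 * \<theta> + (1 - \<alpha>) / 2 * (1 - \<theta>) + (- (1 + \<theta>)))"
    unfolding D Tx powr_add[of x _ "- (1 + \<theta>)"] using \<delta> by (simp add: \<theta>_def)
  moreover have "sqrt (y powr e) = y powr (e / 2)" for y e :: real
    by (simp add: powr_half_sqrt[symmetric] powr_powr)
  ultimately have sq: "sqrt (2 * shell_const \<alpha> \<theta> j / \<theta> * (T / x) powr (1 + \<theta>)) = 
     sqrt (1 / \<delta> * 4 powr \<theta> * C0 powr (1 - \<theta>)) * T powr ((1 + \<theta>) / 2) * x powr ((2 * \<theta> + (1 - \<alpha>) / 2 * (1 - \<theta>) + (- (1 + \<theta>))) / 2)"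
    by (simp only: real_sqrt_mult)
  have half: "(x / 2) powr (- s) = 2 powr s * x powr (- s)"
    by (simp add: powr_divide powr_minus_divide)
  have x1: "x = x powr 1" using x by simp
  have "x * sqrt (2 * shell_const \<alpha> \<theta> j / \<theta> * (T / x) powr (1 + \<theta>)) * (x * (x / 2) powr (- s))
     = sqrt (1 / \<delta> * 4 powr \<theta> * C0 powr (1 - \<theta>)) * 2 powr s * T powr ((1 + \<theta>) / 2) * 
       (x * x * x powr ((2 * \<theta> + (1 - \<alpha>) / 2 * (1 - \<theta>) + (- (1 + \<theta>))) / 2) * x powr (- s))"
    unfolding sq half by (simp only: mult_ac)
  also have "x * x * x powr ((2 * \<theta> + (1 - \<alpha>) / 2 * (1 - \<theta>) + (- (1 + \<theta>))) / 2) * x powr (- s)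
     = x powr (1 + 1 + (2 * \<theta> + (1 - \<alpha>) / 2 * (1 - \<theta>) + (- (1 + \<theta>))) / 2 + (- s))"
    using x by (simp only: powr_add powr_one)
  also have "1 + 1 + (2 * \<theta> + (1 - \<alpha>) / 2 * (1 - \<theta>) + (- (1 + \<theta>))) / 2 + (- s) = - \<delta> - \<delta> * (1 - \<alpha>) / 2"
    by (simp add: s_def s_crit_def \<theta>_def field_simps)
  \<comment> \<open>The surplus decay \<delta> * (1 - \<alpha>) / 2 is nonnegative and is given
    away, using x \<ge> 1.\<close>
  also have "sqrt (1 / \<delta> * 4 powr \<theta> * C0 powr (1 - \<theta>)) * 2 powr s * T powr ((1 + \<theta>) / 2) * x powr (- \<delta> - \<delta> * (1 - \<alpha>) / 2)
     \<le> sqrt (1 / \<delta> * 4 powr \<theta> * C0 powr (1 - \<theta>)) * 2 powr s * T powr ((1 + \<theta>) / 2) * x powr (- \<delta>)"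
    using x \<delta> \<alpha> by (intro mult_left_mono powr_mono) auto
  also have "x powr (- \<delta>) = (2 powr (- \<delta>)) ^ j"
    unfolding x_def by (simp add: powr_powr mult.commute flip: powr_realpow)
  also have "(1 + \<theta>) / 2 = 1 / 2 + \<delta>" by (simp add: \<theta>_def)
  finally show ?thesis unfolding x_def s_def \<theta>_def C0_def .
qed

text \<open>The essential supremum controls the solution at almost every time only, but the
  intervals start at the specific times i * T / 2^j. The set where the bound holds is closed and
  contains almost all of the open interval, hence all of [0, T].\<close>

lemma le_esssup_continuous:
  fixes \<phi> :: "real \<Rightarrow> real" and f :: "real \<Rightarrow> ennreal"
  assumes "0 < T" "continuous_on {0..T} \<phi>" "\<And>t. t \<in> {0..T} \<Longrightarrow> f t = ennreal (\<phi> t)" 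
    "\<And>t. t \<in> {0..T} \<Longrightarrow> 0 \<le> \<phi> t" "t \<in> {0..T}"
  shows "ennreal (\<phi> t) \<le> esssup (restrict_space lborel {0..T}) f"
proof (cases "esssup (restrict_space lborel {0..T}) f")
  case (real K)
  have "AE t in restrict_space lborel {0..T}. f t \<le> ennreal K"
    using esssup_AE[of f "restrict_space lborel {0..T}"] real by simp
  then have "AE t in lborel. t \<in> {0..T} \<longrightarrow> f t \<le> ennreal K"
    by (subst (asm) AE_restrict_space_iff) auto
  then have "AE t in lebesgue. t \<in> {0..T} \<longrightarrow> f t \<le> ennreal K" by (rule AE_completion)
  then have ae: "AE t \<in> {0<..<T} in lebesgue. t \<in> {t \<in> {0..T}. \<phi> t \<le> K}"
    by eventually_elim (use assms(3) real in auto)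
  have cl: "closed {t \<in> {0..T}. \<phi> t \<le> K}"
    by (rule continuous_on_closed_Collect_le[OF assms(2)]) (auto intro: continuous_intros)
  have "{0<..<T} \<subseteq> {t \<in> {0..T}. \<phi> t \<le> K}"
    using mem_closed_if_AE_lebesgue_open[OF _ cl ae] by auto
  then have "closure {0<..<T} \<subseteq> {t \<in> {0..T}. \<phi> t \<le> K}" using cl by (rule closure_minimal)
  then have "\<phi> t \<le> K" using assms(1,5) by auto
  then show ?thesis using real by (simp add: ennreal_leI)
qed simp

lemma l2_bessel_continuous:
  assumes "\<And>t. t \<in> {0..T} \<Longrightarrow> bessel s (V t) \<in> L2"
    "\<And>t. t \<in> {0..T} \<Longrightarrow> ((\<lambda>\<tau>. l2 (bessel s (\<lambda>\<zeta>. V \<tau> \<zeta> - V t \<zeta>))) \<longlongrightarrow> 0) (at t within {0..T})"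
  shows "continuous_on {0..T} (\<lambda>t. l2 (bessel s (V t)))"
  by (rule continuous_on_by_modulus[OF assms(2)]) (auto simp: bessel_diff intro!: l2_abs_diff_le assms)

lemma indicator_square_shells: "(\<Sum>j\<le>n. indicator (shell j) \<zeta>) = (indicator (square (2 ^ n)) \<zeta> :: real)"
proof (induction n)
  case (Suc n)
  have "square (2 ^ n) \<subseteq> square (2 ^ Suc n)" by (intro square_mono power_increasing) auto
  then show ?case using Suc by (auto simp: shell_def indicator_def)
qed (simp add: shell_def)

lemma fourier_integral_square_tendsto:
  assumes "integrable lborel f"
  shows "(\<lambda>n. fourier_integral (freq_cut (square (2 ^ n)) f) z) \<longlonglongrightarrow> fourier_integral f z"
proof -
  have [measurable]: "f \<in> borel_measurable borel" using assms by auto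
  have "(\<lambda>n. LINT \<zeta>|lborel. cis (- (\<zeta> \<bullet> z)) * freq_cut (square (2 ^ n)) f \<zeta>) \<longlonglongrightarrow> (LINT \<zeta>|lborel. cis (- (\<zeta> \<bullet> z)) * f \<zeta>)"
  proof (rule integral_dominated_convergence[where w = "\<lambda>\<zeta>. norm (f \<zeta>)"])
    show "AE \<zeta> in lborel. (\<lambda>n. cis (- (\<zeta> \<bullet> z)) * freq_cut (square (2 ^ n)) f \<zeta>) \<longlonglongrightarrow> cis (- (\<zeta> \<bullet> z)) * f \<zeta>"
    proof (intro AE_I2 tendsto_mult tendsto_const)
      fix \<zeta> :: plane
      obtain m :: nat where m: "norm \<zeta> \<le> real m" using real_arch_simple by blast
      have "\<zeta> \<in> square (2 ^ n)" if "n \<ge> m" for n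
      proof -
        have "norm \<zeta> \<le> 2 ^ n"
          using m that of_nat_less_two_power[of n, where 'a=real] by (meson le_less_trans less_imp_le of_nat_mono order_trans)
        then show ?thesis using abs_fst_le_norm[of \<zeta>] abs_snd_le_norm[of \<zeta>]
          by (auto simp: square_def mem_Times_iff abs_le_iff)
      qed
      then have "\<forall>\<^sub>F n in sequentially. freq_cut (square (2 ^ n)) f \<zeta> = f \<zeta>"
        by (auto simp: eventually_sequentially freq_cut_def intro!: exI[of _ m])
      then show "(\<lambda>n. freq_cut (square (2 ^ n)) f \<zeta>) \<longlonglongrightarrow> f \<zeta>" by (rule tendsto_eventually)
    qed
    show "AE \<zeta> in lborel. norm (cis (- (\<zeta> \<bullet> z)) * freq_cut (square (2 ^ n)) f \<zeta>) \<le> norm (f \<zeta>)" for n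
      by (simp add: norm_freq_cut_le)
  qed (use assms in auto)
  then show ?thesis unfolding fourier_integral_def by (intro tendsto_intros)
qed

text \<open>Partial sums over the shells are cuts to squares, whose inverse transforms converge at
  every point by dominated convergence. The series on the right is taken in \<open>ennreal\<close>,
  where it may be infinite.\<close>

lemma norm_fourier_integral_le_suminf:
  assumes "integrable lborel (\<lambda>\<zeta>. M \<zeta> * V \<zeta>)" "V \<in> L2" "\<And>j. freq_cut (shell j) M \<in> L2"
  shows "ennreal (norm (fourier_integral (\<lambda>\<zeta>. M \<zeta> * V \<zeta>) (- z))) \<le> (\<Sum>j. ennreal (wave_sup (freq_cut (shell j) M) V))"
proof (rule LIMSEQ_le_const2)
  let ?f = "\<lambda>\<zeta>. M \<zeta> * V \<zeta>"
  show "(\<lambda>n. ennreal (norm (fourier_integral (freq_cut (square (2 ^ n)) ?f) (- z)))) \<longlonglongrightarrow> ennreal (norm (fourier_integral ?f (- z)))"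
    by (intro tendsto_intros fourier_integral_square_tendsto assms)
  have "ennreal (norm (fourier_integral (freq_cut (square (2 ^ n)) ?f) (- z))) \<le> (\<Sum>j. ennreal (wave_sup (freq_cut (shell j) M) V))" for n
  proof -
    let ?g = "\<lambda>j \<zeta>. freq_cut (shell j) M \<zeta> * V \<zeta>"
    have eq: "freq_cut (square (2 ^ n)) ?f \<zeta> = (\<Sum>j\<le>n. ?g j \<zeta>)" for \<zeta>
      by (simp only: freq_cut_def indicator_square_shells[symmetric] of_real_sum sum_distrib_right mult.assoc)
    have i: "integrable lborel (\<lambda>\<zeta>. cis (- (\<zeta> \<bullet> - z)) * ?g j \<zeta>)" for j
      by (intro integrable_cis_mult L2_mult_integrable assms) measurable
    have "fourier_integral (freq_cut (square (2 ^ n)) ?f) (- z) 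
        = of_real (1 / (2 * pi)) * (LINT \<zeta>|lborel. (\<Sum>j\<le>n. cis (- (\<zeta> \<bullet> - z)) * ?g j \<zeta>))"
      by (simp only: fourier_integral_def eq sum_distrib_left)
    also have "\<dots> = of_real (1 / (2 * pi)) * (\<Sum>j\<le>n. (LINT \<zeta>|lborel. cis (- (\<zeta> \<bullet> - z)) * ?g j \<zeta>))"
      by (subst Bochner_Integration.integral_sum[OF i]) (rule refl)
    also have "\<dots> = (\<Sum>j\<le>n. fourier_integral (?g j) (- z))"
      by (simp only: fourier_integral_def sum_distrib_left)
    finally have eq2: "fourier_integral (freq_cut (square (2 ^ n)) ?f) (- z) = (\<Sum>j\<le>n. fourier_integral (?g j) (- z))" .
    have "norm (fourier_integral (freq_cut (square (2 ^ n)) ?f) (- z)) \<le> (\<Sum>j\<le>n. wave_sup (freq_cut (shell j) M) V)"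
      unfolding eq2 by (intro sum_norm_le wave_sup_upper assms)
    then have "ennreal (norm (fourier_integral (freq_cut (square (2 ^ n)) ?f) (- z))) \<le> ennreal (\<Sum>j\<le>n. wave_sup (freq_cut (shell j) M) V)"
      by (rule ennreal_leI)
    also have "\<dots> = (\<Sum>j\<le>n. ennreal (wave_sup (freq_cut (shell j) M) V))"
      by (intro sum_ennreal[symmetric] wave_sup_nonneg assms)
    also have "\<dots> \<le> (\<Sum>j. ennreal (wave_sup (freq_cut (shell j) M) V))"
      by (rule sum_le_suminf) auto
    finally show ?thesis .
  qed
  then show "\<exists>N. \<forall>n\<ge>N. ennreal (norm (fourier_integral (freq_cut (square (2 ^ n)) ?f) (- z))) \<le> (\<Sum>j. ennreal (wave_sup (freq_cut (shell j) M) V))"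
    by blast
qed

lemma nn_integral_continuous_Icc:
  fixes \<phi> :: "real \<Rightarrow> real"
  assumes "continuous_on {a..b} \<phi>" "\<And>t. t \<in> {a..b} \<Longrightarrow> 0 \<le> \<phi> t"
  shows "(\<integral>\<^sup>+ t\<in>{a..b}. ennreal (\<phi> t) \<partial>lborel) = ennreal (integral {a..b} \<phi>)"
    and "(\<lambda>t. ennreal (\<phi> t) * indicator {a..b} t) \<in> borel_measurable borel"
proof -
  have eq: "ennreal (\<phi> t) * indicator {a..b} t = ennreal (indicator {a..b} t * \<phi> t)" for t
    by (simp add: indicator_def)
  show "(\<integral>\<^sup>+ t\<in>{a..b}. ennreal (\<phi> t) \<partial>lborel) = ennreal (integral {a..b} \<phi>)"
    unfolding eq by (rule nn_integral_has_integral_lebesgue[OF assms(2)])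
      (auto intro: integrable_integral integrable_continuous_interval assms)
  show "(\<lambda>t. ennreal (\<phi> t) * indicator {a..b} t) \<in> borel_measurable borel"
    unfolding eq using borel_measurable_continuous_on_indicator[OF _ assms(1)] by simp
qed

definition strichartz_const :: "real \<Rightarrow> real \<Rightarrow> real" where
  "strichartz_const \<alpha> \<delta> = sqrt (1 / \<delta> * 4 powr (2 * \<delta>) * (256 / sqrt (2 * \<alpha> * (1 + \<alpha>))) powr (1 - 2 * \<delta>)) * 2 powr (s_crit \<alpha> + 2 * \<delta>)"

lemma strichartz_const_pos: "0 < \<alpha> \<Longrightarrow> 0 < \<delta> \<Longrightarrow> 0 < strichartz_const \<alpha> \<delta>"
  by (simp add: strichartz_const_def)

context dispersive_flow
begin

text \<open>Both contributions are brought to the common factor 2^j * (2^j / 2)^(- s): the data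
  acquire 2^j from the number of intervals, the force from its one missing derivative.\<close>

lemma wave_sup_shell_decay:
  assumes \<alpha>: "0 < \<alpha>" "\<alpha> \<le> 1" and \<delta>: "0 < \<delta>" "\<delta> < 1 / 2" and T: "0 < T"
    and M: "M \<in> borel_measurable borel" "\<And>\<zeta>. \<zeta> \<in> shell j \<Longrightarrow> norm (M \<zeta>) \<le> 2 ^ j"
    and s: "s = s_crit \<alpha> + 2 * \<delta>"
    and W': "\<And>t. t \<in> {0..T} \<Longrightarrow> bessel s (W t) \<in> L2" "\<And>t. t \<in> {0..T} \<Longrightarrow> l2 (bessel s (W t)) \<le> K"
    and G': "\<And>t. t \<in> {0..T} \<Longrightarrow> bessel (s - 1) (G t) \<in> L2" "continuous_on {0..T} (\<lambda>t. l2 (bessel (s - 1) (G t)))"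
  shows "integral {0..T} (\<lambda>t. wave_sup (freq_cut (shell j) M) (W t))
     \<le> strichartz_const \<alpha> \<delta> * T powr (1 / 2 + \<delta>) * (2 powr (- \<delta>)) ^ j * (K + integral {0..T} (\<lambda>t. l2 (bessel (s - 1) (G t))))"
proof -
  let ?Y = "integral {0..T} (\<lambda>t. l2 (bessel (s - 1) (G t)))"
  let ?x = "2 ^ j :: real"
  let ?R = "?x * sqrt (2 * shell_const \<alpha> (2 * \<delta>) j / (2 * \<delta>) * (T / ?x) powr (1 + 2 * \<delta>))"
  have "0 \<le> 1 / 4 * (1 - \<alpha>)" using \<alpha> by simp
  then have s1: "1 \<le> s" using \<delta> unfolding s s_crit_def by linarith
  have R0: "0 \<le> ?R" using shell_const_nonneg[of \<alpha> "2 * \<delta>" j] \<delta> by simp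
  have K0: "0 \<le> K" using order_trans[OF l2_nonneg W'(2)[of 0]] T by simp
  have Y0: "0 \<le> ?Y" by (rule Henstock_Kurzweil_Integration.integral_nonneg) (auto intro: integrable_continuous_interval G')
  have Wsum: "(\<Sum>i<2^j. l2 (freq_cut (shell j) (W (real i * (T / ?x))))) \<le> ?x * (?x / 2) powr (- s) * K"
  proof -
    have "l2 (freq_cut (shell j) (W (real i * (T / ?x)))) \<le> (?x / 2) powr (- s) * K" if "i < 2 ^ j" for i
    proof -
      have "real i \<le> ?x" using of_nat_mono[OF less_imp_le[OF that], where 'a=real] by simp
      then have "real i * (T / ?x) \<le> ?x * (T / ?x)" using T by (intro mult_right_mono) auto
      then have t: "real i * (T / ?x) \<in> {0..T}" using T by simp
      show ?thesis
        by (rule order_trans[OF l2_freq_cut_shell_le[OF _ W'(1)[OF t] L2_measurable[OF W[OF t]]] mult_left_mono[OF W'(2)[OF t]]])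
          (use s1 in auto)
    qed
    then have "(\<Sum>i<2^j. l2 (freq_cut (shell j) (W (real i * (T / ?x))))) \<le> (\<Sum>i<(2::nat)^j. (?x / 2) powr (- s) * K)"
      by (intro sum_mono) simp
    then show ?thesis by simp
  qed
  have Gint: "integral {0..T} (\<lambda>t. l2 (freq_cut (shell j) (G t))) \<le> ?x * (?x / 2) powr (- s) * ?Y"
  proof -
    have "integral {0..T} (\<lambda>t. l2 (freq_cut (shell j) (G t))) \<le> integral {0..T} (\<lambda>t. (?x / 2) powr (- (s - 1)) * l2 (bessel (s - 1) (G t)))"
    proof (rule integral_le)
      show "(\<lambda>t. l2 (freq_cut (shell j) (G t))) integrable_on {0..T}"
        by (intro integrable_continuous_interval l2_freq_cut_continuous shell_measurable G G_cont)
      show "(\<lambda>t. (?x / 2) powr (- (s - 1)) * l2 (bessel (s - 1) (G t))) integrable_on {0..T}"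
        by (intro integrable_continuous_interval continuous_intros G')
      show "l2 (freq_cut (shell j) (G t)) \<le> (?x / 2) powr (- (s - 1)) * l2 (bessel (s - 1) (G t))" if "t \<in> {0..T}" for t
        using l2_freq_cut_shell_le[OF _ G'(1)[OF that] L2_measurable[OF G[OF that]], of j] s1 by simp
    qed
    also have "\<dots> = (?x / 2) powr (- (s - 1)) * ?Y" by simp
    also have "(?x / 2) powr (- (s - 1)) = (?x / 2) powr (- s) * (?x / 2)"
      using powr_add[of "?x / 2" "- s" 1] by simp
    also have "(?x / 2) powr (- s) * (?x / 2) * ?Y \<le> ?x * (?x / 2) powr (- s) * ?Y"
      using Y0 by (intro mult_right_mono) auto
    finally show ?thesis .
  qed
  have "integral {0..T} (\<lambda>t. wave_sup (freq_cut (shell j) M) (W t)) \<le> ?R * 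
     ((\<Sum>i<2^j. l2 (freq_cut (shell j) (W (real i * (T / ?x))))) + integral {0..T} (\<lambda>t. l2 (freq_cut (shell j) (G t))))"
    by (rule wave_sup_shell_le[OF \<alpha> _ _ T M]) (use \<delta> in auto)
  also have "\<dots> \<le> ?R * (?x * (?x / 2) powr (- s) * K + ?x * (?x / 2) powr (- s) * ?Y)"
    by (intro mult_left_mono add_mono Wsum Gint R0)
  also have "\<dots> = (?R * (?x * (?x / 2) powr (- s))) * (K + ?Y)" by (simp only: distrib_left mult.assoc)
  also have "\<dots> \<le> (strichartz_const \<alpha> \<delta> * T powr (1 / 2 + \<delta>) * (2 powr (- \<delta>)) ^ j) * (K + ?Y)"
    unfolding s strichartz_const_def using K0 Y0 by (intro mult_right_mono shell_exponents[OF \<alpha> \<delta> T]) (auto simp: s)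
  finally show ?thesis .
qed

text \<open>Triangle inequality over the shells, exchange of the series with the time integral, and
  a geometric series of ratio 2^(- \<delta>), whose sum is the factor 1 / (1 - 2^(- \<delta>)) in
  the constant.\<close>

theorem strichartz_L1_Linf:
  assumes \<alpha>: "0 < \<alpha>" "\<alpha> \<le> 1" and \<delta>: "0 < \<delta>" "\<delta> < 1 / 2" and T: "0 < T"
    and M: "M \<in> borel_measurable borel" "\<And>j \<zeta>. \<zeta> \<in> shell j \<Longrightarrow> norm (M \<zeta>) \<le> 2 ^ j"
    and s: "s = s_crit \<alpha> + 2 * \<delta>"
    and W': "\<And>t. t \<in> {0..T} \<Longrightarrow> bessel s (W t) \<in> L2" "\<And>t. t \<in> {0..T} \<Longrightarrow> l2 (bessel s (W t)) \<le> K"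
    and G': "\<And>t. t \<in> {0..T} \<Longrightarrow> bessel (s - 1) (G t) \<in> L2" "continuous_on {0..T} (\<lambda>t. l2 (bessel (s - 1) (G t)))"
    and MW: "\<And>t. t \<in> {0..T} \<Longrightarrow> integrable lborel (\<lambda>\<zeta>. M \<zeta> * W t \<zeta>)"
    and u: "\<And>t z. t \<in> {0..T} \<Longrightarrow> u t z = fourier_integral (\<lambda>\<zeta>. M \<zeta> * W t \<zeta>) (- z)"
  shows "L1_time_norm T Linf_norm u
     \<le> ennreal (strichartz_const \<alpha> \<delta> / (1 - 2 powr (- \<delta>)) * T powr (1 / 2 + \<delta>)) * (ennreal K + ennreal (integral {0..T} (\<lambda>t. l2 (bessel (s - 1) (G t)))))"
proof -
  let ?Y = "integral {0..T} (\<lambda>t. l2 (bessel (s - 1) (G t)))"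
  let ?S = "\<lambda>j t. wave_sup (freq_cut (shell j) M) (W t)"
  let ?q = "2 powr (- \<delta>)"
  let ?C = "strichartz_const \<alpha> \<delta> * T powr (1 / 2 + \<delta>) * (K + ?Y)"
  have K0: "0 \<le> K" using order_trans[OF l2_nonneg W'(2)[of 0]] T by simp
  have Y0: "0 \<le> ?Y" by (rule Henstock_Kurzweil_Integration.integral_nonneg) (auto intro: integrable_continuous_interval G')
  have C0: "0 \<le> ?C" using strichartz_const_pos[OF \<alpha>(1) \<delta>(1)] K0 Y0 by simp
  have q: "0 < ?q" "?q < 1" using powr_less_mono[of "- \<delta>" 0 2] \<delta> by auto
  have mL: "freq_cut (shell j) M \<in> L2" for j
  proof (rule L2_bounded_support[OF shell_measurable emeasure_shell_finite])
    show "freq_cut (shell j) M \<in> borel_measurable borel" using M(1) by simp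
    show "norm (freq_cut (shell j) M \<zeta>) \<le> 2 ^ j * indicator (shell j) \<zeta>" for \<zeta>
      using M(2)[of \<zeta>] by (auto simp: freq_cut_def indicator_def)
  qed
  have Sc: "continuous_on {0..T} (?S j)" for j by (rule wave_sup_continuous[OF mL W W_cont])
  have S0: "0 \<le> ?S j t" if "t \<in> {0..T}" for j t by (rule wave_sup_nonneg[OF mL W[OF that]])
  have Linf: "Linf_norm (u t) \<le> (\<Sum>j. ennreal (?S j t))" if t: "t \<in> {0..T}" for t
    unfolding Linf_norm_def
  proof (rule esssup_I)
    have [measurable]: "(\<lambda>\<zeta>. M \<zeta> * W t \<zeta>) \<in> borel_measurable borel" using MW[OF t] by auto
    have "u t = (\<lambda>z. fourier_integral (\<lambda>\<zeta>. M \<zeta> * W t \<zeta>) (- z))" using u[OF t] by auto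
    then show "(\<lambda>z. ennreal (norm (u t z))) \<in> borel_measurable lborel" by simp
    show "AE z in lborel. ennreal (norm (u t z)) \<le> (\<Sum>j. ennreal (?S j t))"
      unfolding u[OF t] by (intro AE_I2 norm_fourier_integral_le_suminf MW[OF t] W[OF t] mL)
  qed
  \<comment> \<open>The spatial norm is first majorized by a series of continuous functions of time;
    only this series, whose terms are measurable, is exchanged with the integral.\<close>
  have "L1_time_norm T Linf_norm u \<le> (\<integral>\<^sup>+ t. (\<Sum>j. ennreal (?S j t) * indicator {0..T} t) \<partial>lborel)"
    unfolding L1_time_norm_def
  proof (rule nn_integral_mono)
    fix t show "Linf_norm (u t) * indicator {0..T} t \<le> (\<Sum>j. ennreal (?S j t) * indicator {0..T} t)"
      using Linf[of t] by (auto simp: indicator_def)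
  qed
  also have "\<dots> = (\<Sum>j. \<integral>\<^sup>+ t. ennreal (?S j t) * indicator {0..T} t \<partial>lborel)"
    by (rule nn_integral_suminf) (use nn_integral_continuous_Icc(2)[OF Sc S0] in simp)
  also have "\<dots> = (\<Sum>j. ennreal (integral {0..T} (?S j)))"
    by (simp only: nn_integral_continuous_Icc(1)[OF Sc S0])
  also have "\<dots> \<le> (\<Sum>j. ennreal (?C * ?q ^ j))"
  proof (rule suminf_le)
    show "ennreal (integral {0..T} (?S j)) \<le> ennreal (?C * ?q ^ j)" for j
      using wave_sup_shell_decay[OF \<alpha> \<delta> T M(1) M(2) s W' G', of j] by (intro ennreal_leI) (simp add: mult_ac)
  qed auto
  also have "\<dots> = ennreal (\<Sum>j. ?C * ?q ^ j)"
    by (rule suminf_ennreal2) (use C0 q in \<open>auto intro!: summable_mult summable_geometric\<close>)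
  also have "(\<Sum>j. ?C * ?q ^ j) = ?C * (1 / (1 - ?q))"
    using q by (subst suminf_mult) (auto intro: summable_geometric simp: suminf_geometric)
  also have "?C * (1 / (1 - ?q)) = (strichartz_const \<alpha> \<delta> / (1 - ?q) * T powr (1 / 2 + \<delta>)) * (K + ?Y)" by simp
  also have "ennreal \<dots> = ennreal (strichartz_const \<alpha> \<delta> / (1 - ?q) * T powr (1 / 2 + \<delta>)) * (ennreal K + ennreal ?Y)"
    using K0 Y0 q strichartz_const_pos[OF \<alpha>(1) \<delta>(1)] by (subst ennreal_mult) (auto simp: ennreal_plus)
  finally show ?thesis .
qed

end

section \<open>Application to smooth solutions\<close>

lemma smooth_solution_dispersive_flow:
  assumes "smooth_solution \<alpha> T w F" "0 < \<alpha>" "\<alpha> \<le> 1"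
  shows "dispersive_flow \<alpha> T (\<lambda>t. fourier (w t)) (\<lambda>t. fourier (F t))"
proof
  have C: "C_H_infinity T w" "C_H_infinity T F" using assms by (auto simp: smooth_solution_def)
  fix t assume t: "t \<in> {0..T}"
  have H: "w t \<in> H_infinity" "F t \<in> H_infinity" using C_H_infinity_fourier(1)[OF C(1) t] C_H_infinity_fourier(1)[OF C(2) t] .
  show "fourier (w t) \<in> L2" "fourier (F t) \<in> L2" using H by (auto intro: rapid_L2 H_infinity_rapid)
  show "(\<lambda>\<zeta>. \<i> * of_real (dispersion \<alpha> \<zeta>) * fourier (w t) \<zeta>) \<in> L2"
    using fourier_dispersive_terms[OF H(1) assms(2,3)] is_fourier_L2(2) by blast
  show "((\<lambda>\<tau>. l2 (\<lambda>\<zeta>. fourier (w \<tau>) \<zeta> - fourier (w t) \<zeta>)) \<longlongrightarrow> 0) (at t within {0..T})"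
    using C_H_infinity_fourier(2)[OF C(1) t, of 0] by simp
  show "((\<lambda>\<tau>. l2 (\<lambda>\<zeta>. fourier (F \<tau>) \<zeta> - fourier (F t) \<zeta>)) \<longlongrightarrow> 0) (at t within {0..T})"
    using C_H_infinity_fourier(2)[OF C(2) t, of 0] by simp
  show "((\<lambda>\<tau>. l2 (\<lambda>\<zeta>. (fourier (w \<tau>) \<zeta> - fourier (w t) \<zeta>) / of_real (\<tau> - t)
      - (fourier (F t) \<zeta> - \<i> * of_real (dispersion \<alpha> \<zeta>) * fourier (w t) \<zeta>))) \<longlongrightarrow> 0) (at t within {0..T})"
    by (rule smooth_solution_fourier_derivative[OF assms t])
qed

text \<open>The symbol \<open>M\<close> is left general so that both partial derivatives are
  instances. What is done here is the passage from the \<open>ennreal\<close>-valued norms of the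
  statement to the real quantities of the locale.\<close>

lemma refined_strichartz:
  assumes sol: "smooth_solution \<alpha> T w F" and \<alpha>: "0 < \<alpha>" "\<alpha> \<le> 1" and \<delta>: "0 < \<delta>" "\<delta> < 1 / 2" and T: "0 < T"
    and M: "M \<in> borel_measurable borel" "\<And>j \<zeta>. \<zeta> \<in> shell j \<Longrightarrow> norm (M \<zeta>) \<le> 2 ^ j"
    and MW: "\<And>t. t \<in> {0..T} \<Longrightarrow> (\<lambda>\<zeta>. M \<zeta> * fourier (w t) \<zeta>) \<in> rapid"
    and u: "\<And>t. t \<in> {0..T} \<Longrightarrow> u t = (\<lambda>z. fourier_integral (\<lambda>\<zeta>. M \<zeta> * fourier (w t) \<zeta>) (- z))"
  shows "L1_time_norm T Linf_norm u
     \<le> ennreal (strichartz_const \<alpha> \<delta> / (1 - 2 powr (- \<delta>)) * T powr (1 / 2 + \<delta>)) * 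
        (Linf_time_norm T (sobolev_norm (s_crit \<alpha> + 2 * \<delta>)) w
             + (\<integral>\<^sup>+ t\<in>{0..T}. sobolev_norm (s_crit \<alpha> - 1 + 2 * \<delta>) (F t) \<partial>lborel))"
proof -
  interpret dispersive_flow \<alpha> T "\<lambda>t. fourier (w t)" "\<lambda>t. fourier (F t)"
    by (rule smooth_solution_dispersive_flow[OF sol \<alpha>])
  define s where "s = s_crit \<alpha> + 2 * \<delta>"
  have s1: "s_crit \<alpha> - 1 + 2 * \<delta> = s - 1" by (simp add: s_def)
  have "0 \<le> 1 / 4 * (1 - \<alpha>)" using \<alpha> by simp
  then have s0: "0 \<le> s" "0 \<le> s - 1" using \<delta> unfolding s_def s_crit_def by linarith+
  have C: "C_H_infinity T w" "C_H_infinity T F" using sol by (auto simp: smooth_solution_def)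
  note Cw = C_H_infinity_fourier[OF C(1)] and CF = C_H_infinity_fourier[OF C(2)]
  have bw: "bessel r (fourier (w t)) \<in> L2" and bF: "bessel r (fourier (F t)) \<in> L2" if "t \<in> {0..T}" "0 \<le> r" for t r
    using Cw(1)[OF that(1)] CF(1)[OF that(1)] that(2) by (auto intro: rapid_bessel_L2 H_infinity_rapid)
  have sob: "sobolev_norm r (w t) = ennreal (l2 (bessel r (fourier (w t))))" 
    "sobolev_norm r (F t) = ennreal (l2 (bessel r (fourier (F t))))" if "t \<in> {0..T}" "0 \<le> r" for t r
    using sobolev_norm_eq L2_norm_eq bw[OF that] bF[OF that] H_infinity_L2 Cw(1)[OF that(1)] CF(1)[OF that(1)] by auto
  have cw: "continuous_on {0..T} (\<lambda>t. l2 (bessel s (fourier (w t))))"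
    by (rule l2_bessel_continuous[OF bw Cw(2)]) (use s0 in auto)
  have cF: "continuous_on {0..T} (\<lambda>t. l2 (bessel (s - 1) (fourier (F t))))"
    by (rule l2_bessel_continuous[OF bF CF(2)]) (use s0 in auto)
  let ?c = "strichartz_const \<alpha> \<delta> / (1 - 2 powr (- \<delta>)) * T powr (1 / 2 + \<delta>)"
  let ?B = "Linf_time_norm T (sobolev_norm s) w"
  have c0: "0 < ?c"
    using strichartz_const_pos[OF \<alpha>(1) \<delta>(1)] T powr_less_mono[of "- \<delta>" 0 2] \<delta> by simp
  have Y: "(\<integral>\<^sup>+ t\<in>{0..T}. sobolev_norm (s - 1) (F t) \<partial>lborel) = ennreal (integral {0..T} (\<lambda>t. l2 (bessel (s - 1) (fourier (F t)))))"
  proof -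
    have "(\<integral>\<^sup>+ t\<in>{0..T}. sobolev_norm (s - 1) (F t) \<partial>lborel) = (\<integral>\<^sup>+ t\<in>{0..T}. ennreal (l2 (bessel (s - 1) (fourier (F t)))) \<partial>lborel)"
      using sob(2) s0 by (intro nn_integral_cong) (auto simp: indicator_def)
    also have "\<dots> = ennreal (integral {0..T} (\<lambda>t. l2 (bessel (s - 1) (fourier (F t)))))"
      by (rule nn_integral_continuous_Icc(1)[OF cF]) simp
    finally show ?thesis .
  qed
  have Wle: "ennreal (l2 (bessel s (fourier (w t)))) \<le> ?B" if "t \<in> {0..T}" for t
    unfolding Linf_time_norm_def
    by (rule le_esssup_continuous[OF T cw sob(1) _ that]) (use s0 in auto)
  have "L1_time_norm T Linf_norm u \<le> ennreal ?c * (?B + (\<integral>\<^sup>+ t\<in>{0..T}. sobolev_norm (s - 1) (F t) \<partial>lborel))"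
  proof (cases ?B)
    case (real K)
    have "l2 (bessel s (fourier (w t))) \<le> K" if "t \<in> {0..T}" for t
      using Wle[OF that] real by simp
    then show ?thesis
      unfolding Y real(2)
      by (intro strichartz_L1_Linf[OF \<alpha> \<delta> T M s_def bw _ bF cF rapid_integrable[OF MW]]) (use s0 u in auto)
  next
    case top
    \<comment> \<open>An infinite essential supremum makes the right-hand side infinite because the
      constant in front is strictly positive.\<close>
    have ne: "ennreal ?c \<noteq> 0" using c0 by (simp only: ennreal_eq_0_iff not_le)
    show ?thesis by (simp only: top add_top_left_ennreal ennreal_top_mult_left[OF ne] top_greatest)
  qed
  then show ?thesis unfolding s1 s_def .
qed

lemma norm_coordinate_shell_le:
  assumes "\<zeta> \<in> shell j"
  shows "norm (\<i> * complex_of_real (fst \<zeta>)) \<le> 2 ^ j" "norm (\<i> * complex_of_real (snd \<zeta>)) \<le> 2 ^ j"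
  using shell_subset[of j] assms by (auto simp: norm_mult square_def abs_le_iff mem_Times_iff)

theorem lemma3p4:
  fixes \<alpha> :: real
  assumes "0 < \<alpha>" and "\<alpha> \<le> 1"
  shows "\<exists>\<delta>\<^sub>0>0. \<forall>\<delta>::real. 0 < \<delta> \<and> \<delta> < \<delta>\<^sub>0 \<longrightarrow>
    (\<exists>k c :: real. 1 / 2 < k \<and> k < 1 \<and> 0 < c \<and>
      (\<forall>T>0. \<forall>w F. smooth_solution \<alpha> T w F \<longrightarrow>
        L1_time_norm T Linf_norm (\<lambda>t. partial_x (w t))
          \<le> ennreal (c * T powr k) *
            (Linf_time_norm T (sobolev_norm (s_crit \<alpha> + 2 * \<delta>)) w
             + (\<integral>\<^sup>+ t\<in>{0..T}. sobolev_norm (s_crit \<alpha> - 1 + 2 * \<delta>) (F t) \<partial>lborel))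
        \<and>
        L1_time_norm T Linf_norm (\<lambda>t. partial_y (w t))
          \<le> ennreal (c * T powr k) *
            (Linf_time_norm T (sobolev_norm (s_crit \<alpha> + 2 * \<delta>)) w
             + (\<integral>\<^sup>+ t\<in>{0..T}. sobolev_norm (s_crit \<alpha> - 1 + 2 * \<delta>) (F t) \<partial>lborel))))"
proof (rule exI[of _ "1 / 2"], safe)
  \<comment> \<open>The threshold 1 / 2 serves two ends: the interpolation parameter 2 * \<delta>
    has to be below 1, and so has the power k = 1 / 2 + \<delta> of T.\<close>
  fix \<delta> :: real assume \<delta>: "0 < \<delta>" "\<delta> < 1 / 2"
  define c where "c = strichartz_const \<alpha> \<delta> / (1 - 2 powr (- \<delta>))"
  have c: "0 < c"
    using strichartz_const_pos[OF assms(1) \<delta>(1)] powr_less_mono[of "- \<delta>" 0 2] \<delta> by (simp add: c_def)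
  let ?B = "\<lambda>T w F. ennreal (c * T powr (1 / 2 + \<delta>)) * (Linf_time_norm T (sobolev_norm (s_crit \<alpha> + 2 * \<delta>)) w
      + (\<integral>\<^sup>+ t\<in>{0..T}. sobolev_norm (s_crit \<alpha> - 1 + 2 * \<delta>) (F t) \<partial>lborel))"
  have "L1_time_norm T Linf_norm (\<lambda>t. partial_x (w t)) \<le> ?B T w F \<and> L1_time_norm T Linf_norm (\<lambda>t. partial_y (w t)) \<le> ?B T w F"
    if T: "0 < T" and sol: "smooth_solution \<alpha> T w F" for T w F
  proof -
    have H: "w t \<in> H_infinity" if "t \<in> {0..T}" for t
      using C_H_infinity_fourier(1)[OF _ that] sol by (auto simp: smooth_solution_def)
    \<comment> \<open>Both symbols, i \<xi> and i \<eta>, are at most 2^j on the j-th shell, so the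
      same constant serves the two inequalities.\<close>
    note * = refined_strichartz[OF sol assms \<delta> T, folded c_def]
    have "L1_time_norm T Linf_norm (\<lambda>t. partial_x (w t)) \<le> ?B T w F"
      by (rule *[OF _ norm_coordinate_shell_le(1) rapid_fst[OF H_infinity_rapid[OF H]] partial_x_eq[OF H]])
        (auto simp: borel_prod[symmetric])
    moreover have "L1_time_norm T Linf_norm (\<lambda>t. partial_y (w t)) \<le> ?B T w F"
      by (rule *[OF _ norm_coordinate_shell_le(2) rapid_snd[OF H_infinity_rapid[OF H]] partial_y_eq[OF H]])
        (auto simp: borel_prod[symmetric])
    ultimately show ?thesis ..
  qed
  then show "\<exists>k c. 1 / 2 < k \<and> k < 1 \<and> 0 < c \<and>
      (\<forall>T>0. \<forall>w F. smooth_solution \<alpha> T w F \<longrightarrow>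
        L1_time_norm T Linf_norm (\<lambda>t. partial_x (w t))
          \<le> ennreal (c * T powr k) *
            (Linf_time_norm T (sobolev_norm (s_crit \<alpha> + 2 * \<delta>)) w
             + (\<integral>\<^sup>+ t\<in>{0..T}. sobolev_norm (s_crit \<alpha> - 1 + 2 * \<delta>) (F t) \<partial>lborel))
        \<and>
        L1_time_norm T Linf_norm (\<lambda>t. partial_y (w t))
          \<le> ennreal (c * T powr k) *
            (Linf_time_norm T (sobolev_norm (s_crit \<alpha> + 2 * \<delta>)) w
             + (\<integral>\<^sup>+ t\<in>{0..T}. sobolev_norm (s_crit \<alpha> - 1 + 2 * \<delta>) (F t) \<partial>lborel)))"
    using c \<delta> by (intro exI[of _ "1 / 2 + \<delta>"] exI[of _ c]) auto
qed simp

end
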